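(* Let $M$ be generalised measurable. Then $M^{\mathrm{eq}}$ is generalised measurable.
   Context: Measuring semirings. An ordered semiring $S=(S,+,\cdot,0,1,<)$ satisfies: $(S,+,0)$ and $(S,\cdot,1)$ are commutative monoids; $\cdot$ distributes over $+$; $<$ is a total order with least element $0$; $x\le y\Rightarrow x+z\le y+z$; $x\le y\Rightarrow xz\le yz$; $0\cdot x=x\cdot 0=0$; $0<x,\ 0<y\Rightarrow 0<xy$; $0\ne1$. Write $a\sim b$ if $a\le b\le n\cdot a$ or $b\le a\le n\cdot b$ for some positive integer $n$, and let $d:S\to S/{\sim}$ be the quotient map. $S$ is a measuring semiring if in addition for all $x,y,z\in S$: if $x<y$ and $d(y)=d(z)$ then $x+z<y+z$. Generalised measurability. $\mathrm{Def}(M)$ is the collection of sets (in cartesian products of sorts of $M$) definable in $M$ with parameters. For a measuring semiring $S$, an $L$-structure $M$ is $S$-measurable if there is $h:\mathrm{Def}(M)\to S$ such that: (1) $h(X)=|X|$ (i.e. $|X|\cdot1$) for finite $X$; (2) $h(X\cup Y)=h(X)+h(Y)$ for disjoint $X,Y\in\mathrm{Def}(M)$; (3) for each family $\{\phi(M^{|\bar x|};\bar b):\bar b\in M^{|\bar y|}\}$ given by an $L$-formula $\phi(\bar x;\bar y)$, the set $F$ of values of $h$ on the family is finite, and for each $f\in F$ the set $\{\bar b:h(\phi(M^{|\bar x|};\bar b))=f\}$ is $\emptyset$-definable; (4) if $p:X\to Y$ is a definable function and $f\in S$ is such that $h(p^{-1}(a))=f$ for all $a\in Y$, then $h(X)=f\cdot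 h(Y)$. $M$ is generalised measurable if it is $S$-measurable for some measuring semiring $S$. $M^{\mathrm{eq}}$ is the usual many-sorted expansion of $M$ by sorts for all quotients by $\emptyset$-definable equivalence relations. *)

theory Defs
  imports "HOL-Algebra.Ring"
begin

section \<open>Ordered and measuring semirings\<close>

record 'v ord_ring = "'v ring" +
  lt :: "'v \<Rightarrow> 'v \<Rightarrow> bool"  (infixl "\<prec>\<index>" 50)

definition leq :: "('v, 'b) ord_ring_scheme \<Rightarrow> 'v \<Rightarrow> 'v \<Rightarrow> bool"  (infixl "\<preceq>\<index>" 50) where
  "x \<preceq>\<^bsub>S\<^esub> y \<longleftrightarrow> x \<prec>\<^bsub>S\<^esub> y \<or> x = y"

locale ord_semiring = semiring S + comm_monoid S for S (structure) +
  assumes less_irrefl: "x \<in> carrier S \<Longrightarrow> \<not> x \<prec> x"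
    and less_trans: "\<lbrakk>x \<in> carrier S; y \<in> carrier S; z \<in> carrier S; x \<prec> y; y \<prec> z\<rbrakk> \<Longrightarrow> x \<prec> z"
    and less_total: "\<lbrakk>x \<in> carrier S; y \<in> carrier S\<rbrakk> \<Longrightarrow> x \<prec> y \<or> x = y \<or> y \<prec> x"
    and zero_leq: "x \<in> carrier S \<Longrightarrow> \<zero> \<preceq> x"
    and add_leq_mono:
      "\<lbrakk>x \<in> carrier S; y \<in> carrier S; z \<in> carrier S; x \<preceq> y\<rbrakk> \<Longrightarrow> x \<oplus> z \<preceq> y \<oplus> z"
    and mult_leq_mono:
      "\<lbrakk>x \<in> carrier S; y \<in> carrier S; z \<in> carrier S; x \<preceq> y\<rbrakk> \<Longrightarrow> x \<otimes> z \<preceq> y \<otimes> z"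
    and mult_pos: "\<lbrakk>x \<in> carrier S; y \<in> carrier S; \<zero> \<prec> x; \<zero> \<prec> y\<rbrakk> \<Longrightarrow> \<zero> \<prec> x \<otimes> y"
    and zero_not_one: "\<zero> \<noteq> \<one>"

definition sim_rel :: "('v, 'b) ord_ring_scheme \<Rightarrow> ('v \<times> 'v) set" where
  "sim_rel S = {(a, b) \<in> carrier S \<times> carrier S. \<exists>n::nat > 0.
     (a \<preceq>\<^bsub>S\<^esub> b \<and> b \<preceq>\<^bsub>S\<^esub> [n] \<cdot>\<^bsub>S\<^esub> a) \<or> (b \<preceq>\<^bsub>S\<^esub> a \<and> a \<preceq>\<^bsub>S\<^esub> [n] \<cdot>\<^bsub>S\<^esub> b)}"

text \<open>
  \<open>dim_class S\<close> is the quotient map \<open>d\<close> from \<open>S\<close> onto its classes modulo \<open>sim_rel S\<close>.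
\<close>

definition dim_class :: "('v, 'b) ord_ring_scheme \<Rightarrow> 'v \<Rightarrow> 'v set" where
  "dim_class S x = sim_rel S `` {x}"

locale measuring_semiring = ord_semiring +
  assumes add_less_mono:
    "\<lbrakk>x \<in> carrier S; y \<in> carrier S; z \<in> carrier S; x \<prec> y; dim_class S y = dim_class S z\<rbrakk>
     \<Longrightarrow> x \<oplus> z \<prec> y \<oplus> z"


section \<open>Many-sorted first-order structures\<close>

text \<open>
  A structure carries its own language.  Sorts are interpreted by sets in one ambient type;
  these sets need not be disjoint, so definable sets will always be recorded together
  with the list of sorts of their coordinates.  Sorts are allowed to be empty.
\<close>

record ('s, 'f, 'r) language =
  sorts :: "'s set"
  funs :: "'f set"
  fun_dom :: "'f \<Rightarrow> 's list"
  fun_cod :: "'f \<Rightarrow> 's"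
  rels :: "'r set"
  rel_dom :: "'r \<Rightarrow> 's list"

record ('s, 'f, 'r, 'a) struct = "('s, 'f, 'r) language" +
  universe :: "'s \<Rightarrow> 'a set"
  fun_interp :: "'f \<Rightarrow> 'a list \<Rightarrow> 'a"
  rel_interp :: "'r \<Rightarrow> 'a list \<Rightarrow> bool"

definition tuples :: "('s, 'f, 'r, 'a) struct \<Rightarrow> 's list \<Rightarrow> 'a list set" where
  "tuples M ss = {xs. list_all2 (\<lambda>x s. x \<in> universe M s) xs ss}"

locale many_sorted_structure =
  fixes M :: "('s, 'f, 'r, 'a) struct"
  assumes fun_dom_sorts: "f \<in> funs M \<Longrightarrow> set (fun_dom M f) \<subseteq> sorts M"
    and fun_cod_sorts: "f \<in> funs M \<Longrightarrow> fun_cod M f \<in> sorts M"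
    and rel_dom_sorts: "r \<in> rels M \<Longrightarrow> set (rel_dom M r) \<subseteq> sorts M"
    and fun_interp_closed:
      "f \<in> funs M \<Longrightarrow> xs \<in> tuples M (fun_dom M f) \<Longrightarrow> fun_interp M f xs \<in> universe M (fun_cod M f)"

text \<open>
  Variables are de Bruijn indices into a context, i.e. the list of the sorts of the free variables;
  \<open>FEx s \<phi>\<close> binds index \<open>0\<close> of \<open>\<phi>\<close>, which ranges over the sort \<open>s\<close>.
\<close>

datatype 'f trm = Var nat | Fn 'f "'f trm list"

datatype ('s, 'f, 'r) form =
    FBot
  | FEq "'f trm" "'f trm"
  | FRel 'r "'f trm list"
  | FNeg "('s, 'f, 'r) form"
  | FAnd "('s, 'f, 'r) form" "('s, 'f, 'r) form"
  | FEx 's "('s, 'f, 'r) form"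

inductive has_sort :: "('s, 'f, 'r, 'b) language_scheme \<Rightarrow> 's list \<Rightarrow> 'f trm \<Rightarrow> 's \<Rightarrow> bool"
  for L \<Gamma> where
  "i < length \<Gamma> \<Longrightarrow> has_sort L \<Gamma> (Var i) (\<Gamma> ! i)"
| "f \<in> funs L \<Longrightarrow> list_all2 (has_sort L \<Gamma>) ts (fun_dom L f) \<Longrightarrow> has_sort L \<Gamma> (Fn f ts) (fun_cod L f)"

primrec formula :: "('s, 'f, 'r, 'b) language_scheme \<Rightarrow> 's list \<Rightarrow> ('s, 'f, 'r) form \<Rightarrow> bool" where
  "formula L \<Gamma> FBot \<longleftrightarrow> True"
| "formula L \<Gamma> (FEq t u) \<longleftrightarrow> (\<exists>s. has_sort L \<Gamma> t s \<and> has_sort L \<Gamma> u s)"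
| "formula L \<Gamma> (FRel r ts) \<longleftrightarrow> r \<in> rels L \<and> list_all2 (has_sort L \<Gamma>) ts (rel_dom L r)"
| "formula L \<Gamma> (FNeg \<phi>) \<longleftrightarrow> formula L \<Gamma> \<phi>"
| "formula L \<Gamma> (FAnd \<phi> \<psi>) \<longleftrightarrow> formula L \<Gamma> \<phi> \<and> formula L \<Gamma> \<psi>"
| "formula L \<Gamma> (FEx s \<phi>) \<longleftrightarrow> s \<in> sorts L \<and> formula L (s # \<Gamma>) \<phi>"

primrec eval :: "('s, 'f, 'r, 'a) struct \<Rightarrow> 'a list \<Rightarrow> 'f trm \<Rightarrow> 'a" where
  "eval M v (Var i) = v ! i"
| "eval M v (Fn f ts) = fun_interp M f (map (eval M v) ts)"

primrec sat :: "('s, 'f, 'r, 'a) struct \<Rightarrow> 'a list \<Rightarrow> ('s, 'f, 'r) form \<Rightarrow> bool" where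
  "sat M v FBot \<longleftrightarrow> False"
| "sat M v (FEq t u) \<longleftrightarrow> eval M v t = eval M v u"
| "sat M v (FRel r ts) \<longleftrightarrow> rel_interp M r (map (eval M v) ts)"
| "sat M v (FNeg \<phi>) \<longleftrightarrow> \<not> sat M v \<phi>"
| "sat M v (FAnd \<phi> \<psi>) \<longleftrightarrow> sat M v \<phi> \<and> sat M v \<psi>"
| "sat M v (FEx s \<phi>) \<longleftrightarrow> (\<exists>a \<in> universe M s. sat M (a # v) \<phi>)"


section \<open>Definable sets\<close>

definition solutions ::
  "('s, 'f, 'r, 'a) struct \<Rightarrow> 's list \<Rightarrow> ('s, 'f, 'r) form \<Rightarrow> 'a list \<Rightarrow> 'a list set" where
  "solutions M xs \<phi> b = {a \<in> tuples M xs. sat M (a @ b) \<phi>}"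

text \<open>
  In a formula \<open>\<phi>(x; y)\<close> the context is the concatenation of the sorts of \<open>x\<close> and of \<open>y\<close>.
  \<open>Def M\<close> allows parameters, \<open>Def0 M\<close> does not.
\<close>

definition Def :: "('s, 'f, 'r, 'a) struct \<Rightarrow> ('s list \<times> 'a list set) set" where
  "Def M = {(xs, solutions M xs \<phi> b) | xs ys \<phi> b.
     set xs \<subseteq> sorts M \<and> set ys \<subseteq> sorts M \<and> formula M (xs @ ys) \<phi> \<and> b \<in> tuples M ys}"

definition Def0 :: "('s, 'f, 'r, 'a) struct \<Rightarrow> ('s list \<times> 'a list set) set" where
  "Def0 M = {(xs, solutions M xs \<phi> []) | xs \<phi>. set xs \<subseteq> sorts M \<and> formula M xs \<phi>}"

definition definable_function ::
  "('s, 'f, 'r, 'a) struct \<Rightarrow> 's list \<times> 'a list set \<Rightarrow> 's list \<times> 'a list set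
    \<Rightarrow> ('a list \<Rightarrow> 'a list) \<Rightarrow> bool" where
  "definable_function M X Y p \<longleftrightarrow> X \<in> Def M \<and> Y \<in> Def M \<and> p \<in> snd X \<rightarrow> snd Y \<and>
     (fst X @ fst Y, {x @ p x | x. x \<in> snd X}) \<in> Def M"


section \<open>Generalised measurability\<close>

locale measurable_structure = many_sorted_structure M + measuring_semiring S
  for M :: "('s, 'f, 'r, 'a) struct" and S :: "('v, 'b) ord_ring_scheme" (structure) +
  fixes h :: "'s list \<times> 'a list set \<Rightarrow> 'v"
  assumes h_closed: "h \<in> Def M \<rightarrow> carrier S"
    and h_finite: "\<lbrakk>(xs, X) \<in> Def M; finite X\<rbrakk> \<Longrightarrow> h (xs, X) = [card X] \<cdot> \<one>"
    and h_disjoint_Un: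
      "\<lbrakk>(xs, X) \<in> Def M; (xs, Y) \<in> Def M; X \<inter> Y = {}\<rbrakk> \<Longrightarrow> h (xs, X \<union> Y) = h (xs, X) \<oplus> h (xs, Y)"
    and h_family_finite:
      "\<lbrakk>set xs \<subseteq> sorts M; set ys \<subseteq> sorts M; formula M (xs @ ys) \<phi>\<rbrakk>
       \<Longrightarrow> finite {h (xs, solutions M xs \<phi> b) | b. b \<in> tuples M ys}"
    and h_family_definable:
      "\<lbrakk>set xs \<subseteq> sorts M; set ys \<subseteq> sorts M; formula M (xs @ ys) \<phi>;
        f \<in> {h (xs, solutions M xs \<phi> b) | b. b \<in> tuples M ys}\<rbrakk>
       \<Longrightarrow> (ys, {b \<in> tuples M ys. h (xs, solutions M xs \<phi> b) = f}) \<in> Def0 M"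
    and h_fibres:
      "\<lbrakk>definable_function M (xs, X) (ys, Y) p; f \<in> carrier S;
        \<And>a. a \<in> Y \<Longrightarrow> h (xs, {x \<in> X. p x = a}) = f\<rbrakk>
       \<Longrightarrow> h (xs, X) = f \<otimes> h (ys, Y)"

text \<open>
  HOL cannot quantify existentially over types, so the type \<open>'v\<close> in which the
  carrier of the semiring lives is a parameter.
\<close>

definition generalised_measurable :: "'v itself \<Rightarrow> ('s, 'f, 'r, 'a) struct \<Rightarrow> bool" where
  "generalised_measurable _ M \<longleftrightarrow> (\<exists>(S :: 'v ord_ring) h. measurable_structure M S h)"


section \<open>Imaginaries\<close>

text \<open>
  There is one quotient sort \<open>Quot ss E\<close> for each list of sorts \<open>ss\<close> and each \<open>E\<close> that is a
  definable (without parameters) equivalence relation on the tuples of sort \<open>ss\<close>.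
\<close>

definition def_equivs :: "('s, 'f, 'r, 'a) struct \<Rightarrow> ('s list \<times> ('a list \<times> 'a list) set) set" where
  "def_equivs M = {(ss, E). set ss \<subseteq> sorts M \<and> equiv (tuples M ss) E \<and>
     (ss @ ss, {a @ b | a b. (a, b) \<in> E}) \<in> Def0 M}"

datatype ('s, 'a) eq_sort = Home 's | Quot "'s list" "('a list \<times> 'a list) set"

datatype ('s, 'f, 'a) eq_fun = Old 'f | Proj "'s list" "('a list \<times> 'a list) set"

datatype 'a eq_elem = Elem (the_elem: 'a) | Class "'a list set"

definition Meq ::
  "('s, 'f, 'r, 'a) struct \<Rightarrow> (('s, 'a) eq_sort, ('s, 'f, 'a) eq_fun, 'r, 'a eq_elem) struct" where
  "Meq M = \<lparr>
     sorts = Home ` sorts M \<union> {Quot ss E | ss E. (ss, E) \<in> def_equivs M},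
     funs = Old ` funs M \<union> {Proj ss E | ss E. (ss, E) \<in> def_equivs M},
     fun_dom = (\<lambda>g. case g of Old f \<Rightarrow> map Home (fun_dom M f) | Proj ss E \<Rightarrow> map Home ss),
     fun_cod = (\<lambda>g. case g of Old f \<Rightarrow> Home (fun_cod M f) | Proj ss E \<Rightarrow> Quot ss E),
     rels = rels M,
     rel_dom = (\<lambda>r. map Home (rel_dom M r)),
     universe = (\<lambda>s. case s of Home t \<Rightarrow> Elem ` universe M t
                             | Quot ss E \<Rightarrow> Class ` (tuples M ss // E)),
     fun_interp = (\<lambda>g xs. case g of Old f \<Rightarrow> Elem (fun_interp M f (map the_elem xs))
                                  | Proj ss E \<Rightarrow> Class (E `` {map the_elem xs})),
     rel_interp = (\<lambda>r xs. rel_interp M r (map the_elem xs))\<rparr>"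

end

theory Submission
  imports Defs
begin

text \<open>
  A tuple of elements of \<open>Meq M\<close> is represented by a tuple of elements of \<open>M\<close>: replace each class by one
  of its members.  This gives a surjection \<open>proj\<close> from tuples of \<open>M\<close> to tuples of \<open>Meq M\<close>, and everything
  that is definable in \<open>Meq M\<close> becomes definable in \<open>M\<close> after pulling back along \<open>proj\<close> (and, without
  parameters, conversely: \<open>dfn_Meq_iff\<close>).  The fibres of \<open>proj\<close> form a definable family in \<open>M\<close>, so only
  finitely many measures \<open>e\<close> of fibres occur, and the pullback of a definable set \<open>Z\<close> splits definably
  into the parts \<open>Z\<^sub>e\<close> that consist of the tuples with fibre of measure \<open>e\<close>.  A measure on \<open>Meq M\<close> that
  extends \<open>h\<close> should therefore send \<open>Z\<close> to the sum of the quotients of \<open>h Z\<^sub>e\<close> by \<open>e\<close>; this is taken as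
  the definition (\<open>weigh\<close>, \<open>heq\<close>).  Since it refers to \<open>Z\<close> alone, nothing has to be shown independent of a choice.

  The quotients live in a different semiring.  A measuring semiring need not be cancellative for
  multiplication, because products may lose infinitesimal differences.  Nonzero factors can be cancelled when
  \<open>x\<close> and \<open>y\<close> are identified as soon as they differ by less than every fraction \<open>1/n\<close> of their
  size, that is, when \<open>x \<le> y\<close> is weakened to the condition that \<open>n x \<le> (n + 1) y\<close> for all \<open>n\<close> (\<open>coarse_leq_mult_cancel\<close>).
  This identification respects the operations and the measuring axiom (\<open>coarse_less_add\<close>), and it
  identifies nothing with \<open>0\<close> (\<open>coarse_leq_zero\<close>).
  The fractions over the resulting semiring form a measuring semiring; as \<open>S\<close> is infinite, \<open>S \<times> S\<close> is no
  larger than \<open>S\<close>, so the fractions can be coded by elements of the type of \<open>S\<close> (\<open>fraction_semiring\<close>).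

  Additivity and definability in families are inherited from \<open>h\<close> summand by summand.  The axiom on
  fibres of \<open>p : X \<rightarrow> Y\<close> is a double count (\<open>weigh_fibres_uniform\<close>).  Suppose that all fibres of
  \<open>proj\<close> over \<open>Y\<close> have the same measure \<open>g\<close>, and that, for each \<open>e\<close>, the part of measure \<open>e\<close> in the
  pullback of \<open>p\<^sup>-\<^sup>1 a\<close> has a measure \<open>\<kappa>\<^sub>e\<close> that is independent of \<open>a\<close>.  Let \<open>W\<close> be the set of pairs \<open>(v, w)\<close> of
  representatives with \<open>p (proj v) = proj w\<close> and fibre of measure \<open>e\<close> at \<open>v\<close>.  Projecting \<open>W\<close> to either
  side gives \<open>g h(X\<^sub>e) = h(W) = \<kappa>\<^sub>e h(Y\<^sub>g)\<close>; divide by \<open>e g\<close> and sum over \<open>e\<close>.  In general \<open>Y\<close> is the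
  disjoint union of finitely many definable pieces over which these measures are constant (\<open>weigh_fibres\<close>).
\<close>

section \<open>Archimedean comparison in a measuring semiring\<close>

context ord_semiring
begin

lemma leq_refl [simp]: "x \<preceq> x"
  by (simp add: leq_def)

lemma less_imp_leq: "x \<prec> y \<Longrightarrow> x \<preceq> y"
  by (simp add: leq_def)

lemma leq_trans:
  "\<lbrakk>x \<preceq> y; y \<preceq> z; x \<in> carrier S; y \<in> carrier S; z \<in> carrier S\<rbrakk> \<Longrightarrow> x \<preceq> z"
  unfolding leq_def using less_trans by blast

lemma leq_less_trans:
  "\<lbrakk>x \<preceq> y; y \<prec> z; x \<in> carrier S; y \<in> carrier S; z \<in> carrier S\<rbrakk> \<Longrightarrow> x \<prec> z"
  unfolding leq_def using less_trans by blast

lemma less_leq_trans: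
  "\<lbrakk>x \<prec> y; y \<preceq> z; x \<in> carrier S; y \<in> carrier S; z \<in> carrier S\<rbrakk> \<Longrightarrow> x \<prec> z"
  unfolding leq_def using less_trans by blast

lemma not_leq: "\<lbrakk>x \<in> carrier S; y \<in> carrier S\<rbrakk> \<Longrightarrow> \<not> x \<preceq> y \<longleftrightarrow> y \<prec> x"
  unfolding leq_def using less_total less_irrefl less_trans by blast

lemma leq_total: "\<lbrakk>x \<in> carrier S; y \<in> carrier S\<rbrakk> \<Longrightarrow> x \<preceq> y \<or> y \<preceq> x"
  unfolding leq_def using less_total by blast

lemma zero_less_iff: "x \<in> carrier S \<Longrightarrow> \<zero> \<prec> x \<longleftrightarrow> x \<noteq> \<zero>"
  using zero_leq less_irrefl unfolding leq_def by auto

lemma leq_zero_iff: "x \<in> carrier S \<Longrightarrow> x \<preceq> \<zero> \<longleftrightarrow> x = \<zero>"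
  using not_leq[of x \<zero>] zero_less_iff[of x] by auto

lemma zero_less_one: "\<zero> \<prec> \<one>"
  using zero_less_iff[of \<one>] zero_not_one by simp

lemma add_leq_add:
  assumes "x \<preceq> y" "u \<preceq> v" "x \<in> carrier S" "y \<in> carrier S" "u \<in> carrier S" "v \<in> carrier S"
  shows "x \<oplus> u \<preceq> y \<oplus> v"
proof -
  have "x \<oplus> u \<preceq> y \<oplus> u" using assms add_leq_mono by blast
  moreover have "y \<oplus> u \<preceq> y \<oplus> v" using assms add_leq_mono[of u v y] by (simp add: a_comm)
  ultimately show ?thesis using assms leq_trans by (meson a_closed)
qed

lemma smul_mono_left:
  assumes "x \<in> carrier S" "m \<le> n"
  shows "[(m::nat)] \<cdot> x \<preceq> [n] \<cdot> x"
proof -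
  have "\<zero> \<oplus> [m] \<cdot> x \<preceq> [(n - m)] \<cdot> x \<oplus> [m] \<cdot> x"
    using assms add_leq_mono zero_leq by (meson add.nat_pow_closed zero_closed)
  then show ?thesis using assms by (simp add: add.nat_pow_mult)
qed

lemma smul_mono_right:
  assumes "x \<preceq> y" "x \<in> carrier S" "y \<in> carrier S"
  shows "[(n::nat)] \<cdot> x \<preceq> [n] \<cdot> y"
  by (induction n) (use assms add_leq_add in auto)

lemma smul_add: "\<lbrakk>x \<in> carrier S; y \<in> carrier S\<rbrakk> \<Longrightarrow> [(n::nat)] \<cdot> (x \<oplus> y) = [n] \<cdot> x \<oplus> [n] \<cdot> y"
  by (simp add: add.nat_pow_distrib)

lemma smul_mult: "\<lbrakk>x \<in> carrier S; y \<in> carrier S\<rbrakk> \<Longrightarrow> ([(n::nat)] \<cdot> x) \<otimes> y = [n] \<cdot> (x \<otimes> y)"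
  by (induction n) (simp_all add: l_distr)

lemma smul_smul: "x \<in> carrier S \<Longrightarrow> [(m::nat)] \<cdot> ([(n::nat)] \<cdot> x) = [(m * n)] \<cdot> x"
  by (simp add: add.nat_pow_pow mult.commute)

lemma sim_rel_self_smul: "\<lbrakk>x \<in> carrier S; n > 0\<rbrakk> \<Longrightarrow> (x, [(n::nat)] \<cdot> x) \<in> sim_rel S"
  using smul_mono_left[of x 1 n] unfolding sim_rel_def by auto

lemma sim_relD:
  assumes "(a, b) \<in> sim_rel S"
  obtains n :: nat where "a \<preceq> [n] \<cdot> b" "b \<preceq> [n] \<cdot> a"
proof -
  from assms obtain n :: nat where n: "n > 0" "a \<in> carrier S" "b \<in> carrier S"
     "(a \<preceq> b \<and> b \<preceq> [n] \<cdot> a) \<or> (b \<preceq> a \<and> a \<preceq> [n] \<cdot> b)"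
    unfolding sim_rel_def by auto
  have "a \<preceq> [n] \<cdot> a" "b \<preceq> [n] \<cdot> b"
    using smul_mono_left[of a 1 n] smul_mono_left[of b 1 n] n by auto
  then show thesis using n that[of n] leq_trans by (meson add.nat_pow_closed)
qed

lemma sim_relI:
  assumes "a \<in> carrier S" "b \<in> carrier S" "a \<preceq> [(n::nat)] \<cdot> b" "b \<preceq> [(m::nat)] \<cdot> a"
  shows "(a, b) \<in> sim_rel S"
proof -
  have 1: "a \<preceq> [(Suc n)] \<cdot> b" using assms smul_mono_left[of b n "Suc n"] leq_trans
    by (meson add.nat_pow_closed le_SucI order_refl)
  have 2: "b \<preceq> [(Suc m)] \<cdot> a" using assms smul_mono_left[of a m "Suc m"] leq_trans
    by (meson add.nat_pow_closed le_SucI order_refl)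
  show ?thesis using 1 2 leq_total[of a b] assms unfolding sim_rel_def by blast
qed

lemma dim_class_eq_iff:
  assumes "a \<in> carrier S" "b \<in> carrier S"
  shows "dim_class S a = dim_class S b \<longleftrightarrow> (a, b) \<in> sim_rel S"
proof
  assume "dim_class S a = dim_class S b"
  moreover have "b \<in> dim_class S b"
    using assms sim_relI[of b b 1 1] by (simp add: dim_class_def)
  ultimately show "(a, b) \<in> sim_rel S" by (auto simp: dim_class_def)
next
  have *: "dim_class S v \<subseteq> dim_class S u" if uv: "(u, v) \<in> sim_rel S" for u v
  proof
    fix w assume "w \<in> dim_class S v"
    then have vw: "(v, w) \<in> sim_rel S" by (simp add: dim_class_def)
    have c: "u \<in> carrier S" "v \<in> carrier S" "w \<in> carrier S"
      using uv vw unfolding sim_rel_def by auto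
    obtain n m :: nat where n: "u \<preceq> [n] \<cdot> v" "v \<preceq> [n] \<cdot> u" and m: "v \<preceq> [m] \<cdot> w" "w \<preceq> [m] \<cdot> v"
      using uv vw by (meson sim_relD)
    have "u \<preceq> [(n * m)] \<cdot> w"
      using leq_trans[OF n(1) smul_mono_right[OF m(1), of n]] c by (simp add: smul_smul)
    moreover have "w \<preceq> [(m * n)] \<cdot> u"
      using leq_trans[OF m(2) smul_mono_right[OF n(2), of m]] c by (simp add: smul_smul)
    ultimately show "w \<in> dim_class S u" using sim_relI[of u w] c by (simp add: dim_class_def)
  qed
  assume "(a, b) \<in> sim_rel S"
  moreover from this have "(b, a) \<in> sim_rel S" unfolding sim_rel_def by auto
  ultimately show "dim_class S a = dim_class S b" using * by blast
qed

text \<open>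
  If \<open>S\<close> consisted of real numbers this would be the usual order, being the limit of
  \<open>x \<le> (1 + 1/n) y\<close>.  In general it is the order up to differences that are infinitesimal relative to
  \<open>x\<close> and \<open>y\<close>.
\<close>

definition coarse_leq :: "'a \<Rightarrow> 'a \<Rightarrow> bool"  (infix "\<lesssim>" 50) where
  "x \<lesssim> y \<longleftrightarrow> (\<forall>n::nat. [n] \<cdot> x \<preceq> [(Suc n)] \<cdot> y)"

lemma not_coarse_leq:
  "\<lbrakk>x \<in> carrier S; y \<in> carrier S\<rbrakk> \<Longrightarrow> \<not> x \<lesssim> y \<longleftrightarrow> (\<exists>n::nat. [(Suc n)] \<cdot> y \<prec> [n] \<cdot> x)"
  unfolding coarse_leq_def using not_leq by (metis add.nat_pow_closed)

lemma leq_imp_coarse_leq: "\<lbrakk>x \<preceq> y; x \<in> carrier S; y \<in> carrier S\<rbrakk> \<Longrightarrow> x \<lesssim> y"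
  unfolding coarse_leq_def
  by (meson add.nat_pow_closed le_SucI leq_trans order_refl smul_mono_left smul_mono_right)

lemma coarse_leq_total: "\<lbrakk>x \<in> carrier S; y \<in> carrier S\<rbrakk> \<Longrightarrow> x \<lesssim> y \<or> y \<lesssim> x"
  using leq_total leq_imp_coarse_leq by blast

lemma coarse_leq_add_right:
  assumes "x \<lesssim> y" "x \<in> carrier S" "y \<in> carrier S" "z \<in> carrier S"
  shows "x \<oplus> z \<lesssim> y \<oplus> z"
  unfolding coarse_leq_def
proof
  fix n :: nat
  have "[n] \<cdot> x \<oplus> [n] \<cdot> z \<preceq> [(Suc n)] \<cdot> y \<oplus> [(Suc n)] \<cdot> z"
    using assms add_leq_add smul_mono_left[of z n "Suc n"] unfolding coarse_leq_def
    by (meson add.nat_pow_closed le_SucI order_refl)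
  then show "[n] \<cdot> (x \<oplus> z) \<preceq> [(Suc n)] \<cdot> (y \<oplus> z)" using assms smul_add by metis
qed

lemma coarse_leq_mult_right:
  assumes "x \<lesssim> y" "x \<in> carrier S" "y \<in> carrier S" "z \<in> carrier S"
  shows "x \<otimes> z \<lesssim> y \<otimes> z"
  unfolding coarse_leq_def
proof
  fix n :: nat
  have "([n] \<cdot> x) \<otimes> z \<preceq> ([(Suc n)] \<cdot> y) \<otimes> z"
    using assms mult_leq_mono unfolding coarse_leq_def by (meson add.nat_pow_closed)
  then show "[n] \<cdot> (x \<otimes> z) \<preceq> [(Suc n)] \<cdot> (y \<otimes> z)" using assms smul_mult by metis
qed

lemma coarse_leq_zero: "x \<in> carrier S \<Longrightarrow> x \<lesssim> \<zero> \<longleftrightarrow> x = \<zero>"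
proof
  assume x: "x \<in> carrier S" "x \<lesssim> \<zero>"
  then have "[(1::nat)] \<cdot> x \<preceq> [(Suc 1)] \<cdot> \<zero>" unfolding coarse_leq_def by blast
  then show "x = \<zero>" using x leq_zero_iff by simp
qed (simp add: leq_imp_coarse_leq)

end

context measuring_semiring
begin

text \<open>
  The measuring axiom is used here: in the step from \<open>n\<close> to \<open>n + 1\<close> the element that is added is a
  multiple of \<open>y\<close> and has its dimension, so the strict inequality survives.
\<close>

lemma smul_less_right:
  assumes "x \<prec> y" "x \<in> carrier S" "y \<in> carrier S"
  shows "[(Suc n)] \<cdot> x \<prec> [(Suc n)] \<cdot> y"
proof (induction n)
  case (Suc n)
  let ?a = "[(Suc n)] \<cdot> x" and ?b = "[(Suc n)] \<cdot> y"
  have c: "?a \<in> carrier S" "?b \<in> carrier S" using assms by (blast intro: add.nat_pow_closed)+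
  have "dim_class S y = dim_class S ?b"
    using dim_class_eq_iff[of y ?b] sim_rel_self_smul[where x=y and n="Suc n"] c assms by blast
  then have "x \<oplus> ?b \<prec> y \<oplus> ?b" using add_less_mono assms c by blast
  moreover have "?a \<oplus> x \<preceq> x \<oplus> ?b"
    using add_leq_mono[of ?a ?b x] Suc c assms by (simp add: a_comm less_imp_leq del: add.nat_pow_Suc)
  ultimately show ?case using c assms leq_less_trans[of "?a \<oplus> x" "x \<oplus> ?b" "y \<oplus> ?b"]
    by (simp add: a_comm add.nat_pow_Suc[where n="Suc n"] del: add.nat_pow_Suc)
qed (use assms in simp)

lemma smul_leq_cancel:
  assumes "[(n::nat)] \<cdot> x \<preceq> [n] \<cdot> y" "n > 0" "x \<in> carrier S" "y \<in> carrier S"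
  shows "x \<preceq> y"
  using smul_less_right[of y x "n - 1"] assms not_leq[of "[n] \<cdot> x" "[n] \<cdot> y"] not_leq[of x y] by fastforce

lemma smul_less_left:
  assumes "x \<in> carrier S" "\<zero> \<prec> x" "m < n"
  shows "[(m::nat)] \<cdot> x \<prec> [n] \<cdot> x"
proof -
  have "[m] \<cdot> x \<prec> [(Suc m)] \<cdot> x"
  proof (cases "m = 0")
    case False
    then have "\<zero> \<oplus> [m] \<cdot> x \<prec> x \<oplus> [m] \<cdot> x"
      using add_less_mono[of \<zero> x "[m] \<cdot> x"] assms dim_class_eq_iff[of x "[m] \<cdot> x"] sim_rel_self_smul
      by (meson add.nat_pow_closed gr0I zero_closed)
    then show ?thesis using assms by (simp add: a_comm)
  qed (use assms in simp)
  then show ?thesis using smul_mono_left[of x "Suc m" n] assms less_leq_trans by (meson Suc_leI add.nat_pow_closed)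
qed

text \<open>
  The multiples of \<open>\<one>\<close> are pairwise distinct.
\<close>

lemma infinite_carrier: "infinite (carrier S)"
proof -
  have "inj (\<lambda>n::nat. [n] \<cdot> \<one>)"
  proof (rule linorder_injI)
    fix m n :: nat assume "m < n"
    then show "[m] \<cdot> \<one> \<noteq> [n] \<cdot> \<one>"
      using smul_less_left[of \<one> m n] zero_less_one less_irrefl[of "[m] \<cdot> \<one>"] by auto
  qed
  moreover have "range (\<lambda>n::nat. [n] \<cdot> \<one>) \<subseteq> carrier S" by auto
  ultimately show ?thesis using finite_imageD finite_subset infinite_UNIV_nat by blast
qed

text \<open>
  Two slacks of relative size \<open>1/(2n)\<close> add up to one of size \<open>1/n\<close>; \<open>smul_leq_cancel\<close> removes the factor 2.
\<close>

lemma coarse_leq_trans: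
  assumes "x \<lesssim> y" "y \<lesssim> z" and c: "x \<in> carrier S" "y \<in> carrier S" "z \<in> carrier S"
  shows "x \<lesssim> z"
  unfolding coarse_leq_def
proof
  fix n :: nat
  have "[(2 * n)] \<cdot> x \<preceq> [(Suc (2 * n))] \<cdot> y" "[(Suc (2 * n))] \<cdot> y \<preceq> [(Suc (Suc (2 * n)))] \<cdot> z"
    using assms unfolding coarse_leq_def by blast+
  then have "[(2 * n)] \<cdot> x \<preceq> [(2 * Suc n)] \<cdot> z"
    using c leq_trans by (metis add.nat_pow_closed mult_Suc_right add_2_eq_Suc)
  then have "[(2::nat)] \<cdot> ([n] \<cdot> x) \<preceq> [(2::nat)] \<cdot> ([(Suc n)] \<cdot> z)"
    using c by (simp add: smul_smul del: add.nat_pow_Suc)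
  then show "[n] \<cdot> x \<preceq> [(Suc n)] \<cdot> z" using smul_leq_cancel c by (meson add.nat_pow_closed zero_less_numeral)
qed

text \<open>
  A weak inequality suffices to refute \<open>\<lesssim>\<close>: doubling it leaves room between \<open>2n + 2\<close> and \<open>2n + 1\<close>.
  This is what makes \<open>\<lesssim>\<close> robust under multiplication, which only preserves weak inequalities.
\<close>

lemma not_coarse_leqI:
  assumes "[(Suc n)] \<cdot> y \<preceq> [n] \<cdot> x" "x \<noteq> \<zero>" and c: "x \<in> carrier S" "y \<in> carrier S"
  shows "\<not> x \<lesssim> y"
proof (cases "y = \<zero>")
  case True
  then show ?thesis using assms coarse_leq_zero by simp
next
  case False
  have "[(2 * Suc n)] \<cdot> y \<preceq> [(2 * n)] \<cdot> x"
    using smul_mono_right[OF assms(1), of 2] c by (metis smul_smul add.nat_pow_closed)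
  moreover have "[(Suc (2 * n))] \<cdot> y \<prec> [(2 * Suc n)] \<cdot> y"
    using smul_less_left[of y "Suc (2 * n)" "2 * Suc n"] c False zero_less_iff by simp
  ultimately have "[(Suc (2 * n))] \<cdot> y \<prec> [(2 * n)] \<cdot> x"
    using less_leq_trans c by (meson add.nat_pow_closed)
  then show ?thesis using not_coarse_leq c by blast
qed

text \<open>
  Cancellation holds because a relative gap of size \<open>1/n\<close> between \<open>y\<close> and \<open>x\<close> is stated by a weak
  inequality between multiples, and that inequality survives multiplication by \<open>z\<close>.
\<close>

lemma coarse_leq_mult_cancel:
  assumes "x \<otimes> z \<lesssim> y \<otimes> z" "\<zero> \<prec> z" and c: "x \<in> carrier S" "y \<in> carrier S" "z \<in> carrier S"
  shows "x \<lesssim> y"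
proof (rule ccontr)
  assume "\<not> x \<lesssim> y"
  then obtain n :: nat where n: "[(Suc n)] \<cdot> y \<prec> [n] \<cdot> x" using not_coarse_leq c by blast
  have "([(Suc n)] \<cdot> y) \<otimes> z \<preceq> ([n] \<cdot> x) \<otimes> z"
    using mult_leq_mono n c less_imp_leq by (meson add.nat_pow_closed)
  then have "[(Suc n)] \<cdot> (y \<otimes> z) \<preceq> [n] \<cdot> (x \<otimes> z)" using smul_mult c by metis
  moreover have "x \<noteq> \<zero>"
    using \<open>\<not> x \<lesssim> y\<close> leq_imp_coarse_leq zero_leq c by blast
  then have "x \<otimes> z \<noteq> \<zero>"
    using mult_pos[of x z] assms zero_less_iff less_irrefl by force
  ultimately show False using not_coarse_leqI assms by blast
qed

text \<open>
  This is the measuring axiom for the coarse order.  As \<open>z\<close> is bounded by a multiple of \<open>y\<close>,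
  adding it to both sides shrinks the relative gap between them only by a bounded factor.
\<close>

lemma coarse_less_add:
  assumes "\<not> y \<lesssim> x" "z \<lesssim> [(m::nat)] \<cdot> y" and c: "x \<in> carrier S" "y \<in> carrier S" "z \<in> carrier S"
  shows "\<not> y \<oplus> z \<lesssim> x \<oplus> z"
proof -
  obtain n :: nat where n: "[(Suc n)] \<cdot> x \<prec> [n] \<cdot> y" using assms not_coarse_leq by blast
  have "[(1::nat)] \<cdot> z \<preceq> [(2::nat)] \<cdot> ([m] \<cdot> y)"
    using assms(2) unfolding coarse_leq_def by (metis Suc_1)
  then have z: "z \<preceq> [(2 * m)] \<cdot> y" using c by (simp add: smul_smul)
  \<comment> \<open>With this choice \<open>k (n + 1) = N + 1\<close>, and the \<open>N - k n = 2 m\<close> remaining multiples of \<open>y\<close> absorb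
    the excess copy of \<open>z\<close>.\<close>
  define k N where "k = 2 * m + 1" and "N = k * n + 2 * m"
  have "[k] \<cdot> ([(Suc n)] \<cdot> x) \<preceq> [k] \<cdot> ([n] \<cdot> y)"
    using smul_mono_right n less_imp_leq c by (meson add.nat_pow_closed)
  then have x: "[(Suc N)] \<cdot> x \<preceq> [(k * n)] \<cdot> y"
    using smul_smul[OF c(1), of k "Suc n"] smul_smul[OF c(2), of k n]
    by (simp add: N_def k_def algebra_simps)
  have cl: "[(j::nat)] \<cdot> w \<in> carrier S" if "w \<in> carrier S" for j w using that by blast
  have "[(Suc N)] \<cdot> x \<oplus> z \<preceq> [(k * n)] \<cdot> y \<oplus> [(2 * m)] \<cdot> y"
    using add_leq_add[OF x z] cl c by blast
  also have "\<dots> = [N] \<cdot> y" using c by (simp add: add.nat_pow_mult N_def)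
  finally have "([(Suc N)] \<cdot> x \<oplus> z) \<oplus> [N] \<cdot> z \<preceq> [N] \<cdot> y \<oplus> [N] \<cdot> z"
    using add_leq_mono cl c by (meson a_closed)
  then have "[(Suc N)] \<cdot> (x \<oplus> z) \<preceq> [N] \<cdot> (y \<oplus> z)"
    using c by (simp add: smul_add[of x z] smul_add[of y z] a_ac)
  moreover have "y \<oplus> z \<noteq> \<zero>"
  proof
    assume "y \<oplus> z = \<zero>"
    then have "y \<preceq> \<zero>" using add_leq_add[of y y \<zero> z] zero_leq c by auto
    then show False using assms(1) leq_imp_coarse_leq leq_zero_iff zero_leq c by auto
  qed
  ultimately show ?thesis using not_coarse_leqI c by blast
qed

end

section \<open>Quotients of preordered semirings\<close>

text \<open>
  The laws of a measuring semiring for a total preorder instead of an order.  The laws that hold for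
  fractions as identities of pairs are stated as equations; only distributivity and annihilation by
  zero are stated up to equivalence.  In the last assumption, the dimension of \<open>r\<close> is bounded by that of
  \<open>q\<close>, expressed by iterated addition.
\<close>

locale measuring_presemiring =
  fixes P :: "'w set" and add mul :: "'w \<Rightarrow> 'w \<Rightarrow> 'w" and z e :: 'w
    and le :: "'w \<Rightarrow> 'w \<Rightarrow> bool"  (infix "\<sqsubseteq>" 50)
  assumes add_closed: "p \<in> P \<Longrightarrow> q \<in> P \<Longrightarrow> add p q \<in> P"
    and mul_closed: "p \<in> P \<Longrightarrow> q \<in> P \<Longrightarrow> mul p q \<in> P"
    and z_closed: "z \<in> P" and e_closed: "e \<in> P"
    and le_total: "p \<in> P \<Longrightarrow> q \<in> P \<Longrightarrow> p \<sqsubseteq> q \<or> q \<sqsubseteq> p"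
    and le_trans: "\<lbrakk>p \<sqsubseteq> q; q \<sqsubseteq> r; p \<in> P; q \<in> P; r \<in> P\<rbrakk> \<Longrightarrow> p \<sqsubseteq> r"
    and add_assoc: "\<lbrakk>p \<in> P; q \<in> P; r \<in> P\<rbrakk> \<Longrightarrow> add (add p q) r = add p (add q r)"
    and add_comm: "\<lbrakk>p \<in> P; q \<in> P\<rbrakk> \<Longrightarrow> add p q = add q p"
    and add_z: "p \<in> P \<Longrightarrow> add z p = p"
    and mul_assoc: "\<lbrakk>p \<in> P; q \<in> P; r \<in> P\<rbrakk> \<Longrightarrow> mul (mul p q) r = mul p (mul q r)"
    and mul_comm: "\<lbrakk>p \<in> P; q \<in> P\<rbrakk> \<Longrightarrow> mul p q = mul q p"
    and mul_e: "p \<in> P \<Longrightarrow> mul e p = p"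
    and distr: "\<lbrakk>p \<in> P; q \<in> P; r \<in> P\<rbrakk> \<Longrightarrow>
      mul (add p q) r \<sqsubseteq> add (mul p r) (mul q r) \<and> add (mul p r) (mul q r) \<sqsubseteq> mul (add p q) r"
    and mul_z: "p \<in> P \<Longrightarrow> mul z p \<sqsubseteq> z"
    and z_le: "p \<in> P \<Longrightarrow> z \<sqsubseteq> p"
    and add_mono: "\<lbrakk>p \<sqsubseteq> q; p \<in> P; q \<in> P; r \<in> P\<rbrakk> \<Longrightarrow> add p r \<sqsubseteq> add q r"
    and mul_mono: "\<lbrakk>p \<sqsubseteq> q; p \<in> P; q \<in> P; r \<in> P\<rbrakk> \<Longrightarrow> mul p r \<sqsubseteq> mul q r"
    and mul_pos: "\<lbrakk>\<not> p \<sqsubseteq> z; \<not> q \<sqsubseteq> z; p \<in> P; q \<in> P\<rbrakk> \<Longrightarrow> \<not> mul p q \<sqsubseteq> z"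
    and e_pos: "\<not> e \<sqsubseteq> z"
    and add_less: "\<lbrakk>\<not> q \<sqsubseteq> p; r \<sqsubseteq> (add q ^^ m) z; p \<in> P; q \<in> P; r \<in> P\<rbrakk> \<Longrightarrow> \<not> add q r \<sqsubseteq> add p r"
begin

lemma add_mono2: "\<lbrakk>p \<sqsubseteq> p'; q \<sqsubseteq> q'; p \<in> P; q \<in> P; p' \<in> P; q' \<in> P\<rbrakk> \<Longrightarrow> add p q \<sqsubseteq> add p' q'"
  using add_mono[of p p' q] add_mono[of q q' p'] le_trans[of "add p q" "add p' q" "add p' q'"]
    add_closed add_comm[of p' q] add_comm[of p' q'] by simp

lemma mul_mono2: "\<lbrakk>p \<sqsubseteq> p'; q \<sqsubseteq> q'; p \<in> P; q \<in> P; p' \<in> P; q' \<in> P\<rbrakk> \<Longrightarrow> mul p q \<sqsubseteq> mul p' q'"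
  using mul_mono[of p p' q] mul_mono[of q q' p'] le_trans[of "mul p q" "mul p' q" "mul p' q'"]
    mul_closed mul_comm[of p' q] mul_comm[of p' q'] by simp

text \<open>
  The function \<open>c\<close> is a code for the equivalence classes; its values may live in any type that is large
  enough, which makes it possible to return to the type of the original semiring.
\<close>

lemma quotient_measuring_semiring:
  fixes c :: "'w \<Rightarrow> 'v"
  assumes c: "\<And>p q. \<lbrakk>p \<in> P; q \<in> P\<rbrakk> \<Longrightarrow> c p = c q \<longleftrightarrow> p \<sqsubseteq> q \<and> q \<sqsubseteq> p"
  obtains T :: "'v ord_ring" where "measuring_semiring T" "carrier T = c ` P"
    "\<And>p q. \<lbrakk>p \<in> P; q \<in> P\<rbrakk> \<Longrightarrow> c p \<oplus>\<^bsub>T\<^esub> c q = c (add p q)"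
    "\<And>p q. \<lbrakk>p \<in> P; q \<in> P\<rbrakk> \<Longrightarrow> c p \<otimes>\<^bsub>T\<^esub> c q = c (mul p q)"
    "\<zero>\<^bsub>T\<^esub> = c z" "\<one>\<^bsub>T\<^esub> = c e"
proof -
  define rep where "rep x = (SOME p. p \<in> P \<and> c p = x)" for x
  have rep: "rep (c p) \<in> P \<and> c (rep (c p)) = c p" if "p \<in> P" for p
    unfolding rep_def by (rule someI[of _ p]) (use that in simp)
  have rep_eq: "rep (c p) \<in> P" "rep (c p) \<sqsubseteq> p" "p \<sqsubseteq> rep (c p)" if "p \<in> P" for p
    using rep[OF that] c[of "rep (c p)" p] that by auto
  define T where "T = \<lparr>carrier = c ` P, mult = \<lambda>x y. c (mul (rep x) (rep y)), one = c e,
    zero = c z, add = \<lambda>x y. c (add (rep x) (rep y)), lt = \<lambda>x y. \<not> rep y \<sqsubseteq> rep x\<rparr>"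
  have T_carrier: "carrier T = c ` P" and T_zero: "\<zero>\<^bsub>T\<^esub> = c z" and T_one: "\<one>\<^bsub>T\<^esub> = c e"
    by (simp_all add: T_def)
  have T_add: "c p \<oplus>\<^bsub>T\<^esub> c q = c (add p q)" if "p \<in> P" "q \<in> P" for p q
    unfolding T_def using rep_eq[OF that(1)] rep_eq[OF that(2)] add_mono2 add_closed that by (simp add: c)
  have T_mult: "c p \<otimes>\<^bsub>T\<^esub> c q = c (mul p q)" if "p \<in> P" "q \<in> P" for p q
    unfolding T_def using rep_eq[OF that(1)] rep_eq[OF that(2)] mul_mono2 mul_closed that by (simp add: c)
  have T_lt: "c p \<prec>\<^bsub>T\<^esub> c q \<longleftrightarrow> \<not> q \<sqsubseteq> p" if "p \<in> P" "q \<in> P" for p q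
  proof -
    have "rep (c q) \<sqsubseteq> rep (c p) \<longleftrightarrow> q \<sqsubseteq> p"
      using rep_eq[OF that(1)] rep_eq[OF that(2)] that by (meson le_trans)
    then show ?thesis by (simp add: T_def)
  qed
  have T_leq: "c p \<preceq>\<^bsub>T\<^esub> c q \<longleftrightarrow> p \<sqsubseteq> q" if "p \<in> P" "q \<in> P" for p q
    unfolding leq_def using that le_total[of p q] by (auto simp: T_lt c)
  have cl: "mul p z \<sqsubseteq> z \<and> z \<sqsubseteq> mul p z" if "p \<in> P" for p
    using mul_z[OF that] mul_comm[OF that z_closed] z_le[of "mul p z"] mul_closed[OF that z_closed] by simp
  interpret ord_semiring T
  proof (intro ord_semiring.intro semiring.intro abelian_monoidI monoidI comm_monoidI semiring_axioms.intro ord_semiring_axioms.intro; (unfold T_carrier T_zero T_one)?)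
    show "\<And>x. x \<in> c ` P \<Longrightarrow> x \<otimes>\<^bsub>T\<^esub> c e = x"
      by (auto simp: T_mult e_closed mul_e mul_comm[of _ e])
    show "\<And>x y. \<lbrakk>x \<in> c ` P; y \<in> c ` P\<rbrakk> \<Longrightarrow> x \<otimes>\<^bsub>T\<^esub> y = y \<otimes>\<^bsub>T\<^esub> x"
      by (auto simp: T_mult mul_comm)
    show "\<And>x y. \<lbrakk>x \<in> c ` P; y \<in> c ` P\<rbrakk> \<Longrightarrow> x \<oplus>\<^bsub>T\<^esub> y = y \<oplus>\<^bsub>T\<^esub> x"
      by (auto simp: T_add add_comm)
    show "\<And>x. x \<in> c ` P \<Longrightarrow> c z \<oplus>\<^bsub>T\<^esub> x = x"
      by (auto simp: T_add z_closed add_z)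
    show "\<And>x. x \<in> c ` P \<Longrightarrow> c e \<otimes>\<^bsub>T\<^esub> x = x" "\<And>x. x \<in> c ` P \<Longrightarrow> c e \<otimes>\<^bsub>T\<^esub> x = x"
      by (auto simp: T_mult e_closed mul_e)
    show "c z \<in> c ` P" "c e \<in> c ` P" "c e \<in> c ` P" using z_closed e_closed by auto
    show "\<And>x y. \<lbrakk>x \<in> c ` P; y \<in> c ` P\<rbrakk> \<Longrightarrow> x \<oplus>\<^bsub>T\<^esub> y \<in> c ` P"
      by (auto simp: T_add add_closed)
    show "\<And>x y. \<lbrakk>x \<in> c ` P; y \<in> c ` P\<rbrakk> \<Longrightarrow> x \<otimes>\<^bsub>T\<^esub> y \<in> c ` P"
      "\<And>x y. \<lbrakk>x \<in> c ` P; y \<in> c ` P\<rbrakk> \<Longrightarrow> x \<otimes>\<^bsub>T\<^esub> y \<in> c ` P"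
      by (auto simp: T_mult mul_closed)
    show "\<And>x y w. \<lbrakk>x \<in> c ` P; y \<in> c ` P; w \<in> c ` P\<rbrakk> \<Longrightarrow> x \<oplus>\<^bsub>T\<^esub> y \<oplus>\<^bsub>T\<^esub> w = x \<oplus>\<^bsub>T\<^esub> (y \<oplus>\<^bsub>T\<^esub> w)"
      by (auto simp: T_add add_closed add_assoc)
    show "\<And>x y w. \<lbrakk>x \<in> c ` P; y \<in> c ` P; w \<in> c ` P\<rbrakk> \<Longrightarrow> x \<otimes>\<^bsub>T\<^esub> y \<otimes>\<^bsub>T\<^esub> w = x \<otimes>\<^bsub>T\<^esub> (y \<otimes>\<^bsub>T\<^esub> w)"
      "\<And>x y w. \<lbrakk>x \<in> c ` P; y \<in> c ` P; w \<in> c ` P\<rbrakk> \<Longrightarrow> x \<otimes>\<^bsub>T\<^esub> y \<otimes>\<^bsub>T\<^esub> w = x \<otimes>\<^bsub>T\<^esub> (y \<otimes>\<^bsub>T\<^esub> w)"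
      by (auto simp: T_mult mul_closed mul_assoc)
    have d: "(x \<oplus>\<^bsub>T\<^esub> y) \<otimes>\<^bsub>T\<^esub> w = x \<otimes>\<^bsub>T\<^esub> w \<oplus>\<^bsub>T\<^esub> y \<otimes>\<^bsub>T\<^esub> w"
      if "x \<in> c ` P" "y \<in> c ` P" "w \<in> c ` P" for x y w
      using that by (auto simp: T_add T_mult add_closed mul_closed c distr)
    then show "\<And>x y w. \<lbrakk>x \<in> c ` P; y \<in> c ` P; w \<in> c ` P\<rbrakk> \<Longrightarrow> (x \<oplus>\<^bsub>T\<^esub> y) \<otimes>\<^bsub>T\<^esub> w = x \<otimes>\<^bsub>T\<^esub> w \<oplus>\<^bsub>T\<^esub> y \<otimes>\<^bsub>T\<^esub> w" .
    show "w \<otimes>\<^bsub>T\<^esub> (x \<oplus>\<^bsub>T\<^esub> y) = w \<otimes>\<^bsub>T\<^esub> x \<oplus>\<^bsub>T\<^esub> w \<otimes>\<^bsub>T\<^esub> y"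
      if "x \<in> c ` P" "y \<in> c ` P" "w \<in> c ` P" for x y w
      using d[OF that] that by (auto simp: T_add T_mult add_closed mul_closed mul_comm)
    show "\<And>x. x \<in> c ` P \<Longrightarrow> c z \<otimes>\<^bsub>T\<^esub> x = c z"
      by (auto simp: T_mult c mul_z z_le mul_closed z_closed)
    show "\<And>x. x \<in> c ` P \<Longrightarrow> x \<otimes>\<^bsub>T\<^esub> c z = c z"
      by (auto simp: T_mult c cl mul_closed z_closed)
    show "\<And>x. x \<in> c ` P \<Longrightarrow> \<not> x \<prec>\<^bsub>T\<^esub> x"
      by (auto simp: T_lt) (metis le_total)
    show "\<And>x y w. \<lbrakk>x \<in> c ` P; y \<in> c ` P; w \<in> c ` P; x \<prec>\<^bsub>T\<^esub> y; y \<prec>\<^bsub>T\<^esub> w\<rbrakk> \<Longrightarrow> x \<prec>\<^bsub>T\<^esub> w"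
      by (auto simp: T_lt) (metis le_total le_trans)
    show "\<And>x y. \<lbrakk>x \<in> c ` P; y \<in> c ` P\<rbrakk> \<Longrightarrow> x \<prec>\<^bsub>T\<^esub> y \<or> x = y \<or> y \<prec>\<^bsub>T\<^esub> x"
      by (auto simp: T_lt c)
    show "\<And>x. x \<in> c ` P \<Longrightarrow> c z \<preceq>\<^bsub>T\<^esub> x" using z_le z_closed by (auto simp: T_leq)
    show "\<And>x y w. \<lbrakk>x \<in> c ` P; y \<in> c ` P; w \<in> c ` P; x \<preceq>\<^bsub>T\<^esub> y\<rbrakk> \<Longrightarrow> x \<oplus>\<^bsub>T\<^esub> w \<preceq>\<^bsub>T\<^esub> y \<oplus>\<^bsub>T\<^esub> w"
      by (auto simp: T_leq T_add add_mono add_closed)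
    show "\<And>x y w. \<lbrakk>x \<in> c ` P; y \<in> c ` P; w \<in> c ` P; x \<preceq>\<^bsub>T\<^esub> y\<rbrakk> \<Longrightarrow> x \<otimes>\<^bsub>T\<^esub> w \<preceq>\<^bsub>T\<^esub> y \<otimes>\<^bsub>T\<^esub> w"
      by (auto simp: T_leq T_mult mul_mono mul_closed)
    show "\<And>x y. \<lbrakk>x \<in> c ` P; y \<in> c ` P; c z \<prec>\<^bsub>T\<^esub> x; c z \<prec>\<^bsub>T\<^esub> y\<rbrakk> \<Longrightarrow> c z \<prec>\<^bsub>T\<^esub> x \<otimes>\<^bsub>T\<^esub> y"
      by (auto simp: T_lt T_mult mul_pos mul_closed z_closed)
    show "c z \<noteq> c e" using e_pos z_closed e_closed by (simp add: c)
  qed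
  have iter: "(add q ^^ m) z \<in> P \<and> [m] \<cdot>\<^bsub>T\<^esub> c q = c ((add q ^^ m) z)" if "q \<in> P" for q m
  proof (induction m)
    case (Suc m)
    then show ?case using that by (simp add: T_add add_closed add_comm[of "(add q ^^ m) z" q])
  qed (use z_closed T_zero in auto)
  have "measuring_semiring T"
  proof (intro measuring_semiring.intro measuring_semiring_axioms.intro ord_semiring_axioms)
    fix x y w assume *: "x \<in> carrier T" "y \<in> carrier T" "w \<in> carrier T" "x \<prec>\<^bsub>T\<^esub> y" "dim_class T y = dim_class T w"
    then obtain p q r where p: "p \<in> P" "q \<in> P" "r \<in> P" "x = c p" "y = c q" "w = c r"
      by (auto simp: T_carrier)
    have "(y, w) \<in> sim_rel T" using * dim_class_eq_iff by blast
    then obtain m :: nat where "w \<preceq>\<^bsub>T\<^esub> [m] \<cdot>\<^bsub>T\<^esub> y" by (meson sim_relD)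
    then have "r \<sqsubseteq> (add q ^^ m) z" using iter[OF p(2), of m] p by (simp add: T_leq)
    then show "x \<oplus>\<^bsub>T\<^esub> w \<prec>\<^bsub>T\<^esub> y \<oplus>\<^bsub>T\<^esub> w"
      using add_less * p add_closed by (simp add: T_add T_lt)
  qed
  then show thesis using that T_carrier T_add T_mult T_zero T_one by blast
qed

end

section \<open>Fractions\<close>

text \<open>
  \<open>quo a b\<close> is the fraction with numerator \<open>a\<close> and denominator \<open>b\<close>.  These rules are all that the
  measure on imaginaries needs to know about fractions.
\<close>

locale fraction_map = measuring_semiring S + T: measuring_semiring T
  for S :: "('v, 'b) ord_ring_scheme" (structure) and T :: "('v, 'c) ord_ring_scheme" +
  fixes quo :: "'v \<Rightarrow> 'v \<Rightarrow> 'v"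
  assumes quo_closed: "\<lbrakk>a \<in> carrier S; b \<in> carrier S; \<zero> \<prec> b\<rbrakk> \<Longrightarrow> quo a b \<in> carrier T"
    and quo_add: "\<lbrakk>a \<in> carrier S; c \<in> carrier S; b \<in> carrier S; \<zero> \<prec> b\<rbrakk>
       \<Longrightarrow> quo (a \<oplus> c) b = quo a b \<oplus>\<^bsub>T\<^esub> quo c b"
    and quo_mult: "\<lbrakk>a \<in> carrier S; b \<in> carrier S; c \<in> carrier S; d \<in> carrier S; \<zero> \<prec> b; \<zero> \<prec> d\<rbrakk>
       \<Longrightarrow> quo a b \<otimes>\<^bsub>T\<^esub> quo c d = quo (a \<otimes> c) (b \<otimes> d)"
    and quo_cancel: "\<lbrakk>a \<in> carrier S; b \<in> carrier S; c \<in> carrier S; \<zero> \<prec> b; \<zero> \<prec> c\<rbrakk>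
       \<Longrightarrow> quo (a \<otimes> c) (b \<otimes> c) = quo a b"
    and quo_self: "\<lbrakk>b \<in> carrier S; \<zero> \<prec> b\<rbrakk> \<Longrightarrow> quo b b = \<one>\<^bsub>T\<^esub>"
    and quo_zero: "\<lbrakk>b \<in> carrier S; \<zero> \<prec> b\<rbrakk> \<Longrightarrow> quo \<zero> b = \<zero>\<^bsub>T\<^esub>"

context measuring_semiring
begin

definition fractions :: "('a \<times> 'a) set" where
  "fractions = {(a, b). a \<in> carrier S \<and> b \<in> carrier S \<and> \<zero> \<prec> b}"

fun frac_add :: "'a \<times> 'a \<Rightarrow> 'a \<times> 'a \<Rightarrow> 'a \<times> 'a" where
  "frac_add (a, b) (c, d) = (a \<otimes> d \<oplus> c \<otimes> b, b \<otimes> d)"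

fun frac_mult :: "'a \<times> 'a \<Rightarrow> 'a \<times> 'a \<Rightarrow> 'a \<times> 'a" where
  "frac_mult (a, b) (c, d) = (a \<otimes> c, b \<otimes> d)"

fun frac_leq :: "'a \<times> 'a \<Rightarrow> 'a \<times> 'a \<Rightarrow> bool" where
  "frac_leq (a, b) (c, d) \<longleftrightarrow> a \<otimes> d \<lesssim> c \<otimes> b"

lemma coarse_leq_mult_iff:
  "\<lbrakk>\<zero> \<prec> z; x \<in> carrier S; y \<in> carrier S; z \<in> carrier S\<rbrakk> \<Longrightarrow> x \<otimes> z \<lesssim> y \<otimes> z \<longleftrightarrow> x \<lesssim> y"
  using coarse_leq_mult_cancel coarse_leq_mult_right by blast

lemma frac_leq_expand:
  assumes "a \<in> carrier S" "b \<in> carrier S" "c \<in> carrier S" "\<zero> \<prec> b" "\<zero> \<prec> c"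
  shows "frac_leq (a, b) (a \<otimes> c, b \<otimes> c)" "frac_leq (a \<otimes> c, b \<otimes> c) (a, b)"
proof -
  have "a \<otimes> (b \<otimes> c) = (a \<otimes> c) \<otimes> b" using assms by (simp add: m_ac)
  then show "frac_leq (a, b) (a \<otimes> c, b \<otimes> c)" "frac_leq (a \<otimes> c, b \<otimes> c) (a, b)"
    using assms by (simp_all add: leq_imp_coarse_leq)
qed

text \<open>
  Cancellation of the middle denominator is the point where the coarse order is indispensable.
\<close>

lemma frac_leq_trans:
  assumes "frac_leq p q" "frac_leq q r" "p \<in> fractions" "q \<in> fractions" "r \<in> fractions"
  shows "frac_leq p r"
proof -
  obtain a b c d e f where pqr: "p = (a, b)" "q = (c, d)" "r = (e, f)" by (metis surj_pair)
  have cl: "a \<in> carrier S" "b \<in> carrier S" "c \<in> carrier S" "d \<in> carrier S" "e \<in> carrier S" "f \<in> carrier S"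
    and pos: "\<zero> \<prec> d" using assms pqr by (auto simp: fractions_def)
  have "(a \<otimes> d) \<otimes> f \<lesssim> (c \<otimes> b) \<otimes> f" "(c \<otimes> f) \<otimes> b \<lesssim> (e \<otimes> d) \<otimes> b"
    using assms(1,2) pqr cl by (simp_all add: coarse_leq_mult_right)
  moreover have "(c \<otimes> b) \<otimes> f = (c \<otimes> f) \<otimes> b" using cl by (simp add: m_ac)
  ultimately have "(a \<otimes> d) \<otimes> f \<lesssim> (e \<otimes> d) \<otimes> b"
    using coarse_leq_trans[of "(a \<otimes> d) \<otimes> f" "(c \<otimes> b) \<otimes> f" "(e \<otimes> d) \<otimes> b"] cl by simp
  then have "(a \<otimes> f) \<otimes> d \<lesssim> (e \<otimes> b) \<otimes> d" using cl by (simp add: m_ac)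
  then show ?thesis using coarse_leq_mult_cancel[of "a \<otimes> f" d "e \<otimes> b"] cl pos pqr by simp
qed

lemma frac_add_leq:
  assumes "frac_leq p q" "p \<in> fractions" "q \<in> fractions" "r \<in> fractions"
  shows "frac_leq (frac_add p r) (frac_add q r)"
proof -
  obtain a b c d e f where pqr: "p = (a, b)" "q = (c, d)" "r = (e, f)" by (metis surj_pair)
  have cl: "a \<in> carrier S" "b \<in> carrier S" "c \<in> carrier S" "d \<in> carrier S" "e \<in> carrier S" "f \<in> carrier S"
    using assms pqr by (auto simp: fractions_def)
  have "a \<otimes> d \<lesssim> c \<otimes> b" using assms(1) pqr by simp
  then have "(a \<otimes> d) \<otimes> (f \<otimes> f) \<oplus> e \<otimes> (b \<otimes> (d \<otimes> f)) \<lesssim> (c \<otimes> b) \<otimes> (f \<otimes> f) \<oplus> e \<otimes> (b \<otimes> (d \<otimes> f))"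
    using cl by (simp add: coarse_leq_add_right coarse_leq_mult_right)
  then show ?thesis using cl pqr by (simp add: l_distr r_distr m_ac)
qed

lemma frac_mult_leq:
  assumes "frac_leq p q" "p \<in> fractions" "q \<in> fractions" "r \<in> fractions"
  shows "frac_leq (frac_mult p r) (frac_mult q r)"
proof -
  obtain a b c d e f where pqr: "p = (a, b)" "q = (c, d)" "r = (e, f)" by (metis surj_pair)
  have cl: "a \<in> carrier S" "b \<in> carrier S" "c \<in> carrier S" "d \<in> carrier S" "e \<in> carrier S" "f \<in> carrier S"
    using assms pqr by (auto simp: fractions_def)
  have "a \<otimes> d \<lesssim> c \<otimes> b" using assms(1) pqr by simp
  then have "(a \<otimes> d) \<otimes> (e \<otimes> f) \<lesssim> (c \<otimes> b) \<otimes> (e \<otimes> f)"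
    using cl by (simp add: coarse_leq_mult_right)
  then show ?thesis using cl pqr by (simp add: m_ac)
qed

lemma frac_add_common_denominator:
  assumes "a \<in> carrier S" "c \<in> carrier S" "b \<in> carrier S" "\<zero> \<prec> b"
  shows "frac_leq (frac_add (a, b) (c, b)) (a \<oplus> c, b)" "frac_leq (a \<oplus> c, b) (frac_add (a, b) (c, b))"
proof -
  have "frac_add (a, b) (c, b) = ((a \<oplus> c) \<otimes> b, b \<otimes> b)" using assms by (simp add: l_distr)
  then show "frac_leq (frac_add (a, b) (c, b)) (a \<oplus> c, b)" "frac_leq (a \<oplus> c, b) (frac_add (a, b) (c, b))"
    using frac_leq_expand[of "a \<oplus> c" b b] assms by simp_all
qed

lemma fractions_closed:
  assumes "p \<in> fractions" "q \<in> fractions"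
  shows "frac_add p q \<in> fractions" "frac_mult p q \<in> fractions"
  using assms mult_pos by (auto simp: fractions_def)

text \<open>
  Iterated addition of a fraction is equivalent to the multiple over the same denominator; the bound in
  this direction is what the measuring axiom for fractions requires.
\<close>

lemma frac_iterate_leq:
  assumes "a \<in> carrier S" "b \<in> carrier S" "\<zero> \<prec> b"
  shows "(frac_add (a, b) ^^ m) (\<zero>, \<one>) \<in> fractions \<and>
    frac_leq ((frac_add (a, b) ^^ m) (\<zero>, \<one>)) ([m] \<cdot> a, b)"
proof (induction m)
  case 0
  then show ?case using assms zero_less_one leq_imp_coarse_leq by (simp add: fractions_def)
next
  case (Suc m)
  let ?w = "(frac_add (a, b) ^^ m) (\<zero>, \<one>)"
  have ab: "(a, b) \<in> fractions" "([m] \<cdot> a, b) \<in> fractions" "([m] \<cdot> a \<oplus> a, b) \<in> fractions"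
    using assms by (auto simp: fractions_def)
  have comm: "frac_add (a, b) ?w = frac_add ?w (a, b)"
    using Suc assms by (cases ?w) (simp add: fractions_def a_comm m_comm)
  have "frac_leq (frac_add ?w (a, b)) (frac_add ([m] \<cdot> a, b) (a, b))"
    using Suc ab frac_add_leq by blast
  moreover have "frac_leq (frac_add ([m] \<cdot> a, b) (a, b)) ([m] \<cdot> a \<oplus> a, b)"
    using frac_add_common_denominator assms by blast
  ultimately have "frac_leq (frac_add ?w (a, b)) ([m] \<cdot> a \<oplus> a, b)"
    using frac_leq_trans Suc ab fractions_closed by blast
  then show ?case using comm Suc ab fractions_closed by simp
qed

text \<open>
  Over the common denominator of the three fractions the claim is \<open>coarse_less_add\<close> for the numerators.
\<close>

lemma frac_add_less:
  assumes "\<not> frac_leq q p" "frac_leq r ((frac_add q ^^ m) (\<zero>, \<one>))"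
    "p \<in> fractions" "q \<in> fractions" "r \<in> fractions"
  shows "\<not> frac_leq (frac_add q r) (frac_add p r)"
proof -
  obtain a b c d e f where pqr: "p = (a, b)" "q = (c, d)" "r = (e, f)" by (metis surj_pair)
  have cl: "a \<in> carrier S" "b \<in> carrier S" "c \<in> carrier S" "d \<in> carrier S" "e \<in> carrier S" "f \<in> carrier S"
    and pos: "\<zero> \<prec> b" "\<zero> \<prec> d" "\<zero> \<prec> f"
    using assms pqr by (auto simp: fractions_def)
  have mc: "([m] \<cdot> c, d) \<in> fractions" using cl pos by (simp add: fractions_def)
  have "frac_leq r ([m] \<cdot> c, d)"
    using frac_leq_trans[OF assms(2)] frac_iterate_leq[of c d m] assms(5) mc cl pos pqr by blast
  then have "(e \<otimes> d) \<otimes> b \<lesssim> (([m] \<cdot> c) \<otimes> f) \<otimes> b"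
    using cl pqr by (simp add: coarse_leq_mult_right)
  moreover have "(c \<otimes> f) \<otimes> b = (c \<otimes> b) \<otimes> f" using cl by (simp add: m_ac)
  ultimately have z: "(e \<otimes> d) \<otimes> b \<lesssim> [m] \<cdot> ((c \<otimes> b) \<otimes> f)"
    using cl by (simp add: smul_mult)
  have "\<not> (c \<otimes> b) \<otimes> f \<lesssim> (a \<otimes> d) \<otimes> f"
    using assms(1) pqr cl pos by (simp add: coarse_leq_mult_iff)
  then have "\<not> (c \<otimes> b) \<otimes> f \<oplus> (e \<otimes> d) \<otimes> b \<lesssim> (a \<otimes> d) \<otimes> f \<oplus> (e \<otimes> d) \<otimes> b"
    using coarse_less_add[OF _ z] cl by simp
  then have "\<not> ((c \<otimes> b) \<otimes> f \<oplus> (e \<otimes> d) \<otimes> b) \<otimes> f \<lesssim> ((a \<otimes> d) \<otimes> f \<oplus> (e \<otimes> d) \<otimes> b) \<otimes> f"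
    using cl pos by (simp add: coarse_leq_mult_iff)
  then show ?thesis using cl pqr by (simp add: l_distr r_distr m_ac)
qed

lemma measuring_presemiring_fractions:
  "measuring_presemiring fractions frac_add frac_mult (\<zero>, \<one>) (\<one>, \<one>) frac_leq"
proof
  show "\<And>p q. \<lbrakk>p \<in> fractions; q \<in> fractions\<rbrakk> \<Longrightarrow> frac_add p q \<in> fractions"
    "\<And>p q. \<lbrakk>p \<in> fractions; q \<in> fractions\<rbrakk> \<Longrightarrow> frac_mult p q \<in> fractions"
    using fractions_closed by blast+
  show "(\<zero>, \<one>) \<in> fractions" "(\<one>, \<one>) \<in> fractions"
    using zero_less_one by (simp_all add: fractions_def)
  show "\<And>p q. \<lbrakk>p \<in> fractions; q \<in> fractions\<rbrakk> \<Longrightarrow> frac_leq p q \<or> frac_leq q p"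
    by (auto simp: fractions_def) (metis coarse_leq_total m_closed)
  show "\<And>p q r. \<lbrakk>frac_leq p q; frac_leq q r; p \<in> fractions; q \<in> fractions; r \<in> fractions\<rbrakk> \<Longrightarrow> frac_leq p r"
    using frac_leq_trans by blast
  show "\<And>p q r. \<lbrakk>p \<in> fractions; q \<in> fractions; r \<in> fractions\<rbrakk> \<Longrightarrow> frac_add (frac_add p q) r = frac_add p (frac_add q r)"
    by (auto simp: fractions_def l_distr r_distr m_ac a_ac)
  show "\<And>p q. \<lbrakk>p \<in> fractions; q \<in> fractions\<rbrakk> \<Longrightarrow> frac_add p q = frac_add q p"
    by (auto simp: fractions_def m_comm a_comm)
  show "\<And>p. p \<in> fractions \<Longrightarrow> frac_add (\<zero>, \<one>) p = p"
    by (auto simp: fractions_def)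
  show "\<And>p q r. \<lbrakk>p \<in> fractions; q \<in> fractions; r \<in> fractions\<rbrakk> \<Longrightarrow> frac_mult (frac_mult p q) r = frac_mult p (frac_mult q r)"
    by (auto simp: fractions_def m_assoc)
  show "\<And>p q. \<lbrakk>p \<in> fractions; q \<in> fractions\<rbrakk> \<Longrightarrow> frac_mult p q = frac_mult q p"
    by (auto simp: fractions_def m_comm)
  show "\<And>p. p \<in> fractions \<Longrightarrow> frac_mult (\<one>, \<one>) p = p"
    by (auto simp: fractions_def)
  show "frac_leq (frac_mult (frac_add p q) r) (frac_add (frac_mult p r) (frac_mult q r)) \<and>
      frac_leq (frac_add (frac_mult p r) (frac_mult q r)) (frac_mult (frac_add p q) r)"
    if "p \<in> fractions" "q \<in> fractions" "r \<in> fractions" for p q r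
  proof -
    obtain a b c d e f where pqr: "p = (a, b)" "q = (c, d)" "r = (e, f)" by (metis surj_pair)
    have cl: "a \<in> carrier S" "b \<in> carrier S" "c \<in> carrier S" "d \<in> carrier S" "e \<in> carrier S" "f \<in> carrier S"
      and pos: "\<zero> \<prec> b" "\<zero> \<prec> d" "\<zero> \<prec> f"
      using that pqr by (auto simp: fractions_def)
    have "frac_add (frac_mult p r) (frac_mult q r) = ((a \<otimes> d \<oplus> c \<otimes> b) \<otimes> e \<otimes> f, b \<otimes> d \<otimes> f \<otimes> f)"
      using cl pqr by (simp add: l_distr r_distr m_ac)
    moreover have "frac_mult (frac_add p q) r = ((a \<otimes> d \<oplus> c \<otimes> b) \<otimes> e, b \<otimes> d \<otimes> f)"
      using pqr by simp
    ultimately show ?thesis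
      using frac_leq_expand[of "(a \<otimes> d \<oplus> c \<otimes> b) \<otimes> e" "b \<otimes> d \<otimes> f" f] cl pos mult_pos by simp
  qed
  show "\<And>p. p \<in> fractions \<Longrightarrow> frac_leq (frac_mult (\<zero>, \<one>) p) (\<zero>, \<one>)"
    by (auto simp: fractions_def leq_imp_coarse_leq)
  show "\<And>p. p \<in> fractions \<Longrightarrow> frac_leq (\<zero>, \<one>) p"
    by (auto simp: fractions_def leq_imp_coarse_leq zero_leq)
  show "\<And>p q r. \<lbrakk>frac_leq p q; p \<in> fractions; q \<in> fractions; r \<in> fractions\<rbrakk> \<Longrightarrow> frac_leq (frac_add p r) (frac_add q r)"
    using frac_add_leq by blast
  show "\<And>p q r. \<lbrakk>frac_leq p q; p \<in> fractions; q \<in> fractions; r \<in> fractions\<rbrakk> \<Longrightarrow> frac_leq (frac_mult p r) (frac_mult q r)"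
    using frac_mult_leq by blast
  show "\<not> frac_leq (frac_mult p q) (\<zero>, \<one>)"
    if "\<not> frac_leq p (\<zero>, \<one>)" "\<not> frac_leq q (\<zero>, \<one>)" "p \<in> fractions" "q \<in> fractions" for p q
  proof -
    obtain a b c d where pq: "p = (a, b)" "q = (c, d)" by (metis surj_pair)
    have cl: "a \<in> carrier S" "b \<in> carrier S" "c \<in> carrier S" "d \<in> carrier S"
      using that pq by (auto simp: fractions_def)
    have "\<zero> \<prec> a" "\<zero> \<prec> c"
      using that(1,2) pq cl by (simp_all add: coarse_leq_zero zero_less_iff)
    then have "\<zero> \<prec> a \<otimes> c" using mult_pos cl by blast
    then show ?thesis using pq cl by (simp add: coarse_leq_zero zero_less_iff)
  qed
  show "\<not> frac_leq (\<one>, \<one>) (\<zero>, \<one>)"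
    using zero_not_one by (simp add: coarse_leq_zero)
  show "\<And>p q r m. \<lbrakk>\<not> frac_leq q p; frac_leq r ((frac_add q ^^ m) (\<zero>, \<one>)); p \<in> fractions; q \<in> fractions; r \<in> fractions\<rbrakk>
     \<Longrightarrow> \<not> frac_leq (frac_add q r) (frac_add p r)"
    using frac_add_less by blast
qed

text \<open>
  A fraction is coded by choosing a representative pair and mapping it into the carrier with an injection
  of \<open>S \<times> S\<close> into \<open>S\<close>, which exists because \<open>S\<close> is infinite.
\<close>

lemma fraction_semiring:
  obtains T :: "'a ord_ring" and quo where "fraction_map S T quo"
proof -
  interpret Q: measuring_presemiring fractions frac_add frac_mult "(\<zero>, \<one>)" "(\<one>, \<one>)" frac_leq
    by (rule measuring_presemiring_fractions)
  have "(card_of (carrier S \<times> carrier S), card_of (carrier S)) \<in> ordLeq"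
    using card_of_Times_same_infinite[OF infinite_carrier] ordIso_imp_ordLeq by blast
  then obtain i :: "'a \<times> 'a \<Rightarrow> 'a" where i: "inj_on i (carrier S \<times> carrier S)"
    using card_of_ordLeq by metis
  define rep where "rep p = (SOME q. q \<in> fractions \<and> frac_leq p q \<and> frac_leq q p)" for p
  have rep: "rep p \<in> fractions \<and> frac_leq p (rep p) \<and> frac_leq (rep p) p" if "p \<in> fractions" for p
    unfolding rep_def by (rule someI[of _ p]) (use that Q.le_total in blast)
  define code where "code p = i (rep p)" for p
  have code: "code p = code q \<longleftrightarrow> frac_leq p q \<and> frac_leq q p" if pq: "p \<in> fractions" "q \<in> fractions" for p q
  proof
    assume "code p = code q"
    moreover have "rep p \<in> carrier S \<times> carrier S" "rep q \<in> carrier S \<times> carrier S"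
      using rep[OF pq(1)] rep[OF pq(2)] by (auto simp: fractions_def)
    ultimately have "rep p = rep q" using i by (simp add: code_def inj_on_eq_iff)
    then show "frac_leq p q \<and> frac_leq q p"
      using frac_leq_trans rep[OF pq(1)] rep[OF pq(2)] pq by metis
  next
    assume "frac_leq p q \<and> frac_leq q p"
    then have "(\<lambda>r. r \<in> fractions \<and> frac_leq p r \<and> frac_leq r p) = (\<lambda>r. r \<in> fractions \<and> frac_leq q r \<and> frac_leq r q)"
      using frac_leq_trans pq by blast
    then show "code p = code q" by (simp add: code_def rep_def)
  qed
  obtain T :: "'a ord_ring" where T: "measuring_semiring T" "carrier T = code ` fractions"
    "\<And>p q. \<lbrakk>p \<in> fractions; q \<in> fractions\<rbrakk> \<Longrightarrow> code p \<oplus>\<^bsub>T\<^esub> code q = code (frac_add p q)"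
    "\<And>p q. \<lbrakk>p \<in> fractions; q \<in> fractions\<rbrakk> \<Longrightarrow> code p \<otimes>\<^bsub>T\<^esub> code q = code (frac_mult p q)"
    "\<zero>\<^bsub>T\<^esub> = code (\<zero>, \<one>)" "\<one>\<^bsub>T\<^esub> = code (\<one>, \<one>)"
    by (rule Q.quotient_measuring_semiring[of code, OF code]) (assumption | rule that)+
  have F: "(a, b) \<in> fractions \<longleftrightarrow> a \<in> carrier S \<and> b \<in> carrier S \<and> \<zero> \<prec> b" for a b
    by (simp add: fractions_def)
  show thesis
  proof (rule that[of T "\<lambda>a b. code (a, b)"],
      intro fraction_map.intro fraction_map_axioms.intro measuring_semiring_axioms T(1))
    show "\<And>a b. \<lbrakk>a \<in> carrier S; b \<in> carrier S; \<zero> \<prec> b\<rbrakk> \<Longrightarrow> code (a, b) \<in> carrier T"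
      by (simp add: T F)
    show "\<And>a c b. \<lbrakk>a \<in> carrier S; c \<in> carrier S; b \<in> carrier S; \<zero> \<prec> b\<rbrakk>
       \<Longrightarrow> code (a \<oplus> c, b) = code (a, b) \<oplus>\<^bsub>T\<^esub> code (c, b)"
      using frac_add_common_denominator by (simp add: T F code fractions_closed del: frac_add.simps)
    show "\<And>a b c d. \<lbrakk>a \<in> carrier S; b \<in> carrier S; c \<in> carrier S; d \<in> carrier S; \<zero> \<prec> b; \<zero> \<prec> d\<rbrakk>
       \<Longrightarrow> code (a, b) \<otimes>\<^bsub>T\<^esub> code (c, d) = code (a \<otimes> c, b \<otimes> d)"
      by (simp add: T F)
    show "\<And>a b c. \<lbrakk>a \<in> carrier S; b \<in> carrier S; c \<in> carrier S; \<zero> \<prec> b; \<zero> \<prec> c\<rbrakk>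
       \<Longrightarrow> code (a \<otimes> c, b \<otimes> c) = code (a, b)"
      using frac_leq_expand mult_pos by (simp add: F code del: frac_leq.simps)
    show "\<And>b. \<lbrakk>b \<in> carrier S; \<zero> \<prec> b\<rbrakk> \<Longrightarrow> code (b, b) = \<one>\<^bsub>T\<^esub>"
      using zero_less_one by (simp add: T F code leq_imp_coarse_leq)
    show "\<And>b. \<lbrakk>b \<in> carrier S; \<zero> \<prec> b\<rbrakk> \<Longrightarrow> code (\<zero>, b) = \<zero>\<^bsub>T\<^esub>"
      using zero_less_one by (simp add: T F code leq_imp_coarse_leq)
  qed
qed

end

section \<open>Definable predicates\<close>

lemma tuples_Nil [simp]: "tuples M [] = {[]}"
  by (auto simp: tuples_def)

lemma tuples_Cons: "v \<in> tuples M (s # ss) \<longleftrightarrow> (\<exists>a w. v = a # w \<and> a \<in> universe M s \<and> w \<in> tuples M ss)"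
  by (auto simp: tuples_def list_all2_Cons2)

lemma bex_tuples_Cons:
  "(\<exists>v \<in> tuples M (s # ss). P v) \<longleftrightarrow> (\<exists>a \<in> universe M s. \<exists>w \<in> tuples M ss. P (a # w))"
  unfolding Bex_def tuples_Cons by blast

lemma tuples_single [simp]: "tuples M [s] = (\<lambda>a. [a]) ` universe M s"
  by (auto simp: tuples_Cons)

lemma length_tuples: "v \<in> tuples M ss \<Longrightarrow> length v = length ss"
  by (simp add: tuples_def list_all2_lengthD)

lemma append_in_tuples: "\<lbrakk>v \<in> tuples M xs; w \<in> tuples M ys\<rbrakk> \<Longrightarrow> v @ w \<in> tuples M (xs @ ys)"
  by (simp add: tuples_def list_all2_appendI)

lemma tuples_append: "v \<in> tuples M (xs @ ys) \<longleftrightarrow> (\<exists>a b. v = a @ b \<and> a \<in> tuples M xs \<and> b \<in> tuples M ys)"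
proof (induction xs arbitrary: v)
  case (Cons s xs)
  then show ?case by (simp add: tuples_Cons) (metis append_Cons)
qed simp

text \<open>
  Definability is treated as a property of predicates on tuples, so that closure properties replace
  manipulations of de Bruijn formulas.
\<close>

definition dfn :: "('s, 'f, 'r, 'a) struct \<Rightarrow> 's list \<Rightarrow> ('a list \<Rightarrow> bool) \<Rightarrow> bool" where
  "dfn M \<Gamma> P \<longleftrightarrow> (\<exists>\<phi>. formula M \<Gamma> \<phi> \<and> (\<forall>v \<in> tuples M \<Gamma>. sat M v \<phi> \<longleftrightarrow> P v))"

lemma dfnI: "\<lbrakk>formula M \<Gamma> \<phi>; \<And>v. v \<in> tuples M \<Gamma> \<Longrightarrow> sat M v \<phi> \<longleftrightarrow> P v\<rbrakk> \<Longrightarrow> dfn M \<Gamma> P"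
  unfolding dfn_def by blast

lemma dfn_cong: "\<lbrakk>dfn M \<Gamma> P; \<And>v. v \<in> tuples M \<Gamma> \<Longrightarrow> P v \<longleftrightarrow> Q v\<rbrakk> \<Longrightarrow> dfn M \<Gamma> Q"
  unfolding dfn_def by blast

lemma dfn_False: "dfn M \<Gamma> (\<lambda>v. False)"
  by (rule dfnI[of _ _ FBot]) auto

lemma dfn_not: "dfn M \<Gamma> P \<Longrightarrow> dfn M \<Gamma> (\<lambda>v. \<not> P v)"
  unfolding dfn_def by (metis formula.simps(4) sat.simps(4))

lemma dfn_and: "\<lbrakk>dfn M \<Gamma> P; dfn M \<Gamma> Q\<rbrakk> \<Longrightarrow> dfn M \<Gamma> (\<lambda>v. P v \<and> Q v)"
  unfolding dfn_def by (metis formula.simps(5) sat.simps(5))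

lemma dfn_or: "\<lbrakk>dfn M \<Gamma> P; dfn M \<Gamma> Q\<rbrakk> \<Longrightarrow> dfn M \<Gamma> (\<lambda>v. P v \<or> Q v)"
  using dfn_not[OF dfn_and[OF dfn_not dfn_not]] by simp

lemma dfn_const: "dfn M \<Gamma> (\<lambda>v. c)"
  by (cases c) (use dfn_False dfn_not[OF dfn_False] in simp_all)

lemma dfn_finite_ex: "\<lbrakk>finite I; \<And>i. i \<in> I \<Longrightarrow> dfn M \<Gamma> (P i)\<rbrakk> \<Longrightarrow> dfn M \<Gamma> (\<lambda>v. \<exists>i \<in> I. P i v)"
  by (induction rule: finite_induct) (auto intro: dfn_const dfn_or)

lemma dfn_ex_Cons:
  assumes "s \<in> sorts M" "dfn M (s # \<Gamma>) P"
  shows "dfn M \<Gamma> (\<lambda>v. \<exists>a \<in> universe M s. P (a # v))"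
proof -
  obtain \<phi> where "formula M (s # \<Gamma>) \<phi>" "\<forall>v \<in> tuples M (s # \<Gamma>). sat M v \<phi> \<longleftrightarrow> P v"
    using assms unfolding dfn_def by blast
  then show ?thesis using assms by (intro dfnI[of _ _ "FEx s \<phi>"]) (auto simp: tuples_Cons)
qed

lemma dfn_ex_left:
  "\<lbrakk>set \<Delta> \<subseteq> sorts M; dfn M (\<Delta> @ \<Gamma>) P\<rbrakk> \<Longrightarrow> dfn M \<Gamma> (\<lambda>v. \<exists>a \<in> tuples M \<Delta>. P (a @ v))"
proof (induction \<Delta> arbitrary: P)
  case (Cons s \<Delta>)
  then have "dfn M (\<Delta> @ \<Gamma>) (\<lambda>v. \<exists>a \<in> universe M s. P (a # v))" by (auto intro: dfn_ex_Cons)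
  then have "dfn M \<Gamma> (\<lambda>v. \<exists>a \<in> tuples M \<Delta>. \<exists>x \<in> universe M s. P (x # (a @ v)))" using Cons by simp
  then show ?case by (rule dfn_cong) (auto simp: bex_tuples_Cons)
qed simp

subsection \<open>Substitution of terms\<close>

text \<open>
  The maps along which definable predicates can be pulled back by syntactic substitution.  Besides the
  coordinate projections they include, in \<open>Meq M\<close>, the quotient maps.
\<close>

definition term_map ::
  "('s, 'f, 'r, 'a) struct \<Rightarrow> 's list \<Rightarrow> 's list \<Rightarrow> ('a list \<Rightarrow> 'a list) \<Rightarrow> bool" where
  "term_map M \<Gamma> \<Delta> g \<longleftrightarrow>
     (\<exists>ts. list_all2 (has_sort M \<Gamma>) ts \<Delta> \<and> (\<forall>v \<in> tuples M \<Gamma>. g v = map (eval M v) ts))"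

lemma term_mapI:
  "\<lbrakk>list_all2 (has_sort M \<Gamma>) ts \<Delta>; \<And>v. v \<in> tuples M \<Gamma> \<Longrightarrow> g v = map (eval M v) ts\<rbrakk> \<Longrightarrow> term_map M \<Gamma> \<Delta> g"
  unfolding term_map_def by blast

lemma term_map_cong:
  "\<lbrakk>term_map M \<Gamma> \<Delta> g; \<And>v. v \<in> tuples M \<Gamma> \<Longrightarrow> g v = g' v\<rbrakk> \<Longrightarrow> term_map M \<Gamma> \<Delta> g'"
  unfolding term_map_def by (metis (no_types, lifting))

lemma has_sort_subst:
  assumes "has_sort M \<Delta> t s" "list_all2 (has_sort M \<Gamma>) us \<Delta>"
  shows "\<exists>t'. has_sort M \<Gamma> t' s \<and> (\<forall>v. eval M v t' = eval M (map (eval M v) us) t)"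
  using assms(1)
proof induction
  case (1 i)
  then show ?case using assms(2)
    by (intro exI[of _ "us ! i"]) (auto simp: list_all2_conv_all_nth)
next
  case (2 f ts)
  let ?Q = "\<lambda>t s t'. has_sort M \<Gamma> t' s \<and> (\<forall>v. eval M v t' = eval M (map (eval M v) us) t)"
  have "\<forall>i < length ts. \<exists>t'. ?Q (ts ! i) (fun_dom M f ! i) t'" and len: "length ts = length (fun_dom M f)"
    using 2(2) by (auto simp: list_all2_conv_all_nth)
  then obtain F where F: "\<And>i. i < length ts \<Longrightarrow> ?Q (ts ! i) (fun_dom M f ! i) (F i)"
    by metis
  let ?ts = "map F [0..<length ts]"
  have "has_sort M \<Gamma> (Fn f ?ts) (fun_cod M f)"
    using 2(1) F len by (intro has_sort.intros) (auto simp: list_all2_conv_all_nth)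
  moreover have "map (eval M v) ?ts = map (eval M (map (eval M v) us)) ts" for v
    using F by (intro nth_equalityI) auto
  ultimately show ?case by (intro exI[of _ "Fn f ?ts"]) (simp del: map_map)
qed

lemma list_has_sort_subst:
  assumes "list_all2 (has_sort M \<Delta>) ts \<Theta>" "list_all2 (has_sort M \<Gamma>) us \<Delta>"
  shows "\<exists>ts'. list_all2 (has_sort M \<Gamma>) ts' \<Theta> \<and> (\<forall>v. map (eval M v) ts' = map (eval M (map (eval M v) us)) ts)"
  using assms(1)
proof induction
  case (Cons t ts s \<Theta>)
  then obtain ts' t' where "list_all2 (has_sort M \<Gamma>) ts' \<Theta>" "has_sort M \<Gamma> t' s"
    "\<forall>v. map (eval M v) ts' = map (eval M (map (eval M v) us)) ts"
    "\<forall>v. eval M v t' = eval M (map (eval M v) us) t"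
    using has_sort_subst[OF Cons(1) assms(2)] by blast
  then show ?case by (intro exI[of _ "t' # ts'"]) simp
qed auto

lemma term_map_coords:
  assumes "length is = length \<Delta>" "\<And>k. k < length \<Delta> \<Longrightarrow> is ! k < length \<Gamma> \<and> \<Gamma> ! (is ! k) = \<Delta> ! k"
  shows "term_map M \<Gamma> \<Delta> (\<lambda>v. map ((!) v) is)"
proof (rule term_mapI)
  show "list_all2 (has_sort M \<Gamma>) (map Var is) \<Delta>"
    using assms by (auto simp: list_all2_conv_all_nth) (metis has_sort.intros(1))
qed simp

lemma term_map_take: "term_map M (\<Gamma> @ \<Delta>) \<Gamma> (take (length \<Gamma>))"
  by (rule term_map_cong[OF term_map_coords[of "[0..<length \<Gamma>]"]])
    (auto simp: length_tuples nth_append intro!: nth_equalityI)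

lemma term_map_drop: "term_map M (\<Gamma> @ \<Delta>) \<Delta> (drop (length \<Gamma>))"
  by (rule term_map_cong[OF term_map_coords[of "[length \<Gamma>..<length \<Gamma> + length \<Delta>]"]])
    (auto simp: length_tuples nth_append intro!: nth_equalityI)

lemma term_map_append:
  "\<lbrakk>term_map M \<Gamma> \<Delta> g; term_map M \<Gamma> \<Delta>' g'\<rbrakk> \<Longrightarrow> term_map M \<Gamma> (\<Delta> @ \<Delta>') (\<lambda>v. g v @ g' v)"
  unfolding term_map_def by (metis (no_types, lifting) list_all2_appendI map_append)

text \<open>
  At a quantifier the substitution is extended by the bound variable, and its old part is composed
  with the map that forgets this variable; composing with term maps plays the role of lifting indices.
\<close>

lemma dfn_subst_formula:
  "\<lbrakk>formula M \<Delta> \<phi>; term_map M \<Gamma> \<Delta> g\<rbrakk> \<Longrightarrow> dfn M \<Gamma> (\<lambda>v. sat M (g v) \<phi>)"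
proof (induction \<phi> arbitrary: \<Gamma> \<Delta> g)
  case FBot
  then show ?case by (simp add: dfn_False)
next
  case (FEq t u)
  obtain us where us: "list_all2 (has_sort M \<Gamma>) us \<Delta>" "\<forall>v \<in> tuples M \<Gamma>. g v = map (eval M v) us"
    using FEq(2) unfolding term_map_def by blast
  obtain s where "has_sort M \<Delta> t s" "has_sort M \<Delta> u s" using FEq(1) by auto
  then obtain t' u' where "has_sort M \<Gamma> t' s" "has_sort M \<Gamma> u' s"
    "\<forall>v. eval M v t' = eval M (map (eval M v) us) t" "\<forall>v. eval M v u' = eval M (map (eval M v) us) u"
    using has_sort_subst us(1) by metis
  then show ?case using us(2) by (intro dfnI[of _ _ "FEq t' u'"]) auto
next
  case (FRel r ts)
  obtain us where us: "list_all2 (has_sort M \<Gamma>) us \<Delta>" "\<forall>v \<in> tuples M \<Gamma>. g v = map (eval M v) us"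
    using FRel(2) unfolding term_map_def by blast
  obtain ts' where "list_all2 (has_sort M \<Gamma>) ts' (rel_dom M r)"
    "\<forall>v. map (eval M v) ts' = map (eval M (map (eval M v) us)) ts"
    using list_has_sort_subst us(1) FRel(1) by (metis formula.simps(3))
  then show ?case using us(2) FRel(1) by (intro dfnI[of _ _ "FRel r ts'"]) auto
next
  case (FNeg \<phi>)
  then show ?case using dfn_not by fastforce
next
  case (FAnd \<phi> \<psi>)
  then show ?case using dfn_and[of M \<Gamma> "\<lambda>v. sat M (g v) \<phi>" "\<lambda>v. sat M (g v) \<psi>"] by fastforce
next
  case (FEx s \<phi>)
  obtain us where us: "list_all2 (has_sort M \<Gamma>) us \<Delta>" "\<forall>v \<in> tuples M \<Gamma>. g v = map (eval M v) us"
    using FEx(3) unfolding term_map_def by blast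
  have "term_map M (s # \<Gamma>) \<Gamma> (drop 1)" using term_map_drop[of M "[s]" \<Gamma>] by simp
  then obtain ws where ws: "list_all2 (has_sort M (s # \<Gamma>)) ws \<Gamma>" "\<forall>v \<in> tuples M (s # \<Gamma>). drop 1 v = map (eval M v) ws"
    unfolding term_map_def by blast
  obtain us' where us': "list_all2 (has_sort M (s # \<Gamma>)) us' \<Delta>"
    "\<forall>v. map (eval M v) us' = map (eval M (map (eval M v) ws)) us"
    using list_has_sort_subst us(1) ws(1) by metis
  have "term_map M (s # \<Gamma>) \<Delta> (\<lambda>v. g (drop 1 v))"
  proof (rule term_mapI[OF us'(1)])
    fix v assume v: "v \<in> tuples M (s # \<Gamma>)"
    then have "g (drop 1 v) = map (eval M (drop 1 v)) us" using us(2) by (auto simp: tuples_Cons)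
    then show "g (drop 1 v) = map (eval M v) us'" using us'(2) ws(2) v by metis
  qed
  moreover have "term_map M (s # \<Gamma>) [s] (take 1)" using term_map_take[of M "[s]" \<Gamma>] by simp
  ultimately have "term_map M (s # \<Gamma>) ([s] @ \<Delta>) (\<lambda>v. take 1 v @ g (drop 1 v))"
    using term_map_append by blast
  then have "dfn M (s # \<Gamma>) (\<lambda>v. sat M (take 1 v @ g (drop 1 v)) \<phi>)"
    using FEx(1)[of "s # \<Delta>" "s # \<Gamma>"] FEx(2) by simp
  then have "dfn M \<Gamma> (\<lambda>v. \<exists>a \<in> universe M s. sat M (take 1 (a # v) @ g (drop 1 (a # v))) \<phi>)"
    by (rule dfn_ex_Cons[rotated]) (use FEx(2) in simp)
  then show ?case by simp
qed

lemma term_map_comp: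
  assumes "term_map M \<Gamma> \<Delta> g" "term_map M \<Delta> \<Theta> k" "\<And>v. v \<in> tuples M \<Gamma> \<Longrightarrow> g v \<in> tuples M \<Delta>"
  shows "term_map M \<Gamma> \<Theta> (\<lambda>v. k (g v))"
proof -
  obtain us where us: "list_all2 (has_sort M \<Gamma>) us \<Delta>" "\<forall>v \<in> tuples M \<Gamma>. g v = map (eval M v) us"
    using assms unfolding term_map_def by blast
  obtain ts where ts: "list_all2 (has_sort M \<Delta>) ts \<Theta>" "\<forall>v \<in> tuples M \<Delta>. k v = map (eval M v) ts"
    using assms unfolding term_map_def by blast
  obtain ts' where "list_all2 (has_sort M \<Gamma>) ts' \<Theta>"
    "\<forall>v. map (eval M v) ts' = map (eval M (map (eval M v) us)) ts"
    using list_has_sort_subst us(1) ts(1) by metis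
  then show ?thesis using us ts assms(3) by (intro term_mapI[of _ _ ts']) auto
qed

context many_sorted_structure
begin

lemma eval_closed:
  assumes "has_sort M \<Gamma> t s" "v \<in> tuples M \<Gamma>"
  shows "eval M v t \<in> universe M s"
  using assms(1)
proof induction
  case (1 i)
  then show ?case using assms(2) by (auto simp: tuples_def list_all2_conv_all_nth)
next
  case (2 f ts)
  then have "map (eval M v) ts \<in> tuples M (fun_dom M f)"
    by (auto simp: tuples_def list_all2_conv_all_nth)
  then show ?case using fun_interp_closed 2 by simp
qed

lemma term_map_closed: "\<lbrakk>term_map M \<Gamma> \<Delta> g; v \<in> tuples M \<Gamma>\<rbrakk> \<Longrightarrow> g v \<in> tuples M \<Delta>"
  unfolding term_map_def by (auto simp: tuples_def[of _ \<Delta>] list_all2_conv_all_nth eval_closed)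

lemma dfn_subst:
  assumes "dfn M \<Delta> P" "term_map M \<Gamma> \<Delta> g"
  shows "dfn M \<Gamma> (\<lambda>v. P (g v))"
proof -
  obtain \<phi> where "formula M \<Delta> \<phi>" "\<forall>v \<in> tuples M \<Delta>. sat M v \<phi> \<longleftrightarrow> P v"
    using assms unfolding dfn_def by blast
  then show ?thesis
    using dfn_cong[OF dfn_subst_formula] assms(2) term_map_closed by (metis (no_types, lifting))
qed

lemma dfn_eq:
  assumes "term_map M \<Gamma> \<Delta> g" "term_map M \<Gamma> \<Delta> k"
  shows "dfn M \<Gamma> (\<lambda>v. g v = k v)"
proof -
  have *: "dfn M \<Gamma> (\<lambda>v. map (eval M v) ts = map (eval M v) us)"
    if "list_all2 (has_sort M \<Gamma>) ts \<Delta>" "list_all2 (has_sort M \<Gamma>) us \<Delta>" for ts us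
    using that
  proof (induction ts \<Delta> arbitrary: us rule: list_all2_induct)
    case (Cons t ts s \<Delta>)
    then obtain u us' where u: "us = u # us'" "has_sort M \<Gamma> u s" "list_all2 (has_sort M \<Gamma>) us' \<Delta>"
      by (auto simp: list_all2_Cons2)
    have "dfn M \<Gamma> (\<lambda>v. eval M v t = eval M v u)"
      using Cons(1) u by (intro dfnI[of _ _ "FEq t u"]) auto
    then show ?case using dfn_and[OF _ Cons(3)[OF u(3)]] u by simp
  qed (simp add: dfn_const)
  obtain ts us where tu: "list_all2 (has_sort M \<Gamma>) ts \<Delta>" "list_all2 (has_sort M \<Gamma>) us \<Delta>"
    "\<forall>v \<in> tuples M \<Gamma>. g v = map (eval M v) ts" "\<forall>v \<in> tuples M \<Gamma>. k v = map (eval M v) us"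
    using assms unfolding term_map_def by metis
  show ?thesis by (rule dfn_cong[OF *[OF tu(1,2)]]) (use tu(3,4) in auto)
qed

end

subsection \<open>Parameters\<close>

definition pdef :: "('s, 'f, 'r, 'a) struct \<Rightarrow> 's list \<Rightarrow> ('a list \<Rightarrow> bool) \<Rightarrow> bool" where
  "pdef M \<Gamma> P \<longleftrightarrow> (\<exists>ys b Q. set ys \<subseteq> sorts M \<and> b \<in> tuples M ys \<and> dfn M (\<Gamma> @ ys) Q \<and>
     (\<forall>v \<in> tuples M \<Gamma>. P v \<longleftrightarrow> Q (v @ b)))"

lemma pdefI:
  "\<lbrakk>set ys \<subseteq> sorts M; b \<in> tuples M ys; dfn M (\<Gamma> @ ys) Q; \<And>v. v \<in> tuples M \<Gamma> \<Longrightarrow> P v \<longleftrightarrow> Q (v @ b)\<rbrakk>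
   \<Longrightarrow> pdef M \<Gamma> P"
  unfolding pdef_def by blast

lemma pdefE:
  assumes "pdef M \<Gamma> P"
  obtains ys b Q where "set ys \<subseteq> sorts M" "b \<in> tuples M ys" "dfn M (\<Gamma> @ ys) Q"
    "\<And>v. v \<in> tuples M \<Gamma> \<Longrightarrow> P v \<longleftrightarrow> Q (v @ b)"
  using assms unfolding pdef_def by blast

lemma pdef_cong: "\<lbrakk>pdef M \<Gamma> P; \<And>v. v \<in> tuples M \<Gamma> \<Longrightarrow> P v \<longleftrightarrow> Q v\<rbrakk> \<Longrightarrow> pdef M \<Gamma> Q"
  unfolding pdef_def by metis

lemma dfn_imp_pdef: "dfn M \<Gamma> P \<Longrightarrow> pdef M \<Gamma> P"
  by (rule pdefI[of "[]" _ "[]" _ P]) auto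

lemma Def0_iff:
  "(xs, A) \<in> Def0 M \<longleftrightarrow> set xs \<subseteq> sorts M \<and> A \<subseteq> tuples M xs \<and> dfn M xs (\<lambda>v. v \<in> A)"
  unfolding Def0_def dfn_def solutions_def by auto

lemma Def0_CollectI: "\<lbrakk>set xs \<subseteq> sorts M; dfn M xs P\<rbrakk> \<Longrightarrow> (xs, {v \<in> tuples M xs. P v}) \<in> Def0 M"
  unfolding Def0_iff by (auto elim!: dfn_cong)

lemma Def_iff:
  "(xs, A) \<in> Def M \<longleftrightarrow> set xs \<subseteq> sorts M \<and> A \<subseteq> tuples M xs \<and> pdef M xs (\<lambda>v. v \<in> A)"
proof
  assume "(xs, A) \<in> Def M"
  then obtain ys \<phi> b where *: "A = solutions M xs \<phi> b" "set xs \<subseteq> sorts M" "set ys \<subseteq> sorts M"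
    "formula M (xs @ ys) \<phi>" "b \<in> tuples M ys" unfolding Def_def by blast
  have "dfn M (xs @ ys) (\<lambda>v. sat M v \<phi>)" using * by (blast intro: dfnI)
  then have "pdef M xs (\<lambda>v. v \<in> A)" using * by (intro pdefI) (auto simp: solutions_def)
  then show "set xs \<subseteq> sorts M \<and> A \<subseteq> tuples M xs \<and> pdef M xs (\<lambda>v. v \<in> A)"
    using * by (auto simp: solutions_def)
next
  assume *: "set xs \<subseteq> sorts M \<and> A \<subseteq> tuples M xs \<and> pdef M xs (\<lambda>v. v \<in> A)"
  then have A: "set xs \<subseteq> sorts M" "A \<subseteq> tuples M xs" "pdef M xs (\<lambda>v. v \<in> A)" by auto
  obtain ys b Q where *: "set ys \<subseteq> sorts M" "b \<in> tuples M ys" "dfn M (xs @ ys) Q"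
    "\<And>v. v \<in> tuples M xs \<Longrightarrow> v \<in> A \<longleftrightarrow> Q (v @ b)" by (rule pdefE[OF A(3)]) (rule that)
  then obtain \<phi> where \<phi>: "formula M (xs @ ys) \<phi>" "\<And>v. v \<in> tuples M (xs @ ys) \<Longrightarrow> sat M v \<phi> \<longleftrightarrow> Q v"
    unfolding dfn_def by blast
  have "A = solutions M xs \<phi> b" using A * \<phi> append_in_tuples unfolding solutions_def by blast
  then show "(xs, A) \<in> Def M" using A * \<phi> unfolding Def_def by blast
qed

lemma Def_CollectI: "\<lbrakk>set xs \<subseteq> sorts M; pdef M xs P\<rbrakk> \<Longrightarrow> (xs, {v \<in> tuples M xs. P v}) \<in> Def M"
  unfolding Def_iff by (auto elim!: pdef_cong)

context many_sorted_structure
begin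

lemma pdef_not: "pdef M \<Gamma> P \<Longrightarrow> pdef M \<Gamma> (\<lambda>v. \<not> P v)"
  by (erule pdefE, rule pdefI, assumption, assumption, erule dfn_not) simp

lemma pdef_and:
  assumes "pdef M \<Gamma> P" "pdef M \<Gamma> Q"
  shows "pdef M \<Gamma> (\<lambda>v. P v \<and> Q v)"
proof -
  obtain ys b P' where P: "set ys \<subseteq> sorts M" "b \<in> tuples M ys" "dfn M (\<Gamma> @ ys) P'"
    "\<And>v. v \<in> tuples M \<Gamma> \<Longrightarrow> P v \<longleftrightarrow> P' (v @ b)" by (rule pdefE[OF assms(1)]) (rule that)
  obtain zs c Q' where Q: "set zs \<subseteq> sorts M" "c \<in> tuples M zs" "dfn M (\<Gamma> @ zs) Q'"
    "\<And>v. v \<in> tuples M \<Gamma> \<Longrightarrow> Q v \<longleftrightarrow> Q' (v @ c)" by (rule pdefE[OF assms(2)]) (rule that)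
  let ?n = "length \<Gamma>" and ?m = "length ys"
  have 1: "dfn M ((\<Gamma> @ ys) @ zs) (\<lambda>v. P' (take (length (\<Gamma> @ ys)) v))"
    by (rule dfn_subst[OF P(3) term_map_take])
  have "term_map M (\<Gamma> @ ys @ zs) zs (\<lambda>v. drop ?m (drop ?n v))"
    by (rule term_map_comp[OF term_map_drop term_map_drop term_map_closed[OF term_map_drop]])
  then have 2: "dfn M (\<Gamma> @ ys @ zs) (\<lambda>v. Q' (take ?n v @ drop ?m (drop ?n v)))"
    using dfn_subst[OF Q(3) term_map_append[OF term_map_take]] by blast
  have D: "dfn M (\<Gamma> @ ys @ zs) (\<lambda>v. P' (take (length (\<Gamma> @ ys)) v) \<and> Q' (take ?n v @ drop ?m (drop ?n v)))"
    using dfn_and 1 2 by fastforce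
  show ?thesis
    by (rule pdefI[where b = "b @ c", OF _ _ D]) (use P Q in \<open>auto simp: append_in_tuples length_tuples\<close>)
qed

lemma pdef_or: "\<lbrakk>pdef M \<Gamma> P; pdef M \<Gamma> Q\<rbrakk> \<Longrightarrow> pdef M \<Gamma> (\<lambda>v. P v \<or> Q v)"
  using pdef_not[OF pdef_and[OF pdef_not pdef_not]] by simp

lemma pdef_const: "pdef M \<Gamma> (\<lambda>v. c)"
  by (rule dfn_imp_pdef[OF dfn_const])

lemma pdef_subst:
  assumes "pdef M \<Delta> P" "term_map M \<Gamma> \<Delta> g"
  shows "pdef M \<Gamma> (\<lambda>v. P (g v))"
proof -
  obtain ys b Q where *: "set ys \<subseteq> sorts M" "b \<in> tuples M ys" "dfn M (\<Delta> @ ys) Q"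
    "\<And>v. v \<in> tuples M \<Delta> \<Longrightarrow> P v \<longleftrightarrow> Q (v @ b)" by (rule pdefE[OF assms(1)]) (rule that)
  have "term_map M (\<Gamma> @ ys) \<Delta> (\<lambda>v. g (take (length \<Gamma>) v))"
    by (rule term_map_comp[OF term_map_take assms(2) term_map_closed[OF term_map_take]])
  then have D: "dfn M (\<Gamma> @ ys) (\<lambda>v. Q (g (take (length \<Gamma>) v) @ drop (length \<Gamma>) v))"
    using dfn_subst[OF *(3) term_map_append[OF _ term_map_drop]] by blast
  show ?thesis
    by (rule pdefI[OF *(1,2) D]) (use *(4) term_map_closed[OF assms(2)] in \<open>auto simp: length_tuples\<close>)
qed

lemma pdef_ex_left:
  assumes "set \<Delta> \<subseteq> sorts M" "pdef M (\<Delta> @ \<Gamma>) P"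
  shows "pdef M \<Gamma> (\<lambda>v. \<exists>a \<in> tuples M \<Delta>. P (a @ v))"
proof -
  obtain ys b Q where *: "set ys \<subseteq> sorts M" "b \<in> tuples M ys" "dfn M ((\<Delta> @ \<Gamma>) @ ys) Q"
    "\<And>v. v \<in> tuples M (\<Delta> @ \<Gamma>) \<Longrightarrow> P v \<longleftrightarrow> Q (v @ b)" by (rule pdefE[OF assms(2)]) (rule that)
  have D: "dfn M (\<Gamma> @ ys) (\<lambda>v. \<exists>a \<in> tuples M \<Delta>. Q (a @ v))"
    using * dfn_ex_left[OF assms(1)] by simp
  show ?thesis
    by (rule pdefI[OF *(1,2) D]) (use *(4) in \<open>auto simp: append_in_tuples\<close>)
qed

lemma pdef_ex_right:
  assumes "set \<Delta> \<subseteq> sorts M" "pdef M (\<Gamma> @ \<Delta>) P"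
  shows "pdef M \<Gamma> (\<lambda>v. \<exists>a \<in> tuples M \<Delta>. P (v @ a))"
  by (rule pdef_cong[OF pdef_ex_left[OF assms(1) pdef_subst[OF assms(2) term_map_append[OF term_map_drop term_map_take]]]])
   (auto simp: length_tuples)

lemma pdef_param:
  assumes "set ys \<subseteq> sorts M" "pdef M (xs @ ys) P" "b \<in> tuples M ys"
  shows "pdef M xs (\<lambda>v. P (v @ b))"
proof -
  obtain zs c Q where *: "set zs \<subseteq> sorts M" "c \<in> tuples M zs" "dfn M ((xs @ ys) @ zs) Q"
    "\<And>v. v \<in> tuples M (xs @ ys) \<Longrightarrow> P v \<longleftrightarrow> Q (v @ c)" by (rule pdefE[OF assms(2)]) (rule that)
  show ?thesis
    by (rule pdefI[of "ys @ zs" _ "b @ c" _ Q]) (use *(1,2,3) *(4)[of "_ @ b"] assms in \<open>auto simp: append_in_tuples\<close>)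
qed

end

section \<open>Coordinates for imaginary elements\<close>

text \<open>
  An imaginary element of sort \<open>s\<close> is represented by a tuple of elements of \<open>M\<close> of sorts \<open>block s\<close>, and \<open>point s\<close>
  maps representatives to the element they represent.  On tuples, \<open>proj\<close> cuts a long tuple into blocks.
\<close>

primrec block :: "('s, 'a) eq_sort \<Rightarrow> 's list" where
  "block (Home s) = [s]"
| "block (Quot ss E) = ss"

primrec point :: "('s, 'a) eq_sort \<Rightarrow> 'a list \<Rightarrow> 'a eq_elem" where
  "point (Home s) = (\<lambda>v. Elem (hd v))"
| "point (Quot ss E) = (\<lambda>v. Class (E `` {v}))"

definition flat :: "('s, 'a) eq_sort list \<Rightarrow> 's list" where
  "flat ts = concat (map block ts)"

primrec proj :: "('s, 'a) eq_sort list \<Rightarrow> 'a list \<Rightarrow> 'a eq_elem list" where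
  "proj [] v = []"
| "proj (s # ts) v = point s (take (length (block s)) v) # proj ts (drop (length (block s)) v)"

lemma flat_simps [simp]:
  "flat [] = []" "flat (s # ts) = block s @ flat ts" "flat (ts @ us) = flat ts @ flat us"
  "flat (map Home xs) = xs"
proof -
  show "flat (map Home xs) = xs" by (induction xs) (simp_all add: flat_def)
qed (simp_all add: flat_def)

lemma proj_append:
  "length v = length (flat ts) \<Longrightarrow> proj (ts @ us) (v @ w) = proj ts v @ proj us w"
  by (induction ts arbitrary: v) simp_all

lemma proj_Home: "length v = length xs \<Longrightarrow> proj (map Home xs) v = map Elem v"
proof (induction xs arbitrary: v)
  case (Cons x xs)
  then show ?case by (cases v) simp_all
qed simp

lemma length_proj [simp]: "length (proj ts v) = length ts"
  by (induction ts arbitrary: v) simp_all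

lemma sorts_Meq: "sorts (Meq M) = Home ` sorts M \<union> {Quot ss E | ss E. (ss, E) \<in> def_equivs M}"
  and funs_Meq: "funs (Meq M) = Old ` funs M \<union> {Proj ss E | ss E. (ss, E) \<in> def_equivs M}"
  and fun_dom_Meq: "fun_dom (Meq M) (Old f) = map Home (fun_dom M f)"
    "fun_dom (Meq M) (Proj ss E) = map Home ss"
  and fun_cod_Meq: "fun_cod (Meq M) (Old f) = Home (fun_cod M f)"
    "fun_cod (Meq M) (Proj ss E) = Quot ss E"
  and rels_Meq: "rels (Meq M) = rels M" "rel_dom (Meq M) r = map Home (rel_dom M r)"
  and universe_Meq: "universe (Meq M) (Home s) = Elem ` universe M s"
    "universe (Meq M) (Quot ss E) = Class ` (tuples M ss // E)"
  and fun_interp_Meq: "fun_interp (Meq M) (Old f) xs = Elem (fun_interp M f (map the_elem xs))"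
    "fun_interp (Meq M) (Proj ss E) xs = Class (E `` {map the_elem xs})"
  and rel_interp_Meq: "rel_interp (Meq M) r xs = rel_interp M r (map the_elem xs)"
  by (simp_all add: Meq_def)

lemma def_equivsD:
  assumes "(ss, E) \<in> def_equivs M"
  shows "set ss \<subseteq> sorts M" "equiv (tuples M ss) E" "dfn M (ss @ ss) (\<lambda>v. v \<in> {a @ b | a b. (a, b) \<in> E})"
  using assms by (auto simp: def_equivs_def Def0_iff)

lemma set_block: "s \<in> sorts (Meq M) \<Longrightarrow> set (block s) \<subseteq> sorts M"
  by (auto simp: sorts_Meq def_equivs_def)

lemma set_flat: "set ts \<subseteq> sorts (Meq M) \<Longrightarrow> set (flat ts) \<subseteq> sorts M"
  using set_block by (induction ts) auto

lemma universe_Meq_point: "universe (Meq M) s = point s ` tuples M (block s)"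
  by (cases s) (auto simp: universe_Meq quotient_def image_image)

text \<open>
  Every tuple of \<open>Meq M\<close> has representatives, also when it contains classes: a class is the class of one
  of its members.
\<close>

lemma tuples_Meq: "tuples (Meq M) ts = proj ts ` tuples M (flat ts)"
proof (induction ts)
  case (Cons s ts)
  show ?case
  proof (intro equalityI subsetI)
    fix w assume "w \<in> tuples (Meq M) (s # ts)"
    then obtain a v where "a \<in> tuples M (block s)" "v \<in> tuples M (flat ts)" "w = point s a # proj ts v"
      using Cons by (auto simp: tuples_Cons universe_Meq_point)
    then show "w \<in> proj (s # ts) ` tuples M (flat (s # ts))"
      by (intro image_eqI[of _ _ "a @ v"]) (auto simp: append_in_tuples length_tuples)
  next
    fix w assume "w \<in> proj (s # ts) ` tuples M (flat (s # ts))"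
    then show "w \<in> tuples (Meq M) (s # ts)"
      using Cons by (auto simp: tuples_Cons universe_Meq_point tuples_append length_tuples)
  qed
qed simp

lemma proj_in_tuples: "v \<in> tuples M (flat ts) \<Longrightarrow> proj ts v \<in> tuples (Meq M) ts"
  by (simp add: tuples_Meq)

lemma tuples_map_Home: "tuples (Meq M) (map Home xs) = map Elem ` tuples M xs"
  by (auto simp: tuples_Meq proj_Home length_tuples intro!: image_eqI)

context many_sorted_structure
begin

lemma many_sorted_structure_Meq: "many_sorted_structure (Meq M)"
proof
  show "f \<in> funs (Meq M) \<Longrightarrow> set (fun_dom (Meq M) f) \<subseteq> sorts (Meq M)" for f
    using fun_dom_sorts def_equivsD(1) by (fastforce simp: funs_Meq sorts_Meq fun_dom_Meq)
  show "f \<in> funs (Meq M) \<Longrightarrow> fun_cod (Meq M) f \<in> sorts (Meq M)" for f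
    using fun_cod_sorts by (auto simp: funs_Meq sorts_Meq fun_cod_Meq)
  show "r \<in> rels (Meq M) \<Longrightarrow> set (rel_dom (Meq M) r) \<subseteq> sorts (Meq M)" for r
    using rel_dom_sorts by (force simp: rels_Meq sorts_Meq)
  show "fun_interp (Meq M) f xs \<in> universe (Meq M) (fun_cod (Meq M) f)"
    if "f \<in> funs (Meq M)" "xs \<in> tuples (Meq M) (fun_dom (Meq M) f)" for f xs
    using that fun_interp_closed
    by (auto simp: funs_Meq fun_dom_Meq fun_cod_Meq fun_interp_Meq universe_Meq tuples_map_Home comp_def quotientI)
qed

text \<open>
  For a quotient sort, two representatives give the same element if they are equivalent, and the
  equivalence relation is definable.
\<close>

lemma dfn_point_eq:
  assumes "s \<in> sorts (Meq M)"
  shows "dfn M (block s @ block s) (\<lambda>v. point s (take (length (block s)) v) = point s (drop (length (block s)) v))"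
proof (cases s)
  case (Home t)
  have D: "dfn M ([t] @ [t]) (\<lambda>v. take (length [t]) v = drop (length [t]) v)"
    by (rule dfn_eq[OF term_map_take term_map_drop])
  show ?thesis unfolding Home block.simps by (rule dfn_cong[OF D]) (auto simp: tuples_Cons)
next
  case (Quot ss E)
  then have "(ss, E) \<in> def_equivs M" using assms by (auto simp: sorts_Meq)
  note E = def_equivsD[OF this]
  show ?thesis
  proof (rule dfn_cong)
    show "dfn M (block s @ block s) (\<lambda>v. v \<in> {a @ b | a b. (a, b) \<in> E})" using E(3) Quot by simp
    fix v assume "v \<in> tuples M (block s @ block s)"
    then obtain a b where v: "v = a @ b" "a \<in> tuples M ss" "b \<in> tuples M ss"
      using Quot by (auto simp: tuples_append)
    have "a @ b \<in> {a @ b | a b. (a, b) \<in> E} \<longleftrightarrow> (a, b) \<in> E"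
    proof
      assume "a @ b \<in> {a @ b | a b. (a, b) \<in> E}"
      then obtain a' b' where ab: "a @ b = a' @ b'" "(a', b') \<in> E" by auto
      then have "a' \<in> tuples M ss" using E(2) unfolding equiv_def by blast
      then show "(a, b) \<in> E" using ab v by (simp add: length_tuples)
    qed auto
    then show "v \<in> {a @ b | a b. (a, b) \<in> E} \<longleftrightarrow>
      point s (take (length (block s)) v) = point s (drop (length (block s)) v)"
      using v Quot eq_equiv_class_iff[OF E(2)] by (simp add: length_tuples)
  qed
qed

lemma dfn_proj_eq:
  "set ts \<subseteq> sorts (Meq M) \<Longrightarrow>
   dfn M (flat ts @ flat ts) (\<lambda>v. proj ts (take (length (flat ts)) v) = proj ts (drop (length (flat ts)) v))"
proof (induction ts)
  case (Cons s ts)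
  let ?B = "block s" and ?F = "flat ts"
  let ?b = "length ?B" and ?f = "length ?F"
  let ?fst = "take (length (?B @ ?F))" and ?snd = "drop (length (?B @ ?F))"
  have F: "term_map M ((?B @ ?F) @ (?B @ ?F)) (?B @ ?F) ?fst" and S: "term_map M ((?B @ ?F) @ (?B @ ?F)) (?B @ ?F) ?snd"
    by (rule term_map_take, rule term_map_drop)
  have t: "term_map M ((?B @ ?F) @ (?B @ ?F)) (?B @ ?B) (\<lambda>v. take ?b (?fst v) @ take ?b (?snd v))"
    by (intro term_map_append term_map_comp[OF F term_map_take] term_map_comp[OF S term_map_take]
        term_map_closed[OF F] term_map_closed[OF S])
  have d: "term_map M ((?B @ ?F) @ (?B @ ?F)) (?F @ ?F) (\<lambda>v. drop ?b (?fst v) @ drop ?b (?snd v))"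
    by (intro term_map_append term_map_comp[OF F term_map_drop] term_map_comp[OF S term_map_drop]
        term_map_closed[OF F] term_map_closed[OF S])
  have "s \<in> sorts (Meq M)" "set ts \<subseteq> sorts (Meq M)" using Cons(2) by auto
  then have D: "dfn M ((?B @ ?F) @ (?B @ ?F)) (\<lambda>v.
    (let u = take ?b (?fst v) @ take ?b (?snd v) in point s (take ?b u) = point s (drop ?b u)) \<and>
    (let u = drop ?b (?fst v) @ drop ?b (?snd v) in proj ts (take ?f u) = proj ts (drop ?f u)))"
    using dfn_and[OF dfn_subst[OF dfn_point_eq t] dfn_subst[OF Cons(1) d]] by (simp add: Let_def)
  show ?case
    unfolding flat_simps
  proof (rule dfn_cong[OF D])
    fix v assume "v \<in> tuples M ((?B @ ?F) @ (?B @ ?F))"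
    then obtain a b a' b' where v: "v = (a @ b) @ (a' @ b')" and
      "a \<in> tuples M ?B" "b \<in> tuples M ?F" "a' \<in> tuples M ?B" "b' \<in> tuples M ?F"
      unfolding tuples_append by blast
    then have "length a = ?b" "length b = ?f" "length a' = ?b" "length b' = ?f"
      by (simp_all add: length_tuples)
    then show "((let u = take ?b (?fst v) @ take ?b (?snd v) in point s (take ?b u) = point s (drop ?b u)) \<and>
      (let u = drop ?b (?fst v) @ drop ?b (?snd v) in proj ts (take ?f u) = proj ts (drop ?f u))) \<longleftrightarrow>
      proj (s # ts) (?fst v) = proj (s # ts) (?snd v)"
      by (simp add: v Let_def)
  qed
qed (simp add: dfn_const)

lemma Var_translation:
  "i < length ts \<Longrightarrow> \<exists>g. term_map M (flat ts) (block (ts ! i)) g \<and>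
     (\<forall>v \<in> tuples M (flat ts). proj ts v ! i = point (ts ! i) (g v))"
proof (induction ts arbitrary: i)
  case (Cons s ts)
  show ?case
  proof (cases i)
    case 0
    then show ?thesis using term_map_take[of M "block s" "flat ts"] by (intro exI[of _ "take (length (block s))"]) auto
  next
    case (Suc j)
    then obtain g where g: "term_map M (flat ts) (block (ts ! j)) g"
      "\<forall>v \<in> tuples M (flat ts). proj ts v ! j = point (ts ! j) (g v)"
      using Cons by auto
    note D = term_map_drop[of M "block s" "flat ts"]
    have "term_map M (block s @ flat ts) (block (ts ! j)) (\<lambda>v. g (drop (length (block s)) v))"
      by (rule term_map_comp[OF D g(1) term_map_closed[OF D]])
    then show ?thesis using Suc g(2) term_map_closed[OF D]
      by (intro exI[of _ "\<lambda>v. g (drop (length (block s)) v)"]) auto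
  qed
qed simp

lemma term_translation_list:
  assumes "list_all2 (\<lambda>t s. \<exists>g. term_map M (flat ts) (block s) g \<and>
     (\<forall>v \<in> tuples M (flat ts). eval (Meq M) (proj ts v) t = point s (g v))) us ss"
  shows "\<exists>g. term_map M (flat ts) (flat ss) g \<and>
     (\<forall>v \<in> tuples M (flat ts). map (eval (Meq M) (proj ts v)) us = proj ss (g v))"
  using assms
proof induction
  case Nil
  show ?case by (intro exI[of _ "\<lambda>_. []"]) (auto simp: term_map_def)
next
  case (Cons u us s ss)
  then obtain g k where g: "term_map M (flat ts) (block s) g"
    "\<forall>v \<in> tuples M (flat ts). eval (Meq M) (proj ts v) u = point s (g v)"
    and k: "term_map M (flat ts) (flat ss) k"
    "\<forall>v \<in> tuples M (flat ts). map (eval (Meq M) (proj ts v)) us = proj ss (k v)" by blast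
  have "length (g v) = length (block s)" if "v \<in> tuples M (flat ts)" for v
    using term_map_closed[OF g(1) that] by (rule length_tuples)
  then show ?case using g k term_map_append[OF g(1) k(1)]
    by (intro exI[of _ "\<lambda>v. g v @ k v"]) simp
qed

text \<open>
  The value of a term of \<open>Meq M\<close> has a representative that depends on representatives of the
  variables through terms of \<open>M\<close>.  This holds because symbols of the original language apply to home sorts only,
  and a quotient map applied to a tuple is represented by that tuple itself.
\<close>

lemma term_translation:
  assumes "has_sort (Meq M) ts t s"
  shows "\<exists>g. term_map M (flat ts) (block s) g \<and>
     (\<forall>v \<in> tuples M (flat ts). eval (Meq M) (proj ts v) t = point s (g v))"
  using assms
proof induction
  case (1 i)
  then show ?case using Var_translation by simp
next
  case (2 f us)
  have "list_all2 (\<lambda>t s. \<exists>g. term_map M (flat ts) (block s) g \<and>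
     (\<forall>v \<in> tuples M (flat ts). eval (Meq M) (proj ts v) t = point s (g v))) us (fun_dom (Meq M) f)"
    using 2(2) by (rule list_all2_mono) blast
  then obtain g where g: "term_map M (flat ts) (flat (fun_dom (Meq M) f)) g"
     "\<forall>v \<in> tuples M (flat ts). map (eval (Meq M) (proj ts v)) us = proj (fun_dom (Meq M) f) (g v)"
    using term_translation_list by blast
  note len = length_tuples[OF term_map_closed[OF g(1)]]
  show ?case
  proof (cases f)
    case (Old f')
    then have f': "f' \<in> funs M" using 2(1) by (auto simp: funs_Meq)
    obtain ts' where ts': "list_all2 (has_sort M (flat ts)) ts' (fun_dom M f')"
      "\<forall>v \<in> tuples M (flat ts). g v = map (eval M v) ts'"
      using g(1) Old by (auto simp: fun_dom_Meq term_map_def)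
    have "term_map M (flat ts) [fun_cod M f'] (\<lambda>v. [fun_interp M f' (g v)])"
      using ts' f' by (intro term_mapI[of _ _ "[Fn f' ts']"]) (auto intro: has_sort.intros)
    then show ?thesis using g(2) len Old
      by (intro exI[of _ "\<lambda>v. [fun_interp M f' (g v)]"])
        (simp add: fun_cod_Meq fun_dom_Meq fun_interp_Meq proj_Home comp_def)
  next
    case (Proj ss E)
    then show ?thesis using g len
      by (intro exI[of _ g]) (simp add: fun_cod_Meq fun_dom_Meq fun_interp_Meq proj_Home comp_def)
  qed
qed

lemma has_sort_sorts: "\<lbrakk>has_sort M ts t s; set ts \<subseteq> sorts M\<rbrakk> \<Longrightarrow> s \<in> sorts M"
  by (erule has_sort.cases) (auto simp: fun_cod_sorts)

text \<open>
  Quantification over a quotient sort becomes quantification over representatives, and equality of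
  classes becomes equivalence of representatives.
\<close>

lemma formula_translation:
  "\<lbrakk>formula (Meq M) ts \<phi>; set ts \<subseteq> sorts (Meq M)\<rbrakk> \<Longrightarrow> dfn M (flat ts) (\<lambda>v. sat (Meq M) (proj ts v) \<phi>)"
proof (induction \<phi> arbitrary: ts)
  case FBot
  then show ?case by (simp add: dfn_False)
next
  case (FEq t u)
  interpret Meq: many_sorted_structure "Meq M" by (rule many_sorted_structure_Meq)
  obtain s where s: "has_sort (Meq M) ts t s" "has_sort (Meq M) ts u s" using FEq by auto
  obtain g where g: "term_map M (flat ts) (block s) g"
    "\<forall>v \<in> tuples M (flat ts). eval (Meq M) (proj ts v) t = point s (g v)"
    using term_translation[OF s(1)] by blast
  obtain k where k: "term_map M (flat ts) (block s) k"
    "\<forall>v \<in> tuples M (flat ts). eval (Meq M) (proj ts v) u = point s (k v)"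
    using term_translation[OF s(2)] by blast
  have "s \<in> sorts (Meq M)" using Meq.has_sort_sorts s(1) FEq(2) by blast
  from dfn_subst[OF dfn_point_eq[OF this] term_map_append[OF g(1) k(1)]]
  show ?case
    by (rule dfn_cong) (use g(2) k(2) length_tuples[OF term_map_closed[OF g(1)]] in simp)
next
  case (FRel r us)
  then have "list_all2 (has_sort (Meq M) ts) us (map Home (rel_dom M r))" "r \<in> rels M"
    by (simp_all add: rels_Meq)
  then have "list_all2 (\<lambda>t s. \<exists>g. term_map M (flat ts) (block s) g \<and>
     (\<forall>v \<in> tuples M (flat ts). eval (Meq M) (proj ts v) t = point s (g v))) us (map Home (rel_dom M r))"
    by (elim list_all2_mono) (rule term_translation)
  from term_translation_list[OF this] obtain g where g: "term_map M (flat ts) (rel_dom M r) g"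
     "\<forall>v \<in> tuples M (flat ts). map (eval (Meq M) (proj ts v)) us = proj (map Home (rel_dom M r)) (g v)"
    by auto
  obtain ts' where ts': "list_all2 (has_sort M (flat ts)) ts' (rel_dom M r)"
      "\<forall>v \<in> tuples M (flat ts). g v = map (eval M v) ts'"
      using g(1) by (auto simp: term_map_def)
  show ?case
    by (rule dfnI[of _ _ "FRel r ts'"])
      (use g(2) ts' \<open>r \<in> rels M\<close> length_tuples[OF term_map_closed[OF g(1)]] in
        \<open>auto simp: rel_interp_Meq proj_Home comp_def\<close>)
next
  case (FNeg \<phi>)
  then show ?case using dfn_not by fastforce
next
  case (FAnd \<phi> \<psi>)
  then have "dfn M (flat ts) (\<lambda>v. sat (Meq M) (proj ts v) \<phi> \<and> sat (Meq M) (proj ts v) \<psi>)"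
    by (intro dfn_and) auto
  then show ?case by simp
next
  case (FEx s \<phi>)
  then have s: "s \<in> sorts (Meq M)" by simp
  have "dfn M (block s @ flat ts) (\<lambda>v. sat (Meq M) (proj (s # ts) v) \<phi>)"
    using FEx(1)[of "s # ts"] FEx(2,3) by simp
  from dfn_ex_left[OF set_block[OF s] this] show ?case
    by (rule dfn_cong) (auto simp: universe_Meq_point length_tuples)
qed

lemma dfn_Meq_imp_dfn:
  assumes "dfn (Meq M) ts P" "set ts \<subseteq> sorts (Meq M)"
  shows "dfn M (flat ts) (\<lambda>v. P (proj ts v))"
proof -
  obtain \<phi> where \<phi>: "formula (Meq M) ts \<phi>" "\<forall>v \<in> tuples (Meq M) ts. sat (Meq M) v \<phi> \<longleftrightarrow> P v"
    using assms(1) unfolding dfn_def by blast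
  show ?thesis
    by (rule dfn_cong[OF formula_translation[OF \<phi>(1) assms(2)]]) (use \<phi>(2) proj_in_tuples in blast)
qed

text \<open>
  The parameters are replaced by representatives.
\<close>

lemma pdef_Meq_imp_pdef:
  assumes "pdef (Meq M) ts P" "set ts \<subseteq> sorts (Meq M)"
  shows "pdef M (flat ts) (\<lambda>v. P (proj ts v))"
proof -
  obtain ys b Q where *: "set ys \<subseteq> sorts (Meq M)" "b \<in> tuples (Meq M) ys" "dfn (Meq M) (ts @ ys) Q"
    "\<And>v. v \<in> tuples (Meq M) ts \<Longrightarrow> P v \<longleftrightarrow> Q (v @ b)" by (rule pdefE[OF assms(1)]) (rule that)
  obtain c where c: "c \<in> tuples M (flat ys)" "b = proj ys c" using *(2) by (auto simp: tuples_Meq)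
  have "dfn M (flat ts @ flat ys) (\<lambda>v. Q (proj (ts @ ys) v))"
    using dfn_Meq_imp_dfn[OF *(3)] *(1) assms(2) by simp
  then show ?thesis
    by (rule pdefI[OF set_flat[OF *(1)] c(1)]) (use *(4) c in \<open>simp add: proj_append length_tuples proj_in_tuples\<close>)
qed

subsection \<open>Definability of images\<close>

lemma term_embedding:
  assumes "has_sort M xs t s"
  shows "\<exists>t'. has_sort (Meq M) (map Home xs) t' (Home s) \<and>
    (\<forall>w \<in> tuples M xs. eval (Meq M) (map Elem w) t' = Elem (eval M w t))"
  using assms
proof induction
  case (1 i)
  then show ?case using has_sort.intros(1)[of i "map Home xs" "Meq M"]
    by (intro exI[of _ "Var i"]) (auto simp: length_tuples)
next
  case (2 f ts)
  let ?Q = "\<lambda>t s t'. has_sort (Meq M) (map Home xs) t' (Home s) \<and>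
    (\<forall>w \<in> tuples M xs. eval (Meq M) (map Elem w) t' = Elem (eval M w t))"
  have "\<forall>i < length ts. \<exists>t'. ?Q (ts ! i) (fun_dom M f ! i) t'" and len: "length ts = length (fun_dom M f)"
    using 2(2) by (auto simp: list_all2_conv_all_nth)
  then obtain F where F: "\<And>i. i < length ts \<Longrightarrow> ?Q (ts ! i) (fun_dom M f ! i) (F i)"
    by metis
  let ?ts = "map F [0..<length ts]"
  have "has_sort (Meq M) (map Home xs) (Fn (Old f) ?ts) (fun_cod (Meq M) (Old f))"
    using 2(1) F len
    by (intro has_sort.intros) (auto simp: list_all2_conv_all_nth funs_Meq fun_dom_Meq)
  moreover have "map (the_elem \<circ> eval (Meq M) (map Elem w)) ?ts = map (eval M w) ts" if "w \<in> tuples M xs" for w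
    using F that by (intro nth_equalityI) auto
  ultimately show ?case
    by (intro exI[of _ "Fn (Old f) ?ts"]) (simp add: fun_cod_Meq fun_interp_Meq del: map_map add: map_map[symmetric])
qed

lemma formula_embedding:
  "formula M xs \<phi> \<Longrightarrow> \<exists>\<phi>'. formula (Meq M) (map Home xs) \<phi>' \<and>
    (\<forall>w \<in> tuples M xs. sat (Meq M) (map Elem w) \<phi>' \<longleftrightarrow> sat M w \<phi>)"
proof (induction \<phi> arbitrary: xs)
  case FBot
  show ?case by (intro exI[of _ FBot]) simp
next
  case (FEq t u)
  then obtain s where s: "has_sort M xs t s" "has_sort M xs u s" by auto
  obtain t' u' where "has_sort (Meq M) (map Home xs) t' (Home s)" "has_sort (Meq M) (map Home xs) u' (Home s)"
    "\<forall>w \<in> tuples M xs. eval (Meq M) (map Elem w) t' = Elem (eval M w t)"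
    "\<forall>w \<in> tuples M xs. eval (Meq M) (map Elem w) u' = Elem (eval M w u)"
    using term_embedding[OF s(1)] term_embedding[OF s(2)] by blast
  then show ?case by (intro exI[of _ "FEq t' u'"]) auto
next
  case (FRel r ts)
  let ?Q = "\<lambda>t s t'. has_sort (Meq M) (map Home xs) t' (Home s) \<and>
    (\<forall>w \<in> tuples M xs. eval (Meq M) (map Elem w) t' = Elem (eval M w t))"
  have "\<forall>i < length ts. \<exists>t'. ?Q (ts ! i) (rel_dom M r ! i) t'" and len: "length ts = length (rel_dom M r)"
    using FRel term_embedding by (auto simp: list_all2_conv_all_nth)
  then obtain F where F: "\<And>i. i < length ts \<Longrightarrow> ?Q (ts ! i) (rel_dom M r ! i) (F i)"
    by metis
  let ?ts = "map F [0..<length ts]"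
  have "map the_elem (map (eval (Meq M) (map Elem w)) ?ts) = map (eval M w) ts" if "w \<in> tuples M xs" for w
    using F that by (intro nth_equalityI) auto
  then show ?case using F len FRel
    by (intro exI[of _ "FRel r ?ts"]) (auto simp: list_all2_conv_all_nth rels_Meq rel_interp_Meq simp del: map_map)
next
  case (FNeg \<phi>)
  then obtain \<phi>' where "formula (Meq M) (map Home xs) \<phi>'"
    "\<forall>w \<in> tuples M xs. sat (Meq M) (map Elem w) \<phi>' \<longleftrightarrow> sat M w \<phi>" by auto
  then show ?case by (intro exI[of _ "FNeg \<phi>'"]) auto
next
  case (FAnd \<phi> \<psi>)
  obtain \<phi>' where "formula (Meq M) (map Home xs) \<phi>'"
    "\<forall>w \<in> tuples M xs. sat (Meq M) (map Elem w) \<phi>' \<longleftrightarrow> sat M w \<phi>" using FAnd(1)[of xs] FAnd(3) by auto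
  moreover obtain \<psi>' where "formula (Meq M) (map Home xs) \<psi>'"
    "\<forall>w \<in> tuples M xs. sat (Meq M) (map Elem w) \<psi>' \<longleftrightarrow> sat M w \<psi>" using FAnd(2)[of xs] FAnd(3) by auto
  ultimately show ?case by (intro exI[of _ "FAnd \<phi>' \<psi>'"]) auto
next
  case (FEx s \<phi>)
  then have "formula M (s # xs) \<phi>" by simp
  from FEx(1)[OF this] obtain \<phi>' where \<phi>': "formula (Meq M) (Home s # map Home xs) \<phi>'"
    "\<forall>w \<in> tuples M (s # xs). sat (Meq M) (map Elem w) \<phi>' \<longleftrightarrow> sat M w \<phi>" by auto
  then have "sat (Meq M) (Elem a # map Elem w) \<phi>' \<longleftrightarrow> sat M (a # w) \<phi>"
    if "a \<in> universe M s" "w \<in> tuples M xs" for a w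
    using that by (force simp: tuples_Cons)
  then show ?case using FEx(2) \<phi>'(1)
    by (intro exI[of _ "FEx (Home s) \<phi>'"]) (auto simp: sorts_Meq universe_Meq)
qed

lemma dfn_Home:
  assumes "dfn M xs P"
  shows "dfn (Meq M) (map Home xs) (\<lambda>v. P (map the_elem v))"
proof -
  obtain \<phi> where \<phi>: "formula M xs \<phi>" "\<forall>v \<in> tuples M xs. sat M v \<phi> \<longleftrightarrow> P v"
    using assms unfolding dfn_def by blast
  obtain \<phi>' where "formula (Meq M) (map Home xs) \<phi>'"
    "\<forall>w \<in> tuples M xs. sat (Meq M) (map Elem w) \<phi>' \<longleftrightarrow> sat M w \<phi>"
    using formula_embedding[OF \<phi>(1)] by blast
  then show ?thesis using \<phi>(2) by (intro dfnI) (auto simp: tuples_map_Home comp_def)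
qed

text \<open>
  The map from representatives to elements is given by terms of \<open>Meq M\<close>: a variable on a home sort, and
  the symbol of the quotient map otherwise.
\<close>

lemma term_map_point:
  assumes "s \<in> sorts (Meq M)"
  shows "term_map (Meq M) (map Home (block s)) [s] (\<lambda>v. [point s (map the_elem v)])"
proof (cases s)
  case (Home t)
  then show ?thesis
    using has_sort.intros(1)[of 0 "[Home t]" "Meq M"]
    by (intro term_mapI[of _ _ "[Var 0]"]) (auto simp: tuples_Cons universe_Meq)
next
  case (Quot ss E)
  then have E: "(ss, E) \<in> def_equivs M" using assms by (auto simp: sorts_Meq)
  let ?vs = "map Var [0..<length ss]"
  have "list_all2 (has_sort (Meq M) (map Home ss)) ?vs (map Home ss)"
    using has_sort.intros(1)[of _ "map Home ss" "Meq M"] by (auto simp: list_all2_conv_all_nth)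
  then have "has_sort (Meq M) (map Home ss) (Fn (Proj ss E) ?vs) (Quot ss E)"
    using E has_sort.intros(2)[of "Proj ss E" "Meq M" "map Home ss" ?vs] by (simp add: funs_Meq fun_dom_Meq fun_cod_Meq)
  moreover have "map (eval (Meq M) v) ?vs = v" if "v \<in> tuples (Meq M) (map Home ss)" for v
    using length_tuples[OF that] by (auto intro!: nth_equalityI)
  ultimately show ?thesis using Quot
    by (intro term_mapI[of _ _ "[Fn (Proj ss E) ?vs]"]) (auto simp: fun_interp_Meq simp del: map_map)
qed

lemma term_map_proj:
  "set ts \<subseteq> sorts (Meq M) \<Longrightarrow>
    term_map (Meq M) (map Home (flat ts)) ts (\<lambda>v. proj ts (map the_elem v))"
proof (induction ts)
  case Nil
  show ?case by (simp add: term_map_def)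
next
  case (Cons s ts)
  interpret Meq: many_sorted_structure "Meq M" by (rule many_sorted_structure_Meq)
  let ?B = "map Home (block s) :: ('s, 'a) eq_sort list" and ?F = "map Home (flat ts) :: ('s, 'a) eq_sort list"
  have T: "term_map (Meq M) (?B @ ?F) ?B (take (length ?B))" and D: "term_map (Meq M) (?B @ ?F) ?F (drop (length ?B))"
    by (rule term_map_take, rule term_map_drop)
  have s: "s \<in> sorts (Meq M)" and ts: "set ts \<subseteq> sorts (Meq M)" using Cons(2) by auto
  have "term_map (Meq M) (?B @ ?F) [s] (\<lambda>v. [point s (map the_elem (take (length ?B) v))])"
    by (rule term_map_comp[OF T term_map_point[OF s] Meq.term_map_closed[OF T]])
  moreover have "term_map (Meq M) (?B @ ?F) ts (\<lambda>v. proj ts (map the_elem (drop (length ?B) v)))"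
    by (rule term_map_comp[OF D Cons(1)[OF ts] Meq.term_map_closed[OF D]])
  ultimately have "term_map (Meq M) (?B @ ?F) ([s] @ ts)
    (\<lambda>v. [point s (map the_elem (take (length ?B) v))] @ proj ts (map the_elem (drop (length ?B) v)))"
    by (rule term_map_append)
  then show ?case by (simp add: take_map drop_map)
qed

text \<open>
  For the converse direction, a tuple of \<open>Meq M\<close> satisfies \<open>P\<close> if some representative of it, a tuple
  of home sorts, satisfies the pulled back predicate; a formula of \<open>M\<close> for the latter is also one of \<open>Meq M\<close>.
\<close>

lemma dfn_Meq_iff:
  assumes ts: "set ts \<subseteq> sorts (Meq M)"
  shows "dfn (Meq M) ts P \<longleftrightarrow> dfn M (flat ts) (\<lambda>v. P (proj ts v))"
proof
  assume "dfn M (flat ts) (\<lambda>v. P (proj ts v))"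
  interpret Meq: many_sorted_structure "Meq M" by (rule many_sorted_structure_Meq)
  let ?H = "map Home (flat ts) :: ('s, 'a) eq_sort list"
  let ?p = "\<lambda>v. proj ts (map the_elem (take (length ?H) v))"
  note T = term_map_take[of "Meq M" ?H ts]
  have p: "term_map (Meq M) (?H @ ts) ts ?p"
    by (rule term_map_comp[OF T term_map_proj[OF ts] Meq.term_map_closed[OF T]])
  have "dfn (Meq M) ?H (\<lambda>v. P (proj ts (map the_elem v)))"
    by (rule dfn_Home) fact
  then have "dfn (Meq M) (?H @ ts) (\<lambda>v. P (?p v))"
    using Meq.dfn_subst[OF _ T] by fastforce
  from dfn_and[OF this Meq.dfn_eq[OF p term_map_drop]]
  have "dfn (Meq M) (?H @ ts) (\<lambda>v. P (?p v) \<and> ?p v = drop (length ?H) v)" .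
  moreover have "set ?H \<subseteq> sorts (Meq M)" using set_flat[OF ts] by (auto simp: sorts_Meq)
  ultimately have D: "dfn (Meq M) ts (\<lambda>w. \<exists>a \<in> tuples (Meq M) ?H. P (?p (a @ w)) \<and> ?p (a @ w) = drop (length ?H) (a @ w))"
    using dfn_ex_left by blast
  show "dfn (Meq M) ts P"
  proof (rule dfn_cong[OF D])
    fix w assume "w \<in> tuples (Meq M) ts"
    then obtain v where "v \<in> tuples M (flat ts)" "w = proj ts v" by (auto simp: tuples_Meq)
    then show "(\<exists>a \<in> tuples (Meq M) ?H. P (?p (a @ w)) \<and> ?p (a @ w) = drop (length ?H) (a @ w)) \<longleftrightarrow> P w"
      by (auto simp: tuples_map_Home length_tuples comp_def)
  qed
qed (rule dfn_Meq_imp_dfn[OF _ ts])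

end

section \<open>Measures of definable predicates\<close>

text \<open>
  The functions of parameters that occur in the axiom on definable families: finitely many values, each taken
  on a set that is definable without parameters.  They are closed under pairing and under composition with
  arbitrary functions, so any finite computation with measures of members of families is again tame.
\<close>

definition tame :: "('s, 'f, 'r, 'a) struct \<Rightarrow> 's list \<Rightarrow> ('a list \<Rightarrow> 'x) \<Rightarrow> bool" where
  "tame M \<Delta> k \<longleftrightarrow> finite (k ` tuples M \<Delta>) \<and> (\<forall>e. dfn M \<Delta> (\<lambda>b. k b = e))"

lemma tame_cong: "\<lbrakk>tame M \<Delta> k; \<And>b. b \<in> tuples M \<Delta> \<Longrightarrow> k b = l b\<rbrakk> \<Longrightarrow> tame M \<Delta> l"
  unfolding tame_def by (auto elim!: dfn_cong)

lemma tame_dfn: "tame M \<Delta> k \<Longrightarrow> dfn M \<Delta> (\<lambda>b. k b = e)"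
  unfolding tame_def by blast

lemma tame_const: "tame M \<Delta> (\<lambda>b. c)"
  unfolding tame_def by (auto simp: dfn_const intro: finite_subset[of _ "{c}"])

lemma tame_comp:
  assumes "tame M \<Delta> k"
  shows "tame M \<Delta> (\<lambda>b. F (k b))"
  unfolding tame_def
proof (intro conjI allI)
  have fin: "finite (k ` tuples M \<Delta>)" using assms by (simp add: tame_def)
  then show "finite ((\<lambda>b. F (k b)) ` tuples M \<Delta>)"
    by (metis finite_imageI image_image)
  fix e
  have "dfn M \<Delta> (\<lambda>b. \<exists>y \<in> {y \<in> k ` tuples M \<Delta>. F y = e}. k b = y)"
    using fin tame_dfn[OF assms] by (intro dfn_finite_ex) auto
  then show "dfn M \<Delta> (\<lambda>b. F (k b) = e)" by (rule dfn_cong) auto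
qed

lemma tame_pair:
  assumes "tame M \<Delta> k" "tame M \<Delta> l"
  shows "tame M \<Delta> (\<lambda>b. (k b, l b))"
  unfolding tame_def
proof (intro conjI allI)
  have "(\<lambda>b. (k b, l b)) ` tuples M \<Delta> \<subseteq> k ` tuples M \<Delta> \<times> l ` tuples M \<Delta>" by auto
  then show "finite ((\<lambda>b. (k b, l b)) ` tuples M \<Delta>)"
    using assms finite_subset unfolding tame_def by blast
  show "dfn M \<Delta> (\<lambda>b. (k b, l b) = e)" for e
    using dfn_and[OF tame_dfn[OF assms(1)] tame_dfn[OF assms(2)], of "fst e" "snd e"]
    by (simp add: prod_eq_iff)
qed

lemma tame_restrict:
  "\<lbrakk>finite I; \<And>i. i \<in> I \<Longrightarrow> tame M \<Delta> (k i)\<rbrakk> \<Longrightarrow> tame M \<Delta> (\<lambda>b. restrict (\<lambda>i. k i b) I)"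
proof (induction rule: finite_induct)
  case empty
  then show ?case by (simp add: tame_const)
next
  case (insert i I)
  have "tame M \<Delta> (\<lambda>b. (k i b, restrict (\<lambda>i. k i b) I))"
    by (rule tame_pair[OF insert.prems insert.IH[OF insert.prems]]) auto
  from tame_comp[OF this, of "\<lambda>p. (snd p)(i := fst p)"] show ?case
    by (rule tame_cong) (auto simp: fun_eq_iff)
qed

context measurable_structure
begin

definition mu :: "'s list \<Rightarrow> ('a list \<Rightarrow> bool) \<Rightarrow> 'v" where
  "mu \<Gamma> P = h (\<Gamma>, {v \<in> tuples M \<Gamma>. P v})"

lemma mu_cong: "(\<And>v. v \<in> tuples M \<Gamma> \<Longrightarrow> P v \<longleftrightarrow> Q v) \<Longrightarrow> mu \<Gamma> P = mu \<Gamma> Q"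
  unfolding mu_def by (metis (mono_tags, lifting) Collect_cong)

lemma mu_closed: "\<lbrakk>set \<Gamma> \<subseteq> sorts M; pdef M \<Gamma> P\<rbrakk> \<Longrightarrow> mu \<Gamma> P \<in> carrier S"
  unfolding mu_def using h_closed Def_CollectI by blast

lemma mu_empty:
  assumes "set \<Gamma> \<subseteq> sorts M" "\<And>v. v \<in> tuples M \<Gamma> \<Longrightarrow> \<not> P v"
  shows "mu \<Gamma> P = \<zero>"
proof -
  have "pdef M \<Gamma> P" by (rule pdef_cong[OF pdef_const[of _ False]]) (use assms in auto)
  moreover have E: "{v \<in> tuples M \<Gamma>. P v} = {}" using assms by blast
  ultimately show ?thesis
    using h_finite[of \<Gamma> "{}"] Def_CollectI[OF assms(1), of P] unfolding mu_def E by simp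
qed

lemma mu_or:
  assumes "set \<Gamma> \<subseteq> sorts M" "pdef M \<Gamma> P" "pdef M \<Gamma> Q" "\<And>v. v \<in> tuples M \<Gamma> \<Longrightarrow> P v \<Longrightarrow> Q v \<Longrightarrow> False"
  shows "mu \<Gamma> (\<lambda>v. P v \<or> Q v) = mu \<Gamma> P \<oplus> mu \<Gamma> Q"
proof -
  have "{v \<in> tuples M \<Gamma>. P v \<or> Q v} = {v \<in> tuples M \<Gamma>. P v} \<union> {v \<in> tuples M \<Gamma>. Q v}" by blast
  then show ?thesis unfolding mu_def
    using h_disjoint_Un[OF Def_CollectI[OF assms(1,2)] Def_CollectI[OF assms(1,3)]] assms(4) by auto
qed

lemma pdef_eq_const:
  assumes "set \<Gamma> \<subseteq> sorts M" "b \<in> tuples M \<Gamma>"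
  shows "pdef M \<Gamma> (\<lambda>v. v = b)"
proof -
  have "pdef M (\<Gamma> @ \<Gamma>) (\<lambda>v. take (length \<Gamma>) v = drop (length \<Gamma>) v)"
    by (rule dfn_imp_pdef[OF dfn_eq[OF term_map_take term_map_drop]])
  from pdef_param[OF assms(1) this assms(2)] show ?thesis
    by (rule pdef_cong) (simp add: length_tuples)
qed

lemma mu_singleton:
  assumes "set \<Gamma> \<subseteq> sorts M" "b \<in> tuples M \<Gamma>"
  shows "mu \<Gamma> (\<lambda>v. v = b) = \<one>"
proof -
  have E: "{v \<in> tuples M \<Gamma>. v = b} = {b}" using assms by blast
  have "(\<Gamma>, {b}) \<in> Def M" using Def_CollectI[OF assms(1) pdef_eq_const[OF assms]] E by simp
  from h_finite[OF this] show ?thesis unfolding mu_def E by simp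
qed

text \<open>
  A nonempty set contains a point, whose measure is \<open>\<one>\<close>.
\<close>

lemma mu_pos:
  assumes "set \<Gamma> \<subseteq> sorts M" "pdef M \<Gamma> P" "b \<in> tuples M \<Gamma>" "P b"
  shows "\<zero> \<prec> mu \<Gamma> P"
proof -
  have d: "pdef M \<Gamma> (\<lambda>v. P v \<and> v \<noteq> b)"
    using pdef_and[OF assms(2) pdef_not[OF pdef_eq_const[OF assms(1,3)]]] .
  have "mu \<Gamma> P = mu \<Gamma> (\<lambda>v. v = b \<or> (P v \<and> v \<noteq> b))"
    by (rule mu_cong) (use assms in auto)
  also have "\<dots> = mu \<Gamma> (\<lambda>v. v = b) \<oplus> mu \<Gamma> (\<lambda>v. P v \<and> v \<noteq> b)"
    by (rule mu_or[OF assms(1) pdef_eq_const[OF assms(1,3)] d]) auto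
  finally have "mu \<Gamma> P = \<one> \<oplus> mu \<Gamma> (\<lambda>v. P v \<and> v \<noteq> b)" using mu_singleton assms by simp
  moreover have "\<one> \<oplus> \<zero> \<preceq> \<one> \<oplus> mu \<Gamma> (\<lambda>v. P v \<and> v \<noteq> b)"
    using mu_closed[OF assms(1) d] zero_leq by (intro add_leq_add) auto
  ultimately show ?thesis
    using zero_less_one less_leq_trans[of \<zero> \<one> "mu \<Gamma> P"] mu_closed[OF assms(1,2)] by simp
qed

text \<open>
  The graph of a term map is definable, so the axiom on fibres applies to it.
\<close>

lemma mu_fibres:
  assumes \<Gamma>: "set \<Gamma> \<subseteq> sorts M" and \<Delta>: "set \<Delta> \<subseteq> sorts M"
    and g: "term_map M \<Gamma> \<Delta> g" and P: "pdef M \<Gamma> P" and Q: "pdef M \<Delta> Q"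
    and PQ: "\<And>v. v \<in> tuples M \<Gamma> \<Longrightarrow> P v \<Longrightarrow> Q (g v)" and c: "c \<in> carrier S"
    and fib: "\<And>w. w \<in> tuples M \<Delta> \<Longrightarrow> Q w \<Longrightarrow> mu \<Gamma> (\<lambda>v. P v \<and> g v = w) = c"
  shows "mu \<Gamma> P = c \<otimes> mu \<Delta> Q"
proof -
  let ?X = "{v \<in> tuples M \<Gamma>. P v}" and ?Y = "{w \<in> tuples M \<Delta>. Q w}"
  note T = term_map_take[of M \<Gamma> \<Delta>]
  have gT: "term_map M (\<Gamma> @ \<Delta>) \<Delta> (\<lambda>u. g (take (length \<Gamma>) u))"
    by (rule term_map_comp[OF T g term_map_closed[OF T]])
  have "pdef M (\<Gamma> @ \<Delta>) (\<lambda>u. P (take (length \<Gamma>) u) \<and> g (take (length \<Gamma>) u) = drop (length \<Gamma>) u)"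
    by (intro pdef_and pdef_subst[OF P T] dfn_imp_pdef[OF dfn_eq[OF gT term_map_drop]])
  from Def_CollectI[OF _ this]
  have "(\<Gamma> @ \<Delta>, {u \<in> tuples M (\<Gamma> @ \<Delta>). P (take (length \<Gamma>) u) \<and> g (take (length \<Gamma>) u) = drop (length \<Gamma>) u}) \<in> Def M"
    using \<Gamma> \<Delta> by simp
  moreover have "{u \<in> tuples M (\<Gamma> @ \<Delta>). P (take (length \<Gamma>) u) \<and> g (take (length \<Gamma>) u) = drop (length \<Gamma>) u}
      = {v @ g v | v. v \<in> ?X}"
    using term_map_closed[OF g] by (fastforce simp: tuples_append length_tuples)
  ultimately have "definable_function M (\<Gamma>, ?X) (\<Delta>, ?Y) g"
    unfolding definable_function_def
    using Def_CollectI[OF \<Gamma> P] Def_CollectI[OF \<Delta> Q] PQ term_map_closed[OF g] by auto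
  from h_fibres[OF this c] show ?thesis
    using fib unfolding mu_def by (simp add: conj_assoc)
qed

lemma mu_bij:
  assumes \<Gamma>: "set \<Gamma> \<subseteq> sorts M" and \<Delta>: "set \<Delta> \<subseteq> sorts M"
    and g: "term_map M \<Gamma> \<Delta> g" and P: "pdef M \<Gamma> P" and Q: "pdef M \<Delta> Q"
    and PQ: "\<And>v. v \<in> tuples M \<Gamma> \<Longrightarrow> P v \<Longrightarrow> Q (g v)"
    and bij: "\<And>w. w \<in> tuples M \<Delta> \<Longrightarrow> Q w \<Longrightarrow> \<exists>v \<in> tuples M \<Gamma>. \<forall>u \<in> tuples M \<Gamma>. P u \<and> g u = w \<longleftrightarrow> u = v"
  shows "mu \<Gamma> P = mu \<Delta> Q"
proof -
  have "mu \<Gamma> P = \<one> \<otimes> mu \<Delta> Q"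
  proof (rule mu_fibres[OF \<Gamma> \<Delta> g P Q PQ])
    fix w assume "w \<in> tuples M \<Delta>" "Q w"
    then obtain v where v: "v \<in> tuples M \<Gamma>" "\<forall>u \<in> tuples M \<Gamma>. P u \<and> g u = w \<longleftrightarrow> u = v" using bij by blast
    have "mu \<Gamma> (\<lambda>u. P u \<and> g u = w) = mu \<Gamma> (\<lambda>u. u = v)" by (rule mu_cong) (use v in blast)
    then show "mu \<Gamma> (\<lambda>u. P u \<and> g u = w) = \<one>" using mu_singleton[OF \<Gamma> v(1)] by simp
  qed auto
  then show ?thesis using mu_closed[OF \<Delta> Q] by simp
qed

lemma pdef_slice_right:
  assumes "set \<Gamma> \<subseteq> sorts M" "pdef M (\<Gamma> @ \<Delta>) P" "v \<in> tuples M \<Gamma>"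
  shows "pdef M \<Delta> (\<lambda>w. P (v @ w))"
proof -
  have "pdef M (\<Delta> @ \<Gamma>) (\<lambda>u. P (drop (length \<Delta>) u @ take (length \<Delta>) u))"
    by (rule pdef_subst[OF assms(2) term_map_append[OF term_map_drop term_map_take]])
  from pdef_param[OF assms(1) this assms(3)] show ?thesis
    by (rule pdef_cong) (simp add: length_tuples)
qed

text \<open>
  If all sections of a set have the same measure, its measure is a product: the fibres of the coordinate
  projection are copies of the sections.  This and its mirror image are the two ways of counting pairs.
\<close>

lemma mu_Fubini_left:
  assumes \<Gamma>: "set \<Gamma> \<subseteq> sorts M" and \<Delta>: "set \<Delta> \<subseteq> sorts M"
    and P: "pdef M (\<Gamma> @ \<Delta>) P" and A: "pdef M \<Gamma> A"
    and PA: "\<And>v w. \<lbrakk>v \<in> tuples M \<Gamma>; w \<in> tuples M \<Delta>; P (v @ w)\<rbrakk> \<Longrightarrow> A v"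
    and c: "c \<in> carrier S"
    and fib: "\<And>v. \<lbrakk>v \<in> tuples M \<Gamma>; A v\<rbrakk> \<Longrightarrow> mu \<Delta> (\<lambda>w. P (v @ w)) = c"
  shows "mu (\<Gamma> @ \<Delta>) P = c \<otimes> mu \<Gamma> A"
proof (rule mu_fibres[OF _ \<Gamma> term_map_take P A _ c])
  show \<Gamma>\<Delta>: "set (\<Gamma> @ \<Delta>) \<subseteq> sorts M" using \<Gamma> \<Delta> by simp
  show "A (take (length \<Gamma>) u)" if "u \<in> tuples M (\<Gamma> @ \<Delta>)" "P u" for u
    using that PA by (auto simp: tuples_append length_tuples)
  fix v assume v: "v \<in> tuples M \<Gamma>" "A v"
  have "mu (\<Gamma> @ \<Delta>) (\<lambda>u. P u \<and> take (length \<Gamma>) u = v) = mu \<Delta> (\<lambda>w. P (v @ w))"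
  proof (rule mu_bij[OF \<Gamma>\<Delta> \<Delta> term_map_drop])
    show "pdef M (\<Gamma> @ \<Delta>) (\<lambda>u. P u \<and> take (length \<Gamma>) u = v)"
      by (rule pdef_and[OF P pdef_subst[OF pdef_eq_const[OF \<Gamma> v(1)] term_map_take]])
    show "pdef M \<Delta> (\<lambda>w. P (v @ w))" by (rule pdef_slice_right[OF \<Gamma> P v(1)])
    show "P (v @ drop (length \<Gamma>) u)" if "P u \<and> take (length \<Gamma>) u = v" for u
      using that by auto
    show "\<exists>x \<in> tuples M (\<Gamma> @ \<Delta>). \<forall>u \<in> tuples M (\<Gamma> @ \<Delta>).
        (P u \<and> take (length \<Gamma>) u = v) \<and> drop (length \<Gamma>) u = w \<longleftrightarrow> u = x"
      if "w \<in> tuples M \<Delta>" "P (v @ w)" for w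
      using that v by (intro bexI[of _ "v @ w"]) (auto simp: append_in_tuples length_tuples)
  qed
  then show "mu (\<Gamma> @ \<Delta>) (\<lambda>u. P u \<and> take (length \<Gamma>) u = v) = c" using fib v by simp
qed

lemma mu_Fubini_right:
  assumes \<Gamma>: "set \<Gamma> \<subseteq> sorts M" and \<Delta>: "set \<Delta> \<subseteq> sorts M"
    and P: "pdef M (\<Gamma> @ \<Delta>) P" and B: "pdef M \<Delta> B"
    and PB: "\<And>v w. \<lbrakk>v \<in> tuples M \<Gamma>; w \<in> tuples M \<Delta>; P (v @ w)\<rbrakk> \<Longrightarrow> B w"
    and c: "c \<in> carrier S"
    and fib: "\<And>w. \<lbrakk>w \<in> tuples M \<Delta>; B w\<rbrakk> \<Longrightarrow> mu \<Gamma> (\<lambda>v. P (v @ w)) = c"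
  shows "mu (\<Gamma> @ \<Delta>) P = c \<otimes> mu \<Delta> B"
proof (rule mu_fibres[OF _ \<Delta> term_map_drop P B _ c])
  show \<Gamma>\<Delta>: "set (\<Gamma> @ \<Delta>) \<subseteq> sorts M" using \<Gamma> \<Delta> by simp
  show "B (drop (length \<Gamma>) u)" if "u \<in> tuples M (\<Gamma> @ \<Delta>)" "P u" for u
    using that PB by (auto simp: tuples_append length_tuples)
  fix w assume w: "w \<in> tuples M \<Delta>" "B w"
  have "mu (\<Gamma> @ \<Delta>) (\<lambda>u. P u \<and> drop (length \<Gamma>) u = w) = mu \<Gamma> (\<lambda>v. P (v @ w))"
  proof (rule mu_bij[OF \<Gamma>\<Delta> \<Gamma> term_map_take])
    show "pdef M (\<Gamma> @ \<Delta>) (\<lambda>u. P u \<and> drop (length \<Gamma>) u = w)"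
      by (rule pdef_and[OF P pdef_subst[OF pdef_eq_const[OF \<Delta> w(1)] term_map_drop]])
    show "pdef M \<Gamma> (\<lambda>v. P (v @ w))" by (rule pdef_param[OF \<Delta> P w(1)])
    show "P (take (length \<Gamma>) u @ w)" if "P u \<and> drop (length \<Gamma>) u = w" for u
      using that by auto
    show "\<exists>x \<in> tuples M (\<Gamma> @ \<Delta>). \<forall>u \<in> tuples M (\<Gamma> @ \<Delta>).
        (P u \<and> drop (length \<Gamma>) u = w) \<and> take (length \<Gamma>) u = v \<longleftrightarrow> u = x"
      if "v \<in> tuples M \<Gamma>" "P (v @ w)" for v
      using that w by (intro bexI[of _ "v @ w"]) (auto simp: append_in_tuples length_tuples)
  qed
  then show "mu (\<Gamma> @ \<Delta>) (\<lambda>u. P u \<and> drop (length \<Gamma>) u = w) = c" using fib w by simp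
qed

lemma tame_mu:
  assumes \<Gamma>: "set \<Gamma> \<subseteq> sorts M" and \<Delta>: "set \<Delta> \<subseteq> sorts M" and "dfn M (\<Gamma> @ \<Delta>) P"
  shows "tame M \<Delta> (\<lambda>b. mu \<Gamma> (\<lambda>v. P (v @ b)))"
proof -
  obtain \<phi> where \<phi>: "formula M (\<Gamma> @ \<Delta>) \<phi>" "\<forall>v \<in> tuples M (\<Gamma> @ \<Delta>). sat M v \<phi> \<longleftrightarrow> P v"
    using assms(3) unfolding dfn_def by blast
  let ?k = "\<lambda>b. h (\<Gamma>, solutions M \<Gamma> \<phi> b)"
  have eq: "?k b = mu \<Gamma> (\<lambda>v. P (v @ b))" if b: "b \<in> tuples M \<Delta>" for b
  proof -
    have "solutions M \<Gamma> \<phi> b = {v \<in> tuples M \<Gamma>. P (v @ b)}"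
      unfolding solutions_def using \<phi>(2) b append_in_tuples by blast
    then show ?thesis by (simp add: mu_def)
  qed
  have "tame M \<Delta> ?k"
    unfolding tame_def
  proof (intro conjI allI)
    show "finite (?k ` tuples M \<Delta>)"
      using h_family_finite[OF \<Gamma> \<Delta> \<phi>(1)] by (simp add: setcompr_eq_image)
    fix e
    show "dfn M \<Delta> (\<lambda>b. ?k b = e)"
    proof (cases "e \<in> {?k b | b. b \<in> tuples M \<Delta>}")
      case True
      from h_family_definable[OF \<Gamma> \<Delta> \<phi>(1) this]
      have "dfn M \<Delta> (\<lambda>v. v \<in> {b \<in> tuples M \<Delta>. ?k b = e})" by (simp add: Def0_iff)
      then show ?thesis by (rule dfn_cong) simp
    next
      case False
      then show ?thesis by (intro dfn_cong[OF dfn_const[of _ _ False]]) auto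
    qed
  qed
  then show ?thesis by (rule tame_cong) (rule eq)
qed

end

section \<open>The measure on imaginary sorts\<close>

context measurable_structure
begin

text \<open>
  For finite classes this is the number of representatives of the element that \<open>v\<close> stands for.
\<close>

definition vol :: "('s, 'a) eq_sort list \<Rightarrow> 'a list \<Rightarrow> 'v" where
  "vol ts v = mu (flat ts) (\<lambda>u. proj ts u = proj ts v)"

definition vols :: "('s, 'a) eq_sort list \<Rightarrow> 'v set" where
  "vols ts = vol ts ` tuples M (flat ts)"

lemma vol_cong: "proj ts u = proj ts v \<Longrightarrow> vol ts u = vol ts v"
  by (simp add: vol_def)

context
  fixes ts :: "('s, 'a) eq_sort list"
  assumes ts: "set ts \<subseteq> sorts (Meq M)"
begin

lemma pdef_fibre: "v \<in> tuples M (flat ts) \<Longrightarrow> pdef M (flat ts) (\<lambda>u. proj ts u = proj ts v)"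
  using pdef_param[OF set_flat[OF ts] dfn_imp_pdef[OF dfn_proj_eq[OF ts]]]
  by (rule pdef_cong) (auto simp: length_tuples)

lemma tame_vol: "tame M (flat ts) (vol ts)"
  by (rule tame_cong[OF tame_mu[OF set_flat[OF ts] set_flat[OF ts] dfn_proj_eq[OF ts]]])
    (auto simp: vol_def length_tuples intro!: mu_cong)

lemma finite_vols: "finite (vols ts)"
  using tame_vol unfolding vols_def tame_def by blast

lemma vols_closed: "e \<in> vols ts \<Longrightarrow> e \<in> carrier S"
  unfolding vols_def vol_def using mu_closed[OF set_flat[OF ts] pdef_fibre] by blast

lemma vols_pos: "e \<in> vols ts \<Longrightarrow> \<zero> \<prec> e"
  unfolding vols_def vol_def using mu_pos[OF set_flat[OF ts] pdef_fibre] by blast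

lemma pdef_vol: "pdef M (flat ts) (\<lambda>v. vol ts v = e)"
  by (rule dfn_imp_pdef[OF tame_dfn[OF tame_vol]])

end

end

locale imaginary_measure = measurable_structure M S h + fraction_map S T quo
  for M :: "('s, 'f, 'r, 'a) struct" and S :: "('v, 'b) ord_ring_scheme" (structure)
    and h :: "'s list \<times> 'a list set \<Rightarrow> 'v" and T :: "('v, 'c) ord_ring_scheme"
    and quo :: "'v \<Rightarrow> 'v \<Rightarrow> 'v"
begin

text \<open>
  The part of the pullback where the fibres have measure \<open>e\<close> is counted with weight \<open>1/e\<close>.  The sum
  ranges over all measures of fibres for the given sorts, the same ones for every \<open>P\<close>, so that additivity
  holds summand by summand.
\<close>

definition weigh :: "('s, 'a) eq_sort list \<Rightarrow> ('a list \<Rightarrow> bool) \<Rightarrow> 'v" where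
  "weigh ts P = finsum T (\<lambda>e. quo (mu (flat ts) (\<lambda>v. P v \<and> vol ts v = e)) e) (vols ts)"

lemma weigh_cong: "(\<And>v. v \<in> tuples M (flat ts) \<Longrightarrow> P v \<longleftrightarrow> Q v) \<Longrightarrow> weigh ts P = weigh ts Q"
proof -
  assume *: "\<And>v. v \<in> tuples M (flat ts) \<Longrightarrow> P v \<longleftrightarrow> Q v"
  have "mu (flat ts) (\<lambda>v. P v \<and> vol ts v = e) = mu (flat ts) (\<lambda>v. Q v \<and> vol ts v = e)" for e
    by (rule mu_cong) (use * in blast)
  then show ?thesis by (simp add: weigh_def)
qed

context
  fixes ts :: "('s, 'a) eq_sort list"
  assumes ts: "set ts \<subseteq> sorts (Meq M)"
begin

lemma pdef_part: "pdef M (flat ts) P \<Longrightarrow> pdef M (flat ts) (\<lambda>v. P v \<and> vol ts v = e)"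
  by (rule pdef_and[OF _ pdef_vol[OF ts]])

lemma weigh_summand_closed:
  "\<lbrakk>pdef M (flat ts) P; e \<in> vols ts\<rbrakk> \<Longrightarrow> quo (mu (flat ts) (\<lambda>v. P v \<and> vol ts v = e)) e \<in> carrier T"
  by (rule quo_closed[OF mu_closed[OF set_flat[OF ts] pdef_part] vols_closed[OF ts] vols_pos[OF ts]])

lemma weigh_closed: "pdef M (flat ts) P \<Longrightarrow> weigh ts P \<in> carrier T"
  unfolding weigh_def by (rule T.finsum_closed) (use weigh_summand_closed in blast)

lemma weigh_or:
  assumes P: "pdef M (flat ts) P" and Q: "pdef M (flat ts) Q"
    and disj: "\<And>v. v \<in> tuples M (flat ts) \<Longrightarrow> P v \<Longrightarrow> Q v \<Longrightarrow> False"
  shows "weigh ts (\<lambda>v. P v \<or> Q v) = weigh ts P \<oplus>\<^bsub>T\<^esub> weigh ts Q"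
proof -
  have "weigh ts P \<oplus>\<^bsub>T\<^esub> weigh ts Q = finsum T (\<lambda>e. quo (mu (flat ts) (\<lambda>v. P v \<and> vol ts v = e)) e
      \<oplus>\<^bsub>T\<^esub> quo (mu (flat ts) (\<lambda>v. Q v \<and> vol ts v = e)) e) (vols ts)"
    unfolding weigh_def by (rule T.finsum_addf[symmetric]) (use weigh_summand_closed P Q in blast)+
  also have "\<dots> = weigh ts (\<lambda>v. P v \<or> Q v)"
    unfolding weigh_def
  proof (rule T.finsum_cong')
    show "(\<lambda>e. quo (mu (flat ts) (\<lambda>v. (P v \<or> Q v) \<and> vol ts v = e)) e) \<in> vols ts \<rightarrow> carrier T"
      using weigh_summand_closed[OF pdef_or[OF P Q]] by blast
    fix e assume e: "e \<in> vols ts"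
    have "mu (flat ts) (\<lambda>v. (P v \<or> Q v) \<and> vol ts v = e)
        = mu (flat ts) (\<lambda>v. (P v \<and> vol ts v = e) \<or> (Q v \<and> vol ts v = e))"
      by (rule mu_cong) blast
    also have "\<dots> = mu (flat ts) (\<lambda>v. P v \<and> vol ts v = e) \<oplus> mu (flat ts) (\<lambda>v. Q v \<and> vol ts v = e)"
      by (rule mu_or[OF set_flat[OF ts] pdef_part[OF P] pdef_part[OF Q]]) (use disj in blast)
    finally show "quo (mu (flat ts) (\<lambda>v. P v \<and> vol ts v = e)) e \<oplus>\<^bsub>T\<^esub> quo (mu (flat ts) (\<lambda>v. Q v \<and> vol ts v = e)) e
        = quo (mu (flat ts) (\<lambda>v. (P v \<or> Q v) \<and> vol ts v = e)) e"
      using quo_add mu_closed[OF set_flat[OF ts] pdef_part] P Q vols_closed[OF ts e] vols_pos[OF ts e] by simp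
  qed simp
  finally show ?thesis by simp
qed

lemma weigh_constant_vol:
  assumes P: "pdef M (flat ts) P" and g: "g \<in> vols ts"
    and vol: "\<And>v. v \<in> tuples M (flat ts) \<Longrightarrow> P v \<Longrightarrow> vol ts v = g"
  shows "weigh ts P = quo (mu (flat ts) P) g"
proof -
  have c: "quo (mu (flat ts) P) g \<in> carrier T"
    by (rule quo_closed[OF mu_closed[OF set_flat[OF ts] P] vols_closed[OF ts g] vols_pos[OF ts g]])
  have "weigh ts P = finsum T (\<lambda>e. if g = e then quo (mu (flat ts) P) g else \<zero>\<^bsub>T\<^esub>) (vols ts)"
    unfolding weigh_def
  proof (rule T.finsum_cong')
    show "(\<lambda>e. if g = e then quo (mu (flat ts) P) g else \<zero>\<^bsub>T\<^esub>) \<in> vols ts \<rightarrow> carrier T" using c by auto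
    fix e assume e: "e \<in> vols ts"
    show "quo (mu (flat ts) (\<lambda>v. P v \<and> vol ts v = e)) e = (if g = e then quo (mu (flat ts) P) g else \<zero>\<^bsub>T\<^esub>)"
    proof (cases "g = e")
      case True
      have "mu (flat ts) (\<lambda>v. P v \<and> vol ts v = e) = mu (flat ts) P"
        by (rule mu_cong) (use vol True in blast)
      then show ?thesis using True by simp
    next
      case False
      have "mu (flat ts) (\<lambda>v. P v \<and> vol ts v = e) = \<zero>"
        by (rule mu_empty[OF set_flat[OF ts]]) (use vol False in blast)
      then show ?thesis using False quo_zero vols_closed[OF ts e] vols_pos[OF ts e] by simp
    qed
  qed simp
  also have "\<dots> = quo (mu (flat ts) P) g"
    using T.finsum_singleton[OF g finite_vols[OF ts], of "\<lambda>_. quo (mu (flat ts) P) g"] c by simp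
  finally show ?thesis .
qed

lemma weigh_empty:
  assumes "\<And>v. v \<in> tuples M (flat ts) \<Longrightarrow> \<not> P v"
  shows "weigh ts P = \<zero>\<^bsub>T\<^esub>"
proof -
  have "weigh ts P = finsum T (\<lambda>e. \<zero>\<^bsub>T\<^esub>) (vols ts)"
    unfolding weigh_def
  proof (rule T.finsum_cong')
    fix e assume e: "e \<in> vols ts"
    have "mu (flat ts) (\<lambda>v. P v \<and> vol ts v = e) = \<zero>"
      by (rule mu_empty[OF set_flat[OF ts]]) (use assms in blast)
    then show "quo (mu (flat ts) (\<lambda>v. P v \<and> vol ts v = e)) e = \<zero>\<^bsub>T\<^esub>"
      using quo_zero vols_closed[OF ts e] vols_pos[OF ts e] by simp
  qed auto
  then show ?thesis by simp
qed

lemma weigh_fibre: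
  assumes v: "v \<in> tuples M (flat ts)"
  shows "weigh ts (\<lambda>u. proj ts u = proj ts v) = \<one>\<^bsub>T\<^esub>"
proof -
  have e: "vol ts v \<in> vols ts" using v by (simp add: vols_def)
  have "weigh ts (\<lambda>u. proj ts u = proj ts v) = quo (vol ts v) (vol ts v)"
    using weigh_constant_vol[OF pdef_fibre[OF ts v] e vol_cong] by (simp add: vol_def)
  then show ?thesis using quo_self vols_closed[OF ts e] vols_pos[OF ts e] by simp
qed

text \<open>
  A single element has measure \<open>e/e = 1\<close>, where \<open>e\<close> is the measure of its set of representatives.
\<close>

lemma weigh_finite:
  assumes "finite Z" "Z \<subseteq> tuples (Meq M) ts"
  shows "pdef M (flat ts) (\<lambda>v. proj ts v \<in> Z) \<and>
    weigh ts (\<lambda>v. proj ts v \<in> Z) = [card Z] \<cdot>\<^bsub>T\<^esub> \<one>\<^bsub>T\<^esub>"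
  using assms
proof (induction rule: finite_induct)
  case empty
  then show ?case using weigh_empty by (simp add: pdef_const)
next
  case (insert z Z)
  then obtain v where v: "v \<in> tuples M (flat ts)" "z = proj ts v" by (auto simp: tuples_Meq)
  have Z: "pdef M (flat ts) (\<lambda>v. proj ts v \<in> Z)" "weigh ts (\<lambda>v. proj ts v \<in> Z) = [card Z] \<cdot>\<^bsub>T\<^esub> \<one>\<^bsub>T\<^esub>"
    using insert by auto
  have "weigh ts (\<lambda>u. proj ts u = z \<or> proj ts u \<in> Z)
      = weigh ts (\<lambda>u. proj ts u = z) \<oplus>\<^bsub>T\<^esub> weigh ts (\<lambda>u. proj ts u \<in> Z)"
    using weigh_or[OF pdef_fibre[OF ts v(1)] Z(1)] insert(2) v(2) by simp
  then show ?case
    using pdef_or[OF pdef_fibre[OF ts v(1)] Z(1)] weigh_fibre[OF v(1)] Z(2) insert(1,2) v(2)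
    by (simp add: T.a_comm)
qed

text \<open>
  The weight is computed from finitely many measures in definable families of \<open>M\<close>.
\<close>

lemma tame_weigh:
  assumes \<Delta>: "set \<Delta> \<subseteq> sorts M" and P: "dfn M (flat ts @ \<Delta>) P"
  shows "tame M \<Delta> (\<lambda>b. weigh ts (\<lambda>v. P (v @ b)))"
proof -
  note \<Gamma> = set_flat[OF ts]
  let ?s = "\<lambda>b e. quo (mu (flat ts) (\<lambda>v. P (v @ b) \<and> vol ts v = e)) e"
  have closed: "?s b e \<in> carrier T" if "b \<in> tuples M \<Delta>" "e \<in> vols ts" for b e
    by (rule weigh_summand_closed[OF pdef_param[OF \<Delta> dfn_imp_pdef[OF P] that(1)] that(2)])
  have summand: "tame M \<Delta> (\<lambda>b. ?s b e)" for e
  proof -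
    have "dfn M (flat ts @ \<Delta>) (\<lambda>u. P u \<and> vol ts (take (length (flat ts)) u) = e)"
      by (rule dfn_and[OF P dfn_subst[OF tame_dfn[OF tame_vol[OF ts]] term_map_take]])
    from tame_comp[OF tame_mu[OF \<Gamma> \<Delta> this], of "\<lambda>x. quo x e"] show ?thesis
    proof (rule tame_cong)
      fix b
      have "mu (flat ts) (\<lambda>v. P (v @ b) \<and> vol ts (take (length (flat ts)) (v @ b)) = e)
          = mu (flat ts) (\<lambda>v. P (v @ b) \<and> vol ts v = e)"
        by (rule mu_cong) (simp add: length_tuples)
      then show "quo (mu (flat ts) (\<lambda>v. P (v @ b) \<and> vol ts (take (length (flat ts)) (v @ b)) = e)) e = ?s b e"
        by simp
    qed
  qed
  have "tame M \<Delta> (\<lambda>b. finsum T (?s b) A)" if "finite A" "A \<subseteq> vols ts" for A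
    using that
  proof (induction rule: finite_induct)
    case empty
    then show ?case by (simp add: tame_const)
  next
    case (insert e A)
    have "tame M \<Delta> (\<lambda>b. finsum T (?s b) A)" using insert by blast
    from tame_comp[OF tame_pair[OF summand[of e] this], of "\<lambda>p. fst p \<oplus>\<^bsub>T\<^esub> snd p"] show ?case
      by (rule tame_cong) (use insert closed in \<open>auto simp: Pi_def subset_eq\<close>)
  qed
  then show ?thesis using finite_vols[OF ts] by (simp add: weigh_def)
qed

end

text \<open>
  Here \<open>R\<close> relates representatives of arguments to representatives of values of a function, so its set of
  values at a given \<open>v\<close> is a full fibre of \<open>proj\<close> (\<open>R_fibre\<close>).  The uniformity assumption says that neither
  the measure of that fibre nor the measures that make up the weight of the preimage depend on the
  value, as needed for counting pairs in both ways.
\<close>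

lemma weigh_fibres_uniform:
  assumes xs: "set xs \<subseteq> sorts (Meq M)" and ys: "set ys \<subseteq> sorts (Meq M)"
    and PX: "pdef M (flat xs) PX" and PY: "pdef M (flat ys) PY" and R: "pdef M (flat xs @ flat ys) R"
    and R_dom: "\<And>v w. \<lbrakk>v \<in> tuples M (flat xs); w \<in> tuples M (flat ys); R (v @ w)\<rbrakk> \<Longrightarrow> PX v \<and> PY w"
    and R_total: "\<And>v. \<lbrakk>v \<in> tuples M (flat xs); PX v\<rbrakk> \<Longrightarrow> \<exists>w \<in> tuples M (flat ys). R (v @ w)"
    and R_fibre: "\<And>v w w'. \<lbrakk>v \<in> tuples M (flat xs); w \<in> tuples M (flat ys); w' \<in> tuples M (flat ys); R (v @ w)\<rbrakk>
      \<Longrightarrow> R (v @ w') \<longleftrightarrow> proj ys w' = proj ys w"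
    and f: "f \<in> carrier T" "\<And>w. \<lbrakk>w \<in> tuples M (flat ys); PY w\<rbrakk> \<Longrightarrow> weigh xs (\<lambda>v. R (v @ w)) = f"
    and uniform: "\<And>w w'. \<lbrakk>w \<in> tuples M (flat ys); w' \<in> tuples M (flat ys); PY w; PY w'\<rbrakk> \<Longrightarrow> vol ys w = vol ys w' \<and>
      (\<forall>e \<in> vols xs. mu (flat xs) (\<lambda>v. R (v @ w) \<and> vol xs v = e) = mu (flat xs) (\<lambda>v. R (v @ w') \<and> vol xs v = e))"
  shows "weigh xs PX = f \<otimes>\<^bsub>T\<^esub> weigh ys PY"
proof (cases "\<exists>w \<in> tuples M (flat ys). PY w")
  case False
  then have "weigh ys PY = \<zero>\<^bsub>T\<^esub>" "weigh xs PX = \<zero>\<^bsub>T\<^esub>"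
    using weigh_empty[OF ys, of PY] weigh_empty[OF xs, of PX] R_total R_dom by blast+
  then show ?thesis using f(1) by simp
next
  case True
  then obtain w\<^sub>0 where w\<^sub>0: "w\<^sub>0 \<in> tuples M (flat ys)" "PY w\<^sub>0" by blast
  let ?\<Gamma> = "flat xs" and ?\<Delta> = "flat ys"
  note \<Gamma> = set_flat[OF xs] and \<Delta> = set_flat[OF ys]
  define g where "g = vol ys w\<^sub>0"
  define \<kappa> where "\<kappa> e = mu ?\<Gamma> (\<lambda>v. R (v @ w\<^sub>0) \<and> vol xs v = e)" for e
  have g: "g \<in> vols ys" using w\<^sub>0 by (simp add: g_def vols_def)
  note gc = vols_closed[OF ys g] vols_pos[OF ys g]
  have R\<^sub>0: "pdef M ?\<Gamma> (\<lambda>v. R (v @ w\<^sub>0))" by (rule pdef_param[OF \<Delta> R w\<^sub>0(1)])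
  have \<kappa>c: "\<kappa> e \<in> carrier S" for e
    unfolding \<kappa>_def by (rule mu_closed[OF \<Gamma> pdef_part[OF xs R\<^sub>0]])
  have Yc: "mu ?\<Delta> PY \<in> carrier S" by (rule mu_closed[OF \<Delta> PY])
  have q: "quo (mu ?\<Delta> PY) g = weigh ys PY"
    by (rule weigh_constant_vol[OF ys PY g, symmetric]) (unfold g_def, rule uniform[OF _ w\<^sub>0(1) _ w\<^sub>0(2), THEN conjunct1])
  have summand: "quo (mu ?\<Gamma> (\<lambda>v. PX v \<and> vol xs v = e)) e = quo (\<kappa> e) e \<otimes>\<^bsub>T\<^esub> quo (mu ?\<Delta> PY) g"
    if e: "e \<in> vols xs" for e
  proof -
    note ec = vols_closed[OF xs e] vols_pos[OF xs e]
    let ?P = "\<lambda>u. R u \<and> vol xs (take (length ?\<Gamma>) u) = e" and ?A = "\<lambda>v. PX v \<and> vol xs v = e"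
    have P: "pdef M (?\<Gamma> @ ?\<Delta>) ?P"
      by (rule pdef_and[OF R pdef_subst[OF pdef_vol[OF xs] term_map_take]])
    have A: "pdef M ?\<Gamma> ?A" by (rule pdef_part[OF xs PX])
    have Ac: "mu ?\<Gamma> ?A \<in> carrier S" by (rule mu_closed[OF \<Gamma> A])
    \<comment> \<open>The pairs are counted along \<open>X\<close>, where the section at \<open>v\<close> is the fibre of \<open>proj\<close> over the value at \<open>v\<close>.\<close>
    have "mu (?\<Gamma> @ ?\<Delta>) ?P = g \<otimes> mu ?\<Gamma> ?A"
    proof (rule mu_Fubini_left[OF \<Gamma> \<Delta> P A _ gc(1)])
      fix v assume v: "v \<in> tuples M ?\<Gamma>" "?A v"
      then obtain w where w: "w \<in> tuples M ?\<Delta>" "R (v @ w)" using R_total by blast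
      have "mu ?\<Delta> (\<lambda>w'. ?P (v @ w')) = mu ?\<Delta> (\<lambda>w'. proj ys w' = proj ys w)"
        by (rule mu_cong) (simp add: R_fibre[OF v(1) w(1) _ w(2)] v(2) length_tuples[OF v(1)])
      then have "mu ?\<Delta> (\<lambda>w'. ?P (v @ w')) = vol ys w" by (simp only: vol_def[of ys w])
      then show "mu ?\<Delta> (\<lambda>w'. ?P (v @ w')) = g"
        using uniform[OF w(1) w\<^sub>0(1) _ w\<^sub>0(2)] R_dom[OF v(1) w] unfolding g_def by simp
    qed (use R_dom in \<open>auto simp: length_tuples\<close>)
    \<comment> \<open>The same pairs are counted along \<open>Y\<close>.\<close>
    moreover have "mu (?\<Gamma> @ ?\<Delta>) ?P = \<kappa> e \<otimes> mu ?\<Delta> PY"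
    proof (rule mu_Fubini_right[OF \<Gamma> \<Delta> P PY _ \<kappa>c])
      fix w assume w: "w \<in> tuples M ?\<Delta>" "PY w"
      have "mu ?\<Gamma> (\<lambda>v. ?P (v @ w)) = mu ?\<Gamma> (\<lambda>v. R (v @ w) \<and> vol xs v = e)"
        by (rule mu_cong) (simp add: length_tuples)
      then show "mu ?\<Gamma> (\<lambda>v. ?P (v @ w)) = \<kappa> e"
        using uniform[OF w(1) w\<^sub>0(1) w(2) w\<^sub>0(2)] e unfolding \<kappa>_def by simp
    qed (use R_dom in blast)
    ultimately have eq: "mu ?\<Gamma> ?A \<otimes> g = \<kappa> e \<otimes> mu ?\<Delta> PY" using m_comm Ac gc(1) by simp
    have "quo (mu ?\<Gamma> ?A) e = quo (mu ?\<Gamma> ?A \<otimes> g) (e \<otimes> g)"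
      using quo_cancel[OF Ac ec(1) gc(1) ec(2) gc(2)] by simp
    also have "\<dots> = quo (\<kappa> e) e \<otimes>\<^bsub>T\<^esub> quo (mu ?\<Delta> PY) g"
      unfolding eq by (rule quo_mult[OF \<kappa>c ec(1) Yc gc(1) ec(2) gc(2), symmetric])
    finally show ?thesis .
  qed
  have sc: "(\<lambda>e. quo (\<kappa> e) e) \<in> vols xs \<rightarrow> carrier T"
    using quo_closed[OF \<kappa>c] vols_closed[OF xs] vols_pos[OF xs] by blast
  have qc: "quo (mu ?\<Delta> PY) g \<in> carrier T" by (rule quo_closed[OF Yc gc])
  have "weigh xs PX = finsum T (\<lambda>e. quo (\<kappa> e) e \<otimes>\<^bsub>T\<^esub> quo (mu ?\<Delta> PY) g) (vols xs)"
    unfolding weigh_def by (rule T.finsum_cong') (use summand sc qc in auto)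
  also have "\<dots> = finsum T (\<lambda>e. quo (\<kappa> e) e) (vols xs) \<otimes>\<^bsub>T\<^esub> quo (mu ?\<Delta> PY) g"
    by (rule T.finsum_ldistr[OF finite_vols[OF xs] qc sc, symmetric])
  also have "finsum T (\<lambda>e. quo (\<kappa> e) e) (vols xs) = f"
    using f(2)[OF w\<^sub>0] by (simp add: weigh_def \<kappa>_def)
  finally show ?thesis using q by simp
qed

text \<open>
  Only finitely many vectors \<open>\<tau>\<close> of the measures in question occur, and they occur on definable sets that
  are unions of fibres of \<open>proj\<close>.  So \<open>Y\<close> and its preimage are cut into finitely many pieces to which the
  uniform case applies, and additivity puts the pieces together.
\<close>

lemma weigh_fibres:
  assumes xs: "set xs \<subseteq> sorts (Meq M)" and ys: "set ys \<subseteq> sorts (Meq M)"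
    and PX: "pdef M (flat xs) PX" and PY: "pdef M (flat ys) PY" and R: "pdef M (flat xs @ flat ys) R"
    and R_dom: "\<And>v w. \<lbrakk>v \<in> tuples M (flat xs); w \<in> tuples M (flat ys); R (v @ w)\<rbrakk> \<Longrightarrow> PX v \<and> PY w"
    and R_total: "\<And>v. \<lbrakk>v \<in> tuples M (flat xs); PX v\<rbrakk> \<Longrightarrow> \<exists>w \<in> tuples M (flat ys). R (v @ w)"
    and R_fibre: "\<And>v w w'. \<lbrakk>v \<in> tuples M (flat xs); w \<in> tuples M (flat ys); w' \<in> tuples M (flat ys); R (v @ w)\<rbrakk>
      \<Longrightarrow> R (v @ w') \<longleftrightarrow> proj ys w' = proj ys w"
    and f: "f \<in> carrier T" "\<And>w. \<lbrakk>w \<in> tuples M (flat ys); PY w\<rbrakk> \<Longrightarrow> weigh xs (\<lambda>v. R (v @ w)) = f"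
  shows "weigh xs PX = f \<otimes>\<^bsub>T\<^esub> weigh ys PY"
proof -
  let ?\<Gamma> = "flat xs" and ?\<Delta> = "flat ys"
  note \<Gamma> = set_flat[OF xs] and \<Delta> = set_flat[OF ys]
  obtain zs b Q where zs: "set zs \<subseteq> sorts M" "b \<in> tuples M zs" and Q: "dfn M ((?\<Gamma> @ ?\<Delta>) @ zs) Q"
    and RQ: "\<And>u. u \<in> tuples M (?\<Gamma> @ ?\<Delta>) \<Longrightarrow> R u \<longleftrightarrow> Q (u @ b)"
    by (rule pdefE[OF R]) (rule that)
  define \<kappa> where "\<kappa> w e = mu ?\<Gamma> (\<lambda>v. R (v @ w) \<and> vol xs v = e)" for w e
  define \<tau> where "\<tau> w = (vol ys w, restrict (\<kappa> w) (vols xs))" for w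
  have \<tau>: "finite (\<tau> ` tuples M ?\<Delta>)" "\<And>t. pdef M ?\<Delta> (\<lambda>w. \<tau> w = t)"
  proof -
    \<comment> \<open>Definability in families concerns formulas without parameters, so the parameters \<open>b\<close> of \<open>R\<close>
      are treated as variables and substituted back afterwards.\<close>
    define K where "K u e = mu ?\<Gamma> (\<lambda>v. Q (v @ u) \<and> vol xs (take (length ?\<Gamma>) (v @ u)) = e)" for u e
    define \<sigma> where "\<sigma> u = (vol ys (take (length ?\<Delta>) u), restrict (K u) (vols xs))" for u
    have K: "tame M (?\<Delta> @ zs) (\<lambda>u. K u e)" for e
      unfolding K_def
    proof (rule tame_mu[OF \<Gamma>, where P = "\<lambda>v. Q v \<and> vol xs (take (length ?\<Gamma>) v) = e"])
      show "set (?\<Delta> @ zs) \<subseteq> sorts M" using \<Delta> zs by simp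
      show "dfn M (?\<Gamma> @ ?\<Delta> @ zs) (\<lambda>v. Q v \<and> vol xs (take (length ?\<Gamma>) v) = e)"
        using Q dfn_subst[OF tame_dfn[OF tame_vol[OF xs]] term_map_take] by (intro dfn_and) simp_all
    qed
    have V: "tame M (?\<Delta> @ zs) (\<lambda>u. vol ys (take (length ?\<Delta>) u))"
      unfolding tame_def
    proof (intro conjI allI)
      show "finite ((\<lambda>u. vol ys (take (length ?\<Delta>) u)) ` tuples M (?\<Delta> @ zs))"
        by (rule finite_subset[OF _ finite_vols[OF ys]]) (auto simp: vols_def tuples_append length_tuples)
      show "dfn M (?\<Delta> @ zs) (\<lambda>u. vol ys (take (length ?\<Delta>) u) = e)" for e
        by (rule dfn_subst[OF tame_dfn[OF tame_vol[OF ys]] term_map_take])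
    qed
    have tame: "tame M (?\<Delta> @ zs) \<sigma>"
      unfolding \<sigma>_def by (rule tame_pair[OF V tame_restrict[OF finite_vols[OF xs] K]])
    have eq: "\<tau> w = \<sigma> (w @ b)" if w: "w \<in> tuples M ?\<Delta>" for w
    proof -
      have "\<kappa> w = K (w @ b)"
        unfolding \<kappa>_def K_def
        by (intro ext mu_cong) (use RQ w in \<open>simp add: append_in_tuples length_tuples\<close>)
      then show ?thesis using w by (simp add: \<tau>_def \<sigma>_def length_tuples)
    qed
    have "\<tau> ` tuples M ?\<Delta> \<subseteq> \<sigma> ` tuples M (?\<Delta> @ zs)"
      using eq zs append_in_tuples by blast
    then show "finite (\<tau> ` tuples M ?\<Delta>)" using tame finite_subset unfolding tame_def by blast
    show "pdef M ?\<Delta> (\<lambda>w. \<tau> w = t)" for t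
      by (rule pdef_cong[OF pdef_param[OF zs(1) dfn_imp_pdef[OF tame_dfn[OF tame]] zs(2)]]) (use eq in simp)
  qed
  have \<tau>_inv: "\<tau> w = \<tau> w'" if w: "w \<in> tuples M ?\<Delta>" "w' \<in> tuples M ?\<Delta>" "proj ys w = proj ys w'" for w w'
  proof -
    have "R (v @ w) \<longleftrightarrow> R (v @ w')" if "v \<in> tuples M ?\<Gamma>" for v
      using R_fibre[OF that w(1,2)] R_fibre[OF that w(2,1)] w(3) by auto
    then have "\<kappa> w = \<kappa> w'" unfolding \<kappa>_def by (intro ext mu_cong) blast
    then show ?thesis using vol_cong[OF w(3)] by (simp add: \<tau>_def)
  qed
  define X where "X \<Theta> v \<longleftrightarrow> (\<exists>w \<in> tuples M ?\<Delta>. R (v @ w) \<and> \<tau> w \<in> \<Theta>)" for \<Theta> v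
  define Y where "Y \<Theta> w \<longleftrightarrow> PY w \<and> \<tau> w \<in> \<Theta>" for \<Theta> w
  have piece: "pdef M ?\<Gamma> (X {t}) \<and> pdef M ?\<Delta> (Y {t}) \<and> weigh xs (X {t}) = f \<otimes>\<^bsub>T\<^esub> weigh ys (Y {t})" for t
  proof (intro conjI)
    let ?R = "\<lambda>u. R u \<and> \<tau> (drop (length ?\<Gamma>) u) = t"
    have R': "pdef M (?\<Gamma> @ ?\<Delta>) ?R"
      by (rule pdef_and[OF R pdef_subst[OF \<tau>(2) term_map_drop]])
    show X: "pdef M ?\<Gamma> (X {t})"
      by (rule pdef_cong[OF pdef_ex_right[OF \<Delta> R']]) (auto simp: X_def length_tuples)
    show Y: "pdef M ?\<Delta> (Y {t})"
      by (rule pdef_cong[OF pdef_and[OF PY \<tau>(2)[of t]]]) (simp add: Y_def)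
    show "weigh xs (X {t}) = f \<otimes>\<^bsub>T\<^esub> weigh ys (Y {t})"
    proof (rule weigh_fibres_uniform[OF xs ys X Y R' _ _ _ f(1)])
      show "X {t} v \<and> Y {t} w" if "v \<in> tuples M ?\<Gamma>" "w \<in> tuples M ?\<Delta>" "?R (v @ w)" for v w
        using that R_dom by (auto simp: X_def Y_def length_tuples)
      show "\<exists>w \<in> tuples M ?\<Delta>. ?R (v @ w)" if "v \<in> tuples M ?\<Gamma>" "X {t} v" for v
        using that by (auto simp: X_def length_tuples)
      show "?R (v @ w') \<longleftrightarrow> proj ys w' = proj ys w"
        if "v \<in> tuples M ?\<Gamma>" "w \<in> tuples M ?\<Delta>" "w' \<in> tuples M ?\<Delta>" "?R (v @ w)" for v w w'
        using that R_fibre[OF that(1-3)] \<tau>_inv[OF that(2,3)] by (auto simp: length_tuples)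
      have slice: "R (v @ w) \<longleftrightarrow> ?R (v @ w)" if "v \<in> tuples M ?\<Gamma>" "Y {t} w" for v w
        using that by (auto simp: Y_def length_tuples)
      show "weigh xs (\<lambda>v. ?R (v @ w)) = f" if "w \<in> tuples M ?\<Delta>" "Y {t} w" for w
      proof -
        have "weigh xs (\<lambda>v. ?R (v @ w)) = weigh xs (\<lambda>v. R (v @ w))"
          by (rule weigh_cong) (use slice that(2) in blast)
        then show ?thesis using f(2)[OF that(1)] that(2) by (simp add: Y_def)
      qed
      have \<kappa>: "mu ?\<Gamma> (\<lambda>v. ?R (v @ w) \<and> vol xs v = e) = \<kappa> w e" if "Y {t} w" for w e
        unfolding \<kappa>_def by (rule mu_cong) (use slice that in blast)
      show "vol ys w = vol ys w' \<and> (\<forall>e \<in> vols xs. mu ?\<Gamma> (\<lambda>v. ?R (v @ w) \<and> vol xs v = e) =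
          mu ?\<Gamma> (\<lambda>v. ?R (v @ w') \<and> vol xs v = e))"
        if "w \<in> tuples M ?\<Delta>" "w' \<in> tuples M ?\<Delta>" "Y {t} w" "Y {t} w'" for w w'
      proof -
        have "\<tau> w = \<tau> w'" using that(3,4) by (simp add: Y_def)
        then have V: "vol ys w = vol ys w'" and r: "restrict (\<kappa> w) (vols xs) = restrict (\<kappa> w') (vols xs)"
          by (simp_all add: \<tau>_def)
        have "\<kappa> w e = \<kappa> w' e" if "e \<in> vols xs" for e
          using fun_cong[OF r, of e] that by simp
        then show ?thesis by (simp only: \<kappa>[OF that(3)] \<kappa>[OF that(4)] V simp_thms ball_simps) blast
      qed
    qed
  qed
  have pieces: "pdef M ?\<Gamma> (X \<Theta>) \<and> pdef M ?\<Delta> (Y \<Theta>) \<and> weigh xs (X \<Theta>) = f \<otimes>\<^bsub>T\<^esub> weigh ys (Y \<Theta>)"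
    if "finite \<Theta>" for \<Theta>
    using that
  proof (induction rule: finite_induct)
    case empty
    have "weigh xs (X {}) = \<zero>\<^bsub>T\<^esub>" "weigh ys (Y {}) = \<zero>\<^bsub>T\<^esub>"
      by (rule weigh_empty[OF xs], simp add: X_def, rule weigh_empty[OF ys], simp add: Y_def)
    moreover have "X {} = (\<lambda>_. False)" "Y {} = (\<lambda>_. False)" by (simp_all add: X_def Y_def fun_eq_iff)
    ultimately show ?case using f(1) by (simp add: pdef_const)
  next
    case (insert t \<Theta>)
    have X: "X (insert t \<Theta>) = (\<lambda>v. X {t} v \<or> X \<Theta> v)" and Y: "Y (insert t \<Theta>) = (\<lambda>w. Y {t} w \<or> Y \<Theta> w)"
      by (auto simp: X_def Y_def fun_eq_iff)
    have dX: False if v: "v \<in> tuples M ?\<Gamma>" "X {t} v" "X \<Theta> v" for v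
    proof -
      obtain w w' where w: "w \<in> tuples M ?\<Delta>" "R (v @ w)" "\<tau> w = t" "w' \<in> tuples M ?\<Delta>" "R (v @ w')" "\<tau> w' \<in> \<Theta>"
        using v(2,3) by (auto simp: X_def)
      then have "\<tau> w' = \<tau> w" using R_fibre[OF v(1) w(1,4,2)] \<tau>_inv[OF w(4,1)] by blast
      then show False using w insert(2) by simp
    qed
    have "weigh xs (X (insert t \<Theta>)) = weigh xs (X {t}) \<oplus>\<^bsub>T\<^esub> weigh xs (X \<Theta>)"
      unfolding X by (rule weigh_or[OF xs]) (use piece insert.IH dX in blast)+
    moreover have "weigh ys (Y (insert t \<Theta>)) = weigh ys (Y {t}) \<oplus>\<^bsub>T\<^esub> weigh ys (Y \<Theta>)"
      unfolding Y
    proof (rule weigh_or[OF ys])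
      show "pdef M ?\<Delta> (Y {t})" "pdef M ?\<Delta> (Y \<Theta>)" using piece insert.IH by blast+
      show "Y {t} w \<Longrightarrow> Y \<Theta> w \<Longrightarrow> False" for w using insert(2) by (simp add: Y_def)
    qed
    moreover have "weigh ys (Y {t}) \<in> carrier T" "weigh ys (Y \<Theta>) \<in> carrier T"
      using weigh_closed[OF ys] piece insert.IH by blast+
    ultimately have "weigh xs (X (insert t \<Theta>)) = f \<otimes>\<^bsub>T\<^esub> weigh ys (Y (insert t \<Theta>))"
      using piece[of t] insert.IH f(1) by (simp add: T.r_distr)
    then show ?case using piece[of t] insert.IH unfolding X Y by (simp add: pdef_or)
  qed
  let ?\<Theta> = "\<tau> ` tuples M ?\<Delta>"
  have "weigh xs PX = weigh xs (X ?\<Theta>)"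
    by (rule weigh_cong) (use R_total R_dom in \<open>auto simp: X_def\<close>)
  moreover have "weigh ys PY = weigh ys (Y ?\<Theta>)"
    by (rule weigh_cong) (auto simp: Y_def)
  ultimately show ?thesis using pieces[OF \<tau>(1)] by simp
qed

definition heq :: "('s, 'a) eq_sort list \<times> 'a eq_elem list set \<Rightarrow> 'v" where
  "heq = (\<lambda>(ts, Z). weigh ts (\<lambda>v. proj ts v \<in> Z))"

lemma heq_simp: "heq (ts, Z) = weigh ts (\<lambda>v. proj ts v \<in> Z)"
  by (simp add: heq_def)

lemma Def_MeqD:
  assumes "(ts, Z) \<in> Def (Meq M)"
  shows "set ts \<subseteq> sorts (Meq M)" "Z \<subseteq> tuples (Meq M) ts" "pdef M (flat ts) (\<lambda>v. proj ts v \<in> Z)"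
  using assms pdef_Meq_imp_pdef by (auto simp: Def_iff)

lemma heq_family:
  assumes xs: "set xs \<subseteq> sorts (Meq M)" and ys: "set ys \<subseteq> sorts (Meq M)" and \<phi>: "formula (Meq M) (xs @ ys) \<phi>"
  shows "tame M (flat ys) (\<lambda>c. heq (xs, solutions (Meq M) xs \<phi> (proj ys c)))"
proof -
  have "dfn M (flat xs @ flat ys) (\<lambda>u. sat (Meq M) (proj (xs @ ys) u) \<phi>)"
    using formula_translation[OF \<phi>] xs ys by simp
  from tame_weigh[OF xs set_flat[OF ys] this] show ?thesis
  proof (rule tame_cong)
    fix c assume "c \<in> tuples M (flat ys)"
    then show "weigh xs (\<lambda>v. sat (Meq M) (proj (xs @ ys) (v @ c)) \<phi>) = heq (xs, solutions (Meq M) xs \<phi> (proj ys c))"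
      unfolding heq_simp
      by (intro weigh_cong) (simp add: solutions_def proj_append length_tuples proj_in_tuples)
  qed
qed

lemma heq_fibres:
  assumes p: "definable_function (Meq M) (xs, X) (ys, Y) p" and f: "f \<in> carrier T"
    and fib: "\<And>a. a \<in> Y \<Longrightarrow> heq (xs, {x \<in> X. p x = a}) = f"
  shows "heq (xs, X) = f \<otimes>\<^bsub>T\<^esub> heq (ys, Y)"
proof -
  let ?G = "{x @ p x | x. x \<in> X}"
  have D: "(xs, X) \<in> Def (Meq M)" "(ys, Y) \<in> Def (Meq M)" "(xs @ ys, ?G) \<in> Def (Meq M)"
    and pXY: "\<And>x. x \<in> X \<Longrightarrow> p x \<in> Y"
    using p unfolding definable_function_def by auto
  note X = Def_MeqD[OF D(1)] and Y = Def_MeqD[OF D(2)] and G = Def_MeqD[OF D(3)]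
  define R where "R u \<longleftrightarrow> proj (xs @ ys) u \<in> ?G" for u
  have R: "R (v @ w) \<longleftrightarrow> proj xs v \<in> X \<and> p (proj xs v) = proj ys w"
    if "v \<in> tuples M (flat xs)" for v w
  proof -
    have append: "proj (xs @ ys) (v @ w) = proj xs v @ proj ys w"
      by (rule proj_append[OF length_tuples[OF that]])
    show ?thesis
    proof
    assume "R (v @ w)"
    then obtain x where x: "proj xs v @ proj ys w = x @ p x" "x \<in> X"
      by (auto simp: R_def append)
    have "length x = length xs" using x(2) X(2) length_tuples by blast
    then show "proj xs v \<in> X \<and> p (proj xs v) = proj ys w" using x by auto
  next
    assume "proj xs v \<in> X \<and> p (proj xs v) = proj ys w"
    then show "R (v @ w)" unfolding R_def append mem_Collect_eq by (intro exI[of _ "proj xs v"]) simp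
    qed
  qed
  have pdef_R: "pdef M (flat xs @ flat ys) R"
    by (rule pdef_cong[OF G(3)[unfolded flat_simps]]) (simp only: R_def)
  show ?thesis
    unfolding heq_simp
  proof (rule weigh_fibres[OF X(1) Y(1) X(3) Y(3) pdef_R _ _ _ f])
    show "proj xs v \<in> X \<and> proj ys w \<in> Y" if "v \<in> tuples M (flat xs)" "R (v @ w)" for v w
      using that R pXY by metis
    show "\<exists>w \<in> tuples M (flat ys). R (v @ w)" if v: "v \<in> tuples M (flat xs)" "proj xs v \<in> X" for v
    proof -
      have "p (proj xs v) \<in> tuples (Meq M) ys" using pXY[OF v(2)] Y(2) by blast
      then obtain w where "w \<in> tuples M (flat ys)" "p (proj xs v) = proj ys w" by (auto simp: tuples_Meq)
      then show ?thesis using R[OF v(1)] v(2) by blast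
    qed
    show "R (v @ w') \<longleftrightarrow> proj ys w' = proj ys w" if "v \<in> tuples M (flat xs)" "R (v @ w)" for v w w'
      using that R by auto
    show "weigh xs (\<lambda>v. R (v @ w)) = f" if w: "proj ys w \<in> Y" for w
    proof -
      have "weigh xs (\<lambda>v. R (v @ w)) = heq (xs, {x \<in> X. p x = proj ys w})"
        unfolding heq_simp by (rule weigh_cong) (simp add: R)
      then show ?thesis using fib[OF w] by simp
    qed
  qed
qed

theorem measurable_structure_Meq: "measurable_structure (Meq M) T heq"
proof -
  interpret Meq: many_sorted_structure "Meq M" by (rule many_sorted_structure_Meq)
  show ?thesis
  proof
    show "heq \<in> Def (Meq M) \<rightarrow> carrier T"
      using weigh_closed Def_MeqD by (auto simp: heq_simp)
    show "heq (ts, Z) = [card Z] \<cdot>\<^bsub>T\<^esub> \<one>\<^bsub>T\<^esub>" if "(ts, Z) \<in> Def (Meq M)" "finite Z" for ts Z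
      using weigh_finite[OF Def_MeqD(1)[OF that(1)] that(2) Def_MeqD(2)[OF that(1)]] by (simp add: heq_simp)
    show "heq (ts, Z \<union> W) = heq (ts, Z) \<oplus>\<^bsub>T\<^esub> heq (ts, W)"
      if "(ts, Z) \<in> Def (Meq M)" "(ts, W) \<in> Def (Meq M)" "Z \<inter> W = {}" for ts Z W
      using weigh_or[OF Def_MeqD(1,3)[OF that(1)] Def_MeqD(3)[OF that(2)]] that(3)
      by (auto simp: heq_simp)
    fix xs ys :: "('s, 'a) eq_sort list" and \<phi> :: "(('s, 'a) eq_sort, ('s, 'f, 'a) eq_fun, 'r) form"
    assume *: "set xs \<subseteq> sorts (Meq M)" "set ys \<subseteq> sorts (Meq M)" "formula (Meq M) (xs @ ys) \<phi>"
    let ?k = "\<lambda>b. heq (xs, solutions (Meq M) xs \<phi> b)"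
    note tame = heq_family[OF *]
    have "{?k b | b. b \<in> tuples (Meq M) ys} = (\<lambda>c. ?k (proj ys c)) ` tuples M (flat ys)"
      by (auto simp: tuples_Meq)
    then show "finite {?k b | b. b \<in> tuples (Meq M) ys}" using tame by (simp add: tame_def)
    show "(ys, {b \<in> tuples (Meq M) ys. ?k b = f}) \<in> Def0 (Meq M)" for f
      by (rule Def0_CollectI[OF *(2)]) (simp add: dfn_Meq_iff[OF *(2)] tame_dfn[OF tame])
  next
    show "heq (xs, X) = f \<otimes>\<^bsub>T\<^esub> heq (ys, Y)"
      if "definable_function (Meq M) (xs, X) (ys, Y) p" "f \<in> carrier T"
        "\<And>a. a \<in> Y \<Longrightarrow> heq (xs, {x \<in> X. p x = a}) = f" for xs X ys Y p f
      using that by (rule heq_fibres)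
  qed
qed

end

theorem proposition5p2p7:
  fixes M :: "('s, 'f, 'r, 'a) struct"
  assumes "generalised_measurable TYPE('v) M"
  shows "generalised_measurable TYPE('v) (Meq M)"
proof -
  obtain S :: "'v ord_ring" and h where "measurable_structure M S h"
    using assms unfolding generalised_measurable_def by blast
  then interpret measurable_structure M S h .
  obtain T :: "'v ord_ring" and quo where "fraction_map S T quo"
    by (rule fraction_semiring)
  then interpret imaginary_measure M S h T quo
    by (intro imaginary_measure.intro measurable_structure_axioms)
  show ?thesis
    unfolding generalised_measurable_def using measurable_structure_Meq by blast
qed

end
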